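(* Let $d\ge 1$ and $r\in\{1,\ldots,d\}$. Let $\{X_i, i\in\mathbb{Z}\}$ be a stationary sequence of standard (mean 0, variance 1) Gaussian random variables (a stationary Gaussian sequence) with covariance function $r_n=E(X_1X_{n+1})$, and let $\{O_{id}^{(r)}(X), i\in\mathbb{Z}\}$ be the sequence of Gaussian $r$-th order statistics generated by $X$, with first crossing point $\Upsilon(O_X^{(r)})$ and last exit time $\tau(O_X^{(r)})$ (all defined in the context; they depend on $\beta>0$). Suppose $$r_n\ln n\to 0\quad\text{as } n\to\infty .$$ Then for any $x,y\in\mathbb{R}$ $$\lim_{\beta\to0}P\left(\Upsilon(O_{X}^{(r)})\geq-u_{\beta}(x),\ \tau(O_{X}^{(r)})\leq u_{\beta}(y)\right)=\exp\left(-(e^{-x}+e^{-y})\right)$$ and $$\lim_{\beta\to0}P\left(\Upsilon(O_{X}^{(r)})\geq-u_{\beta}(x)\right)=\lim_{\beta\to0}P\left(\tau(O_{X}^{(r)})\leq u_{\beta}(x)\right)=\exp(-e^{-x}),$$ where $$u_{\beta}(x)=\left(a(\beta,r)+\frac{x}{r\,a(\beta,r)}\right)\beta^{-1},$$ $$a(\beta,r)=\sqrt{\frac{2}{r}\left(\ln\beta^{-1}-\frac{r+1}{2}\ln\left(\frac{2}{r}\ln\beta^{-1}\right)+\ln\left(C_{d}^{r}r^{-1}(2\pi)^{-r/2}\right)\right)},\qquad C_d^r=\frac{d!}{r!(d-r)!}.$$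
   Context: Order statistics: let $\{X_{ij}, i\in\mathbb{Z}\}$, $j=1,\ldots,d$, be independent copies of the sequence $\{X_i,i\in\mathbb{Z}\}$. For each $i\in\mathbb{Z}$, the order statistics of $X_{i1},\ldots,X_{id}$ are arranged in decreasing order: $$O_{id}^{(d)}(X)=\min_{1\le j\le d}X_{ij}\le\cdots\le O_{id}^{(r)}(X)\le\cdots\le O_{id}^{(1)}(X)=\max_{1\le j\le d}X_{ij},$$ so $O_{id}^{(r)}(X)$ is the $r$-th largest of $X_{i1},\ldots,X_{id}$. For $\beta>0$, the first crossing point and the last exit time are $$\Upsilon(O_{X}^{(r)})=\min\{i\in\mathbb{Z}: O_{id}^{(r)}(X)>-\beta i\},\qquad \tau(O_{X}^{(r)})=\max\{i\geq 0: O_{id}^{(r)}(X)>\beta i\}$$ ($i$ ranging over integers), which are almost surely finite; if the set defining $\tau$ is empty, $\tau$ is taken to be $0$. The limit $\beta\to0$ is through positive values, and $a(\beta,r)$ is considered for $\beta$ small enough that it is well defined and positive. The integer $r$ (order-statistic index) is unrelated to the covariances $r_n$. *)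

theory Defs
  imports "HOL-Probability.Probability"
begin

section \<open>Stationary Gaussian sequences\<close>

text \<open>A Gaussian random variable is allowed to be degenerate, since linear combinations of
  the members of a Gaussian sequence may have variance zero.\<close>

definition gaussian_rv :: "'a measure \<Rightarrow> ('a \<Rightarrow> real) \<Rightarrow> bool" where
  "gaussian_rv M Z \<longleftrightarrow> Z \<in> borel_measurable M \<and>
     ((\<exists>\<mu>. AE \<omega> in M. Z \<omega> = \<mu>) \<or>
      (\<exists>\<mu> \<sigma>. 0 < \<sigma> \<and> distributed M lborel Z (normal_density \<mu> \<sigma>)))"

text \<open>Joint normality of the finite-dimensional distributions, expressed by linear
  combinations.\<close>

definition gaussian_seq :: "'a measure \<Rightarrow> (int \<Rightarrow> 'a \<Rightarrow> real) \<Rightarrow> bool" where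
  "gaussian_seq M X \<longleftrightarrow>
     (\<forall>I c. finite I \<longrightarrow> gaussian_rv M (\<lambda>\<omega>. \<Sum>i\<in>I. c i * X i \<omega>))"

abbreviation seq_space :: "(int \<Rightarrow> real) measure" where
  "seq_space \<equiv> Pi\<^sub>M UNIV (\<lambda>_. borel)"

definition seq_law :: "'a measure \<Rightarrow> (int \<Rightarrow> 'a \<Rightarrow> real) \<Rightarrow> (int \<Rightarrow> real) measure" where
  "seq_law M X = distr M seq_space (\<lambda>\<omega> i. X i \<omega>)"

definition stationary_seq :: "'a measure \<Rightarrow> (int \<Rightarrow> 'a \<Rightarrow> real) \<Rightarrow> bool" where
  "stationary_seq M X \<longleftrightarrow> (\<forall>i. X i \<in> borel_measurable M) \<and>
     (\<forall>k. seq_law M (\<lambda>i. X (i + k)) = seq_law M X)"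

definition standard_seq :: "'a measure \<Rightarrow> (int \<Rightarrow> 'a \<Rightarrow> real) \<Rightarrow> bool" where
  "standard_seq M X \<longleftrightarrow>
     (\<forall>i. prob_space.expectation M (X i) = 0 \<and> prob_space.variance M (X i) = 1)"

text \<open>For a centred stationary sequence this is the covariance at lag \<open>n\<close>.\<close>

definition cov_fun :: "'a measure \<Rightarrow> (int \<Rightarrow> 'a \<Rightarrow> real) \<Rightarrow> nat \<Rightarrow> real" where
  "cov_fun M X n = prob_space.expectation M (\<lambda>\<omega>. X 1 \<omega> * X (int n + 1) \<omega>)"

text \<open>\<open>Y j i\<close> is the \<open>i\<close>-th member of the \<open>j\<close>-th copy, for \<open>j = 1, \<dots>, d\<close>. Independence is
  between whole sequences.\<close>

definition independent_copies ::
  "'a measure \<Rightarrow> (int \<Rightarrow> 'a \<Rightarrow> real) \<Rightarrow> nat \<Rightarrow> (nat \<Rightarrow> int \<Rightarrow> 'a \<Rightarrow> real) \<Rightarrow> bool" where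
  "independent_copies M X d Y \<longleftrightarrow>
     prob_space.indep_vars M (\<lambda>_. seq_space) (\<lambda>j \<omega> i. Y j i \<omega>) {1..d} \<and>
     (\<forall>j\<in>{1..d}. seq_law M (Y j) = seq_law M X)"

section \<open>Order statistics, first crossing point and last exit time\<close>

text \<open>The \<open>r\<close>-th largest of \<open>Y 1 i \<omega>, \<dots>, Y d i \<omega>\<close>, for \<open>1 \<le> r \<le> d\<close>.\<close>

definition order_stat ::
  "(nat \<Rightarrow> int \<Rightarrow> 'a \<Rightarrow> real) \<Rightarrow> nat \<Rightarrow> nat \<Rightarrow> int \<Rightarrow> 'a \<Rightarrow> real" where
  "order_stat Y d r i \<omega> = rev (sort (map (\<lambda>j. Y j i \<omega>) [1..<d + 1])) ! (r - 1)"

text \<open>Both times are extended-real valued, so that they are defined also on the exceptional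
  null set where the minimum or maximum does not exist. The lemmas below show that they are
  the minimum and maximum whenever these exist.\<close>

definition first_crossing :: "(int \<Rightarrow> 'a \<Rightarrow> real) \<Rightarrow> real \<Rightarrow> 'a \<Rightarrow> ereal" where
  "first_crossing Z \<beta> \<omega> =
     (INF i\<in>{i::int. Z i \<omega> > - \<beta> * of_int i}. ereal (of_int i))"

definition last_exit :: "(int \<Rightarrow> 'a \<Rightarrow> real) \<Rightarrow> real \<Rightarrow> 'a \<Rightarrow> ereal" where
  "last_exit Z \<beta> \<omega> =
     (if {i::int. i \<ge> 0 \<and> Z i \<omega> > \<beta> * of_int i} = {} then 0
      else SUP i\<in>{i::int. i \<ge> 0 \<and> Z i \<omega> > \<beta> * of_int i}. ereal (of_int i))"

lemma first_crossing_eq_min: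
  assumes "Z i \<omega> > - \<beta> * of_int i"
    and "\<And>k. Z k \<omega> > - \<beta> * of_int k \<Longrightarrow> i \<le> k"
  shows "first_crossing Z \<beta> \<omega> = ereal (of_int i)"
  unfolding first_crossing_def using assms by (intro INF_eqI) auto

lemma last_exit_eq_max:
  assumes "i \<ge> 0" "Z i \<omega> > \<beta> * of_int i"
    and "\<And>k. k \<ge> 0 \<Longrightarrow> Z k \<omega> > \<beta> * of_int k \<Longrightarrow> k \<le> i"
  shows "last_exit Z \<beta> \<omega> = ereal (of_int i)"
proof -
  have "(SUP i\<in>{i::int. i \<ge> 0 \<and> Z i \<omega> > \<beta> * of_int i}. ereal (of_int i)) = ereal (of_int i)"
    using assms by (intro SUP_eqI) auto
  then show ?thesis
    using assms(1,2) by (auto simp: last_exit_def)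
qed

section \<open>Normalisation\<close>

definition norm_a :: "nat \<Rightarrow> nat \<Rightarrow> real \<Rightarrow> real" where
  "norm_a d r \<beta> = sqrt (2 / real r *
     (ln (1 / \<beta>) - (real r + 1) / 2 * ln (2 / real r * ln (1 / \<beta>))
      + ln (real (d choose r) / real r * (2 * pi) powr (- real r / 2))))"

definition norm_u :: "nat \<Rightarrow> nat \<Rightarrow> real \<Rightarrow> real \<Rightarrow> real" where
  "norm_u d r \<beta> x = (norm_a d r \<beta> + x / (real r * norm_a d r \<beta>)) / \<beta>"

end

theory Submission
  imports Defs "HOL-Real_Asymp.Real_Asymp"
begin

text \<open>
  Both events say that the order statistics stay below a moving line: \<open>\<tau> \<le> u(y)\<close> means that no
  index \<open>i > u(y)\<close> has an order statistic above \<open>\<beta> i\<close>, and \<open>\<Upsilon> \<ge> - u(x)\<close> means that no index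
  \<open>i < - u(x)\<close> has one above \<open>\<beta> \<bar>i\<bar>\<close>. An index with \<open>\<beta> \<bar>i\<bar> = v\<close> exceeds its level with
  probability close to \<open>C v^(-r) exp (- r v^2 / 2)\<close>. Summed along the line these probabilities form
  a Riemann sum, and \<open>a(\<beta>, r)\<close> is chosen so that the part beyond \<open>u(z)\<close> tends to \<open>exp (- z)\<close>
  (\<open>window_sum_limit\<close>). The theorem says that the number of exceedances is asymptotically Poisson,
  in the sense that the probability of having none tends to \<open>exp\<close> of minus the limiting mean.

  The indices are scanned from left to right. If \<open>A\<close> is the event that no earlier index exceeds its
  level and \<open>E\<close> is the exceedance at the current index, then the probability of no exceedance at all
  is the product of the \<open>1 - P(E)\<close> up to the sum of the errors \<open>\<bar>P(A \<inter> E) - P(A) P(E)\<bar>\<close>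
  (\<open>no_event_approx_product\<close>). So it is enough that each single exceedance is almost independent of
  its past.

  The past within distance \<open>L = exp (\<epsilon> a^2)\<close> is harmless: correlations at non-zero lags are bounded
  by some \<open>\<delta> < 1\<close> (\<open>correlation_bounded_away\<close>), hence two different indices rarely exceed
  together (\<open>joint_exceedance\<close>), and for small \<open>\<epsilon>\<close> the number of close pairs does not make up for
  it.

  The past at distance more than \<open>L\<close> is decoupled exactly. In each column, write
  \<open>Y l = \<rho> Y i + V l\<close> where \<open>\<rho>\<close> is the correlation of \<open>Y l\<close> and \<open>Y i\<close>. The family of all residuals
  \<open>V l\<close> is independent of \<open>Y i\<close>, and unless \<open>Y i\<close> is unusually large the replacement of \<open>Y\<close> by \<open>V\<close>
  moves every order statistic by at most \<open>\<eta> = \<bar>\<rho>\<bar> (r + 1) a\<close>. As \<open>ln L\<close> is of order \<open>a^2\<close>, the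
  condition on \<open>\<rho> n ln n\<close> gives \<open>\<eta> a \<rightarrow> 0\<close>, and the expected number of exceedances hardly changes
  when all levels are shifted by \<open>o(1 / a)\<close>. This is \<open>mixing_estimate\<close>, the heart of the proof; it
  needs the joint law of the sequence only through the independence of uncorrelated Gaussian
  families, which follows from the uniqueness theorem for characteristic functions in finite
  dimension (\<open>finite_dim_char_uniqueness\<close>).

  Since \<open>\<beta>\<close> lies between \<open>exp (- r a^2 / 2 - a)\<close> and \<open>exp (- r a^2 / 2)\<close>, all error terms become
  explicit functions of \<open>a\<close> that decay like the exponential of a negative multiple of \<open>a^2\<close>, or
  are controlled by \<open>\<eta> a\<close>.
\<close>

section \<open>Order statistics and counts of exceedances\<close>

lemma rev_sort_nth_gt_iff:
  fixes xs :: "real list"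
  assumes r: "1 \<le> r" "r \<le> length xs"
  shows "rev (sort xs) ! (r - 1) > u \<longleftrightarrow> r \<le> length (filter (\<lambda>x. u < x) xs)"
proof -
  define ys where "ys = sort xs"
  define n where "n = length xs"
  have n: "length ys = n" and srt: "sorted ys"
    by (auto simp: ys_def n_def)
  have "mset (filter (\<lambda>x. u < x) ys) = mset (filter (\<lambda>x. u < x) xs)"
    by (simp add: ys_def)
  then have "length (filter (\<lambda>x. u < x) xs) = length (filter (\<lambda>x. u < x) ys)"
    by (metis size_mset)
  also have "\<dots> = card {i. i < n \<and> u < ys ! i}"
    by (simp add: length_filter_conv_card n)
  finally have len: "length (filter (\<lambda>x. u < x) xs) = card {i. i < n \<and> u < ys ! i}" .
  have nth: "rev (sort xs) ! (r - 1) = ys ! (n - r)"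
    using r by (simp add: rev_nth ys_def[symmetric] n n_def[symmetric])
  show ?thesis
  proof
    assume "rev (sort xs) ! (r - 1) > u"
    then have gt: "u < ys ! (n - r)" by (simp only: nth)
    have "{n - r..<n} \<subseteq> {i. i < n \<and> u < ys ! i}"
      using gt sorted_nth_mono[OF srt] n by (fastforce intro: less_le_trans)
    from card_mono[OF _ this] show "r \<le> length (filter (\<lambda>x. u < x) xs)"
      using r by (simp add: len n_def)
  next
    assume *: "r \<le> length (filter (\<lambda>x. u < x) xs)"
    show "rev (sort xs) ! (r - 1) > u"
    proof (rule ccontr)
      assume "\<not> ?thesis"
      then have le: "ys ! (n - r) \<le> u" by (simp only: nth not_less)
      have "{i. i < n \<and> u < ys ! i} \<subseteq> {n - r<..<n}"
      proof
        fix i assume i: "i \<in> {i. i < n \<and> u < ys ! i}"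
        have "\<not> i \<le> n - r"
          using sorted_nth_mono[OF srt, of i "n - r"] i le r n by fastforce
        with i show "i \<in> {n - r<..<n}" by auto
      qed
      from card_mono[OF _ this] have "card {i. i < n \<and> u < ys ! i} \<le> r - 1"
        using r by (simp add: n_def)
      with * len r show False by simp
    qed
  qed
qed

text \<open>Counting the entries above a level, instead of sorting them, makes monotonicity and
  measurability of order statistics immediate.\<close>

definition exceeds :: "nat \<Rightarrow> nat \<Rightarrow> real \<Rightarrow> (nat \<Rightarrow> real) \<Rightarrow> bool" where
  "exceeds d r v f \<longleftrightarrow> r \<le> card {j\<in>{1..d}. v < f j}"

lemma order_stat_gt_iff:
  assumes "1 \<le> r" "r \<le> d"
  shows "order_stat Y d r i \<omega> > u \<longleftrightarrow> exceeds d r u (\<lambda>j. Y j i \<omega>)"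
proof -
  have "length (filter (\<lambda>x. u < x) (map (\<lambda>j. Y j i \<omega>) [1..<d + 1]))
      = length (filter (\<lambda>j. u < Y j i \<omega>) [1..<d + 1])"
    by (simp add: filter_map o_def)
  also have "\<dots> = card (set (filter (\<lambda>j. u < Y j i \<omega>) [1..<d + 1]))"
    by (rule distinct_card[symmetric]) simp
  also have "set (filter (\<lambda>j. u < Y j i \<omega>) [1..<d + 1]) = {j\<in>{1..d}. u < Y j i \<omega>}"
    by auto
  finally show ?thesis
    unfolding order_stat_def exceeds_def using assms by (subst rev_sort_nth_gt_iff) auto
qed

lemma exceeds_mono:
  assumes "exceeds d r v f" "\<And>j. j \<in> {1..d} \<Longrightarrow> v < f j \<Longrightarrow> v' < g j"
  shows "exceeds d r v' g"
proof -
  have "card {j\<in>{1..d}. v < f j} \<le> card {j\<in>{1..d}. v' < g j}"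
    using assms(2) by (intro card_mono) auto
  then show ?thesis using assms(1) by (simp add: exceeds_def)
qed

lemma exceeds_iff_sum:
  "exceeds d r v f \<longleftrightarrow> real r \<le> (\<Sum>j\<in>{1..d}. indicator {v<..} (f j))"
proof -
  have "(\<Sum>j\<in>{1..d}. indicator {v<..} (f j)) = (\<Sum>j\<in>{1..d}. of_bool (v < f j) :: real)"
    by (intro sum.cong) auto
  also have "\<dots> = real (card {j\<in>{1..d}. v < f j})" by (simp add: Int_def)
  finally show ?thesis by (simp add: exceeds_def)
qed

lemma exceeds_measurable [measurable]:
  assumes [measurable]: "\<And>j. j \<in> {1..d} \<Longrightarrow> f j \<in> borel_measurable N"
  shows "Measurable.pred N (\<lambda>x. exceeds d r v (\<lambda>j. f j x))"
  unfolding exceeds_iff_sum by measurable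

lemma exceeds_subset:
  assumes "exceeds d r v f"
  obtains J where "J \<subseteq> {1..d}" "card J = r" "\<And>j. j \<in> J \<Longrightarrow> v < f j"
proof -
  obtain J where "J \<subseteq> {j\<in>{1..d}. v < f j}" "card J = r"
    using assms obtain_subset_with_card_n unfolding exceeds_def by metis
  then show ?thesis using that[of J] by blast
qed

lemma exceedsI:
  assumes "J \<subseteq> {1..d}" "card J = r" "\<And>j. j \<in> J \<Longrightarrow> v < f j"
  shows "exceeds d r v f"
proof -
  have "card J \<le> card {j\<in>{1..d}. v < f j}" using assms by (intro card_mono) auto
  then show ?thesis using assms by (simp add: exceeds_def)
qed

section \<open>Finite-dimensional laws and characteristic functions\<close>

text \<open>A bounded non-negative weight turns the law of \<open>V\<close> into another finite measure, and the weighted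
  integrals of \<open>iexp (t * V)\<close> are its characteristic function up to the total mass. The
  one-dimensional uniqueness theorem therefore applies to weighted laws.\<close>

lemma positive_weight_uniqueness:
  fixes f V :: "'a \<Rightarrow> real" and f' V' :: "'b \<Rightarrow> real"
  assumes M: "prob_space M" and N: "prob_space N"
    and [measurable]: "f \<in> borel_measurable M" "V \<in> borel_measurable M"
      "f' \<in> borel_measurable N" "V' \<in> borel_measurable N" "B \<in> sets borel"
    and f: "\<And>x. 0 \<le> f x" "\<And>x. f x \<le> c" and f': "\<And>x. 0 \<le> f' x" "\<And>x. f' x \<le> c"
    and pos: "0 < (\<integral>x. f x \<partial>M)"
    and eq: "\<And>t. (CLINT x|M. f x * iexp (t * V x)) = (CLINT x|N. f' x * iexp (t * V' x))"
  shows "(\<integral>x. f x * indicator B (V x) \<partial>M) = (\<integral>x. f' x * indicator B (V' x) \<partial>N)"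
proof -
  interpret M: prob_space M by fact
  interpret N: prob_space N by fact
  define m where "m = (\<integral>x. f x \<partial>M)"
  have m: "0 < m" using pos by (simp add: m_def)
  have intf: "integrable M f"
    by (rule M.integrable_const_bound[where B=c]) (use f in auto)
  have intf': "integrable N f'"
    by (rule N.integrable_const_bound[where B=c]) (use f' in auto)
  have "complex_of_real (\<integral>x. f x \<partial>M) = complex_of_real (\<integral>x. f' x \<partial>N)"
    using eq[of 0] by simp
  then have m': "(\<integral>x. f' x \<partial>N) = m" by (simp add: m_def)
  define P where "P = distr (density M (\<lambda>x. ennreal (f x / m))) borel V"
  define Q where "Q = distr (density N (\<lambda>x. ennreal (f' x / m))) borel V'"
  have "prob_space (density M (\<lambda>x. ennreal (f x / m)))"
  proof
    show "emeasure (density M (\<lambda>x. ennreal (f x / m))) (space (density M (\<lambda>x. ennreal (f x / m)))) = 1"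
      using f m intf
      by (simp add: emeasure_density nn_integral_eq_integral m_def)
  qed
  then interpret P: prob_space "density M (\<lambda>x. ennreal (f x / m))" .
  have "prob_space (density N (\<lambda>x. ennreal (f' x / m)))"
  proof
    show "emeasure (density N (\<lambda>x. ennreal (f' x / m))) (space (density N (\<lambda>x. ennreal (f' x / m)))) = 1"
      using f' m intf' m'
      by (simp add: emeasure_density nn_integral_eq_integral)
  qed
  then interpret Q: prob_space "density N (\<lambda>x. ennreal (f' x / m))" .
  have "P = Q"
  proof (rule Levy_uniqueness)
    show "real_distribution P" "real_distribution Q"
      unfolding P_def Q_def by simp_all
    show "char P = char Q"
    proof
      fix t
      have "char P t = (CLINT x|M. (f x / m) *\<^sub>R iexp (t * V x))"
        unfolding char_def P_def using f m
        by (subst integral_distr) (auto simp: integral_density)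
      also have "\<dots> = (CLINT x|M. f x * iexp (t * V x)) / m"
        by (simp add: scaleR_conv_of_real)
      also have "\<dots> = (CLINT x|N. f' x * iexp (t * V' x)) / m"
        by (simp only: eq)
      also have "\<dots> = (CLINT x|N. (f' x / m) *\<^sub>R iexp (t * V' x))"
        by (simp add: scaleR_conv_of_real)
      also have "\<dots> = char Q t"
        unfolding char_def Q_def using f' m
        by (subst integral_distr) (auto simp: integral_density)
      finally show "char P t = char Q t" .
    qed
  qed
  have "(\<integral>x. f x * indicator B (V x) \<partial>M) = m * (\<integral>x. (f x / m) *\<^sub>R indicator B (V x) \<partial>M)"
    using m by simp
  also have "(\<integral>x. (f x / m) *\<^sub>R (indicator B (V x)::real) \<partial>M) = (\<integral>x. indicator B x \<partial>P)"
    unfolding P_def using f m by (subst integral_distr) (auto simp: integral_density)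
  also have "\<dots> = (\<integral>x. indicator B x \<partial>Q)" by (simp add: \<open>P = Q\<close>)
  also have "\<dots> = (\<integral>x. (f' x / m) *\<^sub>R (indicator B (V' x)::real) \<partial>N)"
    unfolding Q_def using f' m by (subst integral_distr) (auto simp: integral_density)
  also have "m * \<dots> = (\<integral>x. f' x * indicator B (V' x) \<partial>N)"
    using m by simp
  finally show ?thesis .
qed

text \<open>The real part of a complex weight \<open>w\<close> with \<open>\<bar>w\<bar> \<le> 1\<close> becomes a positive weight after adding the
  constant \<open>2\<close>, and its transform is obtained from that of \<open>w\<close> at \<open>t\<close> and at \<open>- t\<close>.\<close>

lemma real_part_weight_uniqueness:
  fixes w :: "'a \<Rightarrow> complex" and V :: "'a \<Rightarrow> real"
    and w' :: "'b \<Rightarrow> complex" and V' :: "'b \<Rightarrow> real"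
  assumes M: "prob_space M" and N: "prob_space N"
    and [measurable]: "w \<in> borel_measurable M" "V \<in> borel_measurable M"
      "w' \<in> borel_measurable N" "V' \<in> borel_measurable N" "B \<in> sets borel"
    and w: "\<And>x. norm (w x) \<le> 1" and w': "\<And>x. norm (w' x) \<le> 1"
    and law: "\<And>t. (CLINT x|M. iexp (t * V x)) = (CLINT x|N. iexp (t * V' x))"
    and eq: "\<And>t. (CLINT x|M. w x * iexp (t * V x)) = (CLINT x|N. w' x * iexp (t * V' x))"
  shows "(\<integral>x. Re (w x) * indicator B (V x) \<partial>M) = (\<integral>x. Re (w' x) * indicator B (V' x) \<partial>N)"
proof -
  interpret M: prob_space M by fact
  interpret N: prob_space N by fact
  have i1: "integrable M (\<lambda>x. w x * iexp (t * V x))" for t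
    by (rule M.integrable_const_bound[where B=1]) (use w in \<open>auto simp: norm_mult\<close>)
  have i1': "integrable N (\<lambda>x. w' x * iexp (t * V' x))" for t
    by (rule N.integrable_const_bound[where B=1]) (use w' in \<open>auto simp: norm_mult\<close>)
  have i2: "integrable M (\<lambda>x. iexp (t * V x))" for t
    by (rule M.integrable_const_bound[where B=1]) auto
  have i2': "integrable N (\<lambda>x. iexp (t * V' x))" for t
    by (rule N.integrable_const_bound[where B=1]) auto
  have bd: "\<bar>Re (w x)\<bar> \<le> 1" for x using abs_Re_le_cmod[of "w x"] w[of x] by linarith
  have bd': "\<bar>Re (w' x)\<bar> \<le> 1" for x using abs_Re_le_cmod[of "w' x"] w'[of x] by linarith
  have iw: "integrable M (\<lambda>x. Re (w x))"
    by (rule M.integrable_const_bound[where B=1]) (use bd in auto)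
  have iw': "integrable N (\<lambda>x. Re (w' x))"
    by (rule N.integrable_const_bound[where B=1]) (use bd' in auto)
  have iv: "integrable M (\<lambda>x. indicator B (V x) :: real)"
    by (rule M.integrable_const_bound[where B=1]) (auto simp: indicator_def)
  have iv': "integrable N (\<lambda>x. indicator B (V' x) :: real)"
    by (rule N.integrable_const_bound[where B=1]) (auto simp: indicator_def)
  have iwv: "integrable M (\<lambda>x. Re (w x) * indicator B (V x) :: real)"
    by (rule M.integrable_const_bound[where B=1]) (use bd in \<open>auto simp: indicator_def\<close>)
  have iwv': "integrable N (\<lambda>x. Re (w' x) * indicator B (V' x) :: real)"
    by (rule N.integrable_const_bound[where B=1]) (use bd' in \<open>auto simp: indicator_def\<close>)
  have iwe: "integrable M (\<lambda>x. Re (w x) * iexp (t * V x))" for t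
    by (rule M.integrable_const_bound[where B=1]) (use bd in \<open>auto simp: norm_mult\<close>)
  have iwe': "integrable N (\<lambda>x. Re (w' x) * iexp (t * V' x))" for t
    by (rule N.integrable_const_bound[where B=1]) (use bd' in \<open>auto simp: norm_mult\<close>)
  \<comment> \<open>The transform of the real part is a combination of the transforms of the weight at \<open>t\<close> and \<open>- t\<close>.\<close>
  have re: "complex_of_real (Re z) * iexp (t * v) = (z * iexp (t * v) + cnj (z * iexp ((- t) * v))) / 2"
    for z t v
    by (simp add: exp_cnj complex_eq_iff field_simps)
  have Rew: "(CLINT x|M. Re (w x) * iexp (t * V x)) = (CLINT x|N. Re (w' x) * iexp (t * V' x))" for t
  proof -
    have "(CLINT x|M. Re (w x) * iexp (t * V x))
        = ((CLINT x|M. w x * iexp (t * V x)) + cnj (CLINT x|M. w x * iexp ((- t) * V x))) / 2"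
      unfolding re
      by (simp only: integral_divide_zero Bochner_Integration.integral_cnj
          Bochner_Integration.integral_add[OF i1 integrable_cnj[OF i1]])
    also have "\<dots> = ((CLINT x|N. w' x * iexp (t * V' x)) + cnj (CLINT x|N. w' x * iexp ((- t) * V' x))) / 2"
      by (simp only: eq)
    also have "\<dots> = (CLINT x|N. Re (w' x) * iexp (t * V' x))"
      unfolding re
      by (simp only: integral_divide_zero Bochner_Integration.integral_cnj
          Bochner_Integration.integral_add[OF i1' integrable_cnj[OF i1']])
    finally show ?thesis .
  qed
  have "(\<integral>x. (2 + Re (w x)) * indicator B (V x) \<partial>M) = (\<integral>x. (2 + Re (w' x)) * indicator B (V' x) \<partial>N)"
  proof (rule positive_weight_uniqueness[OF M N, where c=3])
    show "0 \<le> 2 + Re (w x)" "2 + Re (w x) \<le> 3" for x using bd[of x] by linarith+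
    show "0 \<le> 2 + Re (w' x)" "2 + Re (w' x) \<le> 3" for x using bd'[of x] by linarith+
    have "(\<integral>x. - 1 \<partial>M) \<le> (\<integral>x. Re (w x) \<partial>M)"
    proof (rule integral_mono)
      show "- 1 \<le> Re (w x)" for x using bd[of x] by linarith
    qed (use iw in auto)
    then show "0 < (\<integral>x. 2 + Re (w x) \<partial>M)"
      using iw by (simp add: M.prob_space)
    show "(CLINT x|M. complex_of_real (2 + Re (w x)) * iexp (t * V x)) = (CLINT x|N. complex_of_real (2 + Re (w' x)) * iexp (t * V' x))" for t
      using i2[of t] i2'[of t] iwe[of t] iwe'[of t] Rew[of t] law[of t]
      by (simp add: ring_distribs)
  qed measurable
  moreover have "(\<integral>x. 1 * (indicator B (V x) :: real) \<partial>M) = (\<integral>x. 1 * indicator B (V' x) \<partial>N)"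
    by (rule positive_weight_uniqueness[OF M N, where c=1]) (use law in \<open>auto simp: M.prob_space\<close>)
  ultimately show ?thesis
    using iv iv' iwv iwv' by (simp add: ring_distribs)
qed

text \<open>Applied to \<open>w\<close> and to \<open>- \<i> * w\<close>, the previous lemma gives the real and the imaginary part.\<close>

lemma weight_uniqueness:
  fixes w :: "'a \<Rightarrow> complex" and V :: "'a \<Rightarrow> real"
    and w' :: "'b \<Rightarrow> complex" and V' :: "'b \<Rightarrow> real"
  assumes M: "prob_space M" and N: "prob_space N"
    and [measurable]: "w \<in> borel_measurable M" "V \<in> borel_measurable M"
      "w' \<in> borel_measurable N" "V' \<in> borel_measurable N" "B \<in> sets borel"
    and w: "\<And>x. norm (w x) \<le> 1" and w': "\<And>x. norm (w' x) \<le> 1"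
    and law: "\<And>t. (CLINT x|M. iexp (t * V x)) = (CLINT x|N. iexp (t * V' x))"
    and eq: "\<And>t. (CLINT x|M. w x * iexp (t * V x)) = (CLINT x|N. w' x * iexp (t * V' x))"
  shows "(CLINT x|M. w x * of_real (indicator B (V x))) = (CLINT x|N. w' x * of_real (indicator B (V' x)))"
proof -
  interpret M: prob_space M by fact
  interpret N: prob_space N by fact
  have i: "integrable M (\<lambda>x. w x * of_real (indicator B (V x)))"
    by (rule M.integrable_const_bound[where B=1]) (use w in \<open>auto simp: norm_mult indicator_def\<close>)
  have i': "integrable N (\<lambda>x. w' x * of_real (indicator B (V' x)))"
    by (rule N.integrable_const_bound[where B=1]) (use w' in \<open>auto simp: norm_mult indicator_def\<close>)
  have R: "(\<integral>x. Re (w x) * indicator B (V x) \<partial>M) = (\<integral>x. Re (w' x) * indicator B (V' x) \<partial>N)"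
    by (rule real_part_weight_uniqueness[OF M N]) (use w w' law eq in auto)
  have eq2: "(CLINT x|M. (- \<i> * w x) * iexp (t * V x)) = (CLINT x|N. (- \<i> * w' x) * iexp (t * V' x))" for t
    using eq[of t] by (simp add: mult.assoc)
  have I: "(\<integral>x. Re (- \<i> * w x) * indicator B (V x) \<partial>M) = (\<integral>x. Re (- \<i> * w' x) * indicator B (V' x) \<partial>N)"
    by (rule real_part_weight_uniqueness[OF M N _ _ _ _ _ _ _ law eq2]) (use w w' in \<open>auto simp: norm_mult\<close>)
  show ?thesis
  proof (rule complex_eqI)
    show "Re (CLINT x|M. w x * of_real (indicator B (V x))) = Re (CLINT x|N. w' x * of_real (indicator B (V' x)))"
      using i i' R by (simp flip: integral_Re)
    show "Im (CLINT x|M. w x * of_real (indicator B (V x))) = Im (CLINT x|N. w' x * of_real (indicator B (V' x)))"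
      using i i' I by (simp flip: integral_Im)
  qed
qed

text \<open>The exponential factors of the coordinates are replaced by indicators of Borel sets one coordinate
  at a time. In each step the coordinates already replaced, together with the exponentials of those
  still to come, form a bounded complex weight for the current coordinate, so the one-dimensional
  result applies. At the end the two laws agree on all boxes.\<close>

theorem finite_dim_char_uniqueness:
  fixes U :: "'k \<Rightarrow> 'a \<Rightarrow> real" and U' :: "'k \<Rightarrow> 'b \<Rightarrow> real"
  assumes M: "prob_space M" and N: "prob_space N" and K: "finite K"
    and U: "\<And>k. k \<in> K \<Longrightarrow> U k \<in> borel_measurable M"
    and U': "\<And>k. k \<in> K \<Longrightarrow> U' k \<in> borel_measurable N"
    and char: "\<And>t. (CLINT x|M. iexp (\<Sum>k\<in>K. t k * U k x)) = (CLINT x|N. iexp (\<Sum>k\<in>K. t k * U' k x))"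
  shows "distr M (PiM K (\<lambda>_. borel)) (\<lambda>x. \<lambda>k\<in>K. U k x) = distr N (PiM K (\<lambda>_. borel)) (\<lambda>x. \<lambda>k\<in>K. U' k x)"
proof -
  interpret M: prob_space M by fact
  interpret N: prob_space N by fact
  note [measurable] = U U'
  \<comment> \<open>The set \<open>J\<close> contains the coordinates whose exponential has been replaced by an indicator.\<close>
  have step: "(CLINT x|M. of_real (\<Prod>k\<in>J. indicator (A k) (U k x)) * iexp (\<Sum>k\<in>K-J. t k * U k x)) =
        (CLINT x|N. of_real (\<Prod>k\<in>J. indicator (A k) (U' k x)) * iexp (\<Sum>k\<in>K-J. t k * U' k x))"
    if "J \<subseteq> K" and A: "\<And>k. k \<in> K \<Longrightarrow> A k \<in> sets borel" for J A t
    using finite_subset[OF that(1) K] that(1)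
  proof (induction J arbitrary: t rule: finite_induct)
    case empty
    then show ?case using char by simp
  next
    case (insert j J)
    note [measurable] = A
    have jK: "j \<in> K" and sub: "J \<subseteq> K" using insert by auto
    define w where "w x = of_real (\<Prod>k\<in>J. indicator (A k) (U k x)) * iexp (\<Sum>k\<in>K-insert j J. t k * U k x)" for x
    define w' where "w' x = of_real (\<Prod>k\<in>J. indicator (A k) (U' k x)) * iexp (\<Sum>k\<in>K-insert j J. t k * U' k x)" for x
    have split: "(\<Sum>k\<in>K-J. (t(j:=s)) k * F k) = s * F j + (\<Sum>k\<in>K-insert j J. t k * F k)" for s and F :: "'k \<Rightarrow> real"
    proof -
      have KJ: "K - J = insert j (K - insert j J)" using jK insert.hyps by auto
      show ?thesis using K unfolding KJ by (subst sum.insert) auto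
    qed
    have prod01: "\<bar>\<Prod>k\<in>J. indicator (A k) (F k)\<bar> \<le> (1::real)" for F
      unfolding abs_prod by (intro prod_le_1) (auto simp: indicator_def)
    have "(CLINT x|M. w x * of_real (indicator (A j) (U j x))) = (CLINT x|N. w' x * of_real (indicator (A j) (U' j x)))"
    proof (rule weight_uniqueness[OF M N])
      show "w \<in> borel_measurable M" "w' \<in> borel_measurable N"
        unfolding w_def w'_def using sub by (measurable; auto)+
      show "U j \<in> borel_measurable M" "U' j \<in> borel_measurable N" "A j \<in> sets borel" using jK U U' A by auto
      show "norm (w x) \<le> 1" for x unfolding w_def norm_mult using prod01 by (simp del: of_real_prod)
      show "norm (w' x) \<le> 1" for x unfolding w'_def norm_mult using prod01 by (simp del: of_real_prod)
      fix s
      show "(CLINT x|M. iexp (s * U j x)) = (CLINT x|N. iexp (s * U' j x))"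
      proof -
        have "(\<Sum>k\<in>K. (if k = j then s else 0) * F k) = s * F j" for F :: "'k \<Rightarrow> real"
          using K jK by (subst sum.remove[OF K jK]) auto
        with char[of "\<lambda>k. if k = j then s else 0"] show ?thesis by simp
      qed
      have e: "iexp (s * a + b) = iexp b * iexp (s * a)" for a b :: real
        by (simp add: ring_distribs exp_add[symmetric] add.commute)
      have "(CLINT x|M. w x * iexp (s * U j x)) =
        (CLINT x|M. of_real (\<Prod>k\<in>J. indicator (A k) (U k x)) * iexp (\<Sum>k\<in>K-J. (t(j:=s)) k * U k x))"
        unfolding split w_def e by (simp add: mult.assoc)
      also have "\<dots> = (CLINT x|N. of_real (\<Prod>k\<in>J. indicator (A k) (U' k x)) * iexp (\<Sum>k\<in>K-J. (t(j:=s)) k * U' k x))"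
        by (rule insert.IH[OF sub])
      also have "\<dots> = (CLINT x|N. w' x * iexp (s * U' j x))"
        unfolding split w'_def e by (simp add: mult.assoc)
      finally show "(CLINT x|M. w x * iexp (s * U j x)) = (CLINT x|N. w' x * iexp (s * U' j x))" .
    qed
    then show ?case
      using insert.hyps unfolding w_def w'_def by (simp add: mult_ac)
  qed
  let ?P = "PiM K (\<lambda>_. borel :: real measure)"
  show ?thesis
  proof (rule measure_eqI_PiM_finite[OF K])
    show "sets (distr M ?P (\<lambda>x. \<lambda>k\<in>K. U k x)) = sets ?P" "sets (distr N ?P (\<lambda>x. \<lambda>k\<in>K. U' k x)) = sets ?P"
      by simp_all
    have mU: "(\<lambda>x. \<lambda>k\<in>K. U k x) \<in> measurable M ?P" "(\<lambda>x. \<lambda>k\<in>K. U' k x) \<in> measurable N ?P"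
      by (auto intro!: measurable_restrict)
    show "emeasure (distr M ?P (\<lambda>x. \<lambda>k\<in>K. U k x)) (Pi\<^sub>E K A) = emeasure (distr N ?P (\<lambda>x. \<lambda>k\<in>K. U' k x)) (Pi\<^sub>E K A)"
      if A: "\<And>k. k \<in> K \<Longrightarrow> A k \<in> sets borel" for A
    proof -
      note [measurable] = A
      have sA: "Pi\<^sub>E K A \<in> sets ?P" using K A by (intro sets_PiM_I_finite) auto
      have ind: "(\<Prod>k\<in>K. indicator (A k) (F k)) = (indicator (Pi\<^sub>E K A) (restrict F K) :: real)" for F
        using K by (auto simp: indicator_def PiE_iff prod_zero_iff)
      have "complex_of_real (\<integral>x. (\<Prod>k\<in>K. indicator (A k) (U k x)) \<partial>M) = complex_of_real (\<integral>x. (\<Prod>k\<in>K. indicator (A k) (U' k x)) \<partial>N)"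
        using step[of K A, OF subset_refl A] by (simp del: of_real_prod)
      then have e: "(\<integral>x. indicator (Pi\<^sub>E K A) (\<lambda>k\<in>K. U k x) \<partial>M) = (\<integral>x. indicator (Pi\<^sub>E K A) (\<lambda>k\<in>K. U' k x) \<partial>N :: real)"
        by (simp add: ind del: of_real_prod)
      interpret D1: prob_space "distr M ?P (\<lambda>x. \<lambda>k\<in>K. U k x)" using mU by (intro M.prob_space_distr)
      interpret D2: prob_space "distr N ?P (\<lambda>x. \<lambda>k\<in>K. U' k x)" using mU by (intro N.prob_space_distr)
      have "measure (distr M ?P (\<lambda>x. \<lambda>k\<in>K. U k x)) (Pi\<^sub>E K A) = (\<integral>y. indicator (Pi\<^sub>E K A) y \<partial>distr M ?P (\<lambda>x. \<lambda>k\<in>K. U k x))"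
        using sA by simp
      also have "\<dots> = (\<integral>y. indicator (Pi\<^sub>E K A) y \<partial>distr N ?P (\<lambda>x. \<lambda>k\<in>K. U' k x))"
        using sA e by (subst integral_distr[OF mU(1)], simp, subst integral_distr[OF mU(2)], simp_all only:, simp)
      also have "\<dots> = measure (distr N ?P (\<lambda>x. \<lambda>k\<in>K. U' k x)) (Pi\<^sub>E K A)"
        using sA by simp
      finally show ?thesis by (simp add: D1.emeasure_eq_measure D2.emeasure_eq_measure)
    qed
    show "range (\<lambda>_::nat. space ?P) \<subseteq> prod_algebra K (\<lambda>_. borel)"
      using K by (auto simp: space_PiM intro!: prod_algebraI_finite)
    show "(\<Union>i::nat. space ?P) = space ?P" by simp
    show "emeasure (distr M ?P (\<lambda>x. \<lambda>k\<in>K. U k x)) (space ?P) \<noteq> \<infinity>"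
      using mU by (simp add: emeasure_distr)
  qed
qed

text \<open>The vector \<open>(U, V)\<close> is compared with the vector that takes \<open>U\<close> and \<open>V\<close> from two independent copies
  of the probability space. Their characteristic functions agree by the factorization, so their laws
  agree, and the second law is a product.\<close>

lemma (in prob_space) independence_from_char_factorization:
  fixes U :: "'k \<Rightarrow> 'a \<Rightarrow> real" and V :: "'l \<Rightarrow> 'a \<Rightarrow> real"
  assumes K: "finite K" and L: "finite L"
    and U: "\<And>k. k \<in> K \<Longrightarrow> U k \<in> borel_measurable M"
    and V: "\<And>l. l \<in> L \<Longrightarrow> V l \<in> borel_measurable M"
    and fac: "\<And>s t. (CLINT x|M. iexp ((\<Sum>k\<in>K. s k * U k x) + (\<Sum>l\<in>L. t l * V l x)))
      = (CLINT x|M. iexp (\<Sum>k\<in>K. s k * U k x)) * (CLINT x|M. iexp (\<Sum>l\<in>L. t l * V l x))"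
    and A: "A \<in> sets (PiM K (\<lambda>_. borel))" and B: "B \<in> sets (PiM L (\<lambda>_. borel))"
  shows "prob {x\<in>space M. (\<lambda>k\<in>K. U k x) \<in> A \<and> (\<lambda>l\<in>L. V l x) \<in> B}
    = prob {x\<in>space M. (\<lambda>k\<in>K. U k x) \<in> A} * prob {x\<in>space M. (\<lambda>l\<in>L. V l x) \<in> B}"
proof -
  interpret P: pair_prob_space M M ..
  define I where "I = K <+> L"
  define W where "W m x = (case m of Inl k \<Rightarrow> U k x | Inr l \<Rightarrow> V l x)" for m x
  define W' where "W' m z = (case m of Inl k \<Rightarrow> U k (fst z) | Inr l \<Rightarrow> V l (snd z))" for m z
  have I: "finite I" using K L by (simp add: I_def)
  have W: "W m \<in> borel_measurable M" if "m \<in> I" for m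
    using that U V by (auto simp: I_def W_def[abs_def])
  have W': "W' m \<in> borel_measurable (M \<Otimes>\<^sub>M M)" if "m \<in> I" for m
  proof -
    have [measurable]: "k \<in> K \<Longrightarrow> U k \<in> borel_measurable M" "l \<in> L \<Longrightarrow> V l \<in> borel_measurable M" for k l
      using U V by auto
    show ?thesis using that by (auto simp: I_def W'_def[abs_def])
  qed
  note [measurable] = U V
  have sumI: "(\<Sum>m\<in>I. t m * F m) = (\<Sum>k\<in>K. t (Inl k) * F (Inl k)) + (\<Sum>l\<in>L. t (Inr l) * F (Inr l))"
    for t F :: "'k + 'l \<Rightarrow> real"
    using K L by (simp add: I_def sum.Plus)
  have eq: "distr M (PiM I (\<lambda>_. borel)) (\<lambda>x. \<lambda>m\<in>I. W m x) = distr (M \<Otimes>\<^sub>M M) (PiM I (\<lambda>_. borel)) (\<lambda>x. \<lambda>m\<in>I. W' m x)"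
  proof (rule finite_dim_char_uniqueness[OF prob_space_axioms P.prob_space_axioms I W W'])
    fix t :: "'k + 'l \<Rightarrow> real"
    let ?f = "\<lambda>x. iexp (\<Sum>k\<in>K. t (Inl k) * U k x)"
    let ?g = "\<lambda>x. iexp (\<Sum>l\<in>L. t (Inr l) * V l x)"
    have "(CLINT z|M \<Otimes>\<^sub>M M. iexp (\<Sum>m\<in>I. t m * W' m z)) = (CLINT z|M \<Otimes>\<^sub>M M. ?f (fst z) * ?g (snd z))"
      unfolding sumI W'_def by (simp add: exp_add[symmetric] ring_distribs)
    also have "\<dots> = (CLINT x|M. (CLINT y|M. ?f x * ?g y))"
    proof -
      have "integrable (M \<Otimes>\<^sub>M M) (\<lambda>z. ?f (fst z) * ?g (snd z))"
        by (rule P.integrable_const_bound[where B=1]) (auto simp: norm_mult)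
      from P.integral_fst'[OF this] show ?thesis by simp
    qed
    also have "\<dots> = (CLINT x|M. ?f x) * (CLINT y|M. ?g y)"
      by (simp only: integral_mult_right_zero integral_mult_left_zero)
    also have "\<dots> = (CLINT x|M. iexp (\<Sum>m\<in>I. t m * W m x))"
      unfolding sumI W_def by (simp only: sum.case fac)
    finally show "(CLINT x|M. iexp (\<Sum>m\<in>I. t m * W m x)) = (CLINT z|M \<Otimes>\<^sub>M M. iexp (\<Sum>m\<in>I. t m * W' m z))" by simp
  qed
  define C where "C = {f\<in>space (PiM I (\<lambda>_. borel :: real measure)). (\<lambda>k\<in>K. f (Inl k)) \<in> A \<and> (\<lambda>l\<in>L. f (Inr l)) \<in> B}"
  have C: "C \<in> sets (PiM I (\<lambda>_. borel))"
  proof -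
    have [measurable]: "(\<lambda>f. \<lambda>k\<in>K. f (Inl k)) \<in> measurable (PiM I (\<lambda>_. borel)) (PiM K (\<lambda>_. borel :: real measure))"
      by (rule measurable_restrict) (auto simp: I_def intro!: measurable_component_singleton)
    have [measurable]: "(\<lambda>f. \<lambda>l\<in>L. f (Inr l)) \<in> measurable (PiM I (\<lambda>_. borel)) (PiM L (\<lambda>_. borel :: real measure))"
      by (rule measurable_restrict) (auto simp: I_def intro!: measurable_component_singleton)
    note [measurable] = A B
    show ?thesis unfolding C_def by measurable
  qed
  have mW: "(\<lambda>x. \<lambda>m\<in>I. W m x) \<in> measurable M (PiM I (\<lambda>_. borel))"
    by (rule measurable_restrict) (use W in auto)
  have mW': "(\<lambda>x. \<lambda>m\<in>I. W' m x) \<in> measurable (M \<Otimes>\<^sub>M M) (PiM I (\<lambda>_. borel))"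
    by (rule measurable_restrict) (use W' in auto)
  let ?A = "{x\<in>space M. (\<lambda>k\<in>K. U k x) \<in> A}" and ?B = "{x\<in>space M. (\<lambda>l\<in>L. V l x) \<in> B}"
  have mU: "(\<lambda>x. \<lambda>k\<in>K. U k x) \<in> measurable M (PiM K (\<lambda>_. borel))" "(\<lambda>x. \<lambda>l\<in>L. V l x) \<in> measurable M (PiM L (\<lambda>_. borel))"
    by (rule measurable_restrict; use U V in auto)+
  have mA: "?A \<in> sets M" "?B \<in> sets M"
    using measurable_sets[OF mU(1) A] measurable_sets[OF mU(2) B]
    by (simp_all add: vimage_def Int_def conj_commute)
  have rK: "(\<lambda>k\<in>K. (\<lambda>m\<in>I. F m) (Inl k)) = (\<lambda>k\<in>K. F (Inl k))" "(\<lambda>l\<in>L. (\<lambda>m\<in>I. F m) (Inr l)) = (\<lambda>l\<in>L. F (Inr l))" for F :: "'k + 'l \<Rightarrow> real"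
    by (auto simp: I_def fun_eq_iff restrict_def)
  have "prob {x\<in>space M. (\<lambda>k\<in>K. U k x) \<in> A \<and> (\<lambda>l\<in>L. V l x) \<in> B} = measure (distr M (PiM I (\<lambda>_. borel)) (\<lambda>x. \<lambda>m\<in>I. W m x)) C"
    unfolding measure_distr[OF mW C]
    by (intro arg_cong[where f="measure M"]) (auto simp: C_def space_PiM rK W_def simp del: restrict_apply)
  also have "\<dots> = measure (M \<Otimes>\<^sub>M M) (?A \<times> ?B)"
    unfolding eq measure_distr[OF mW' C]
    by (intro arg_cong[where f="measure (M \<Otimes>\<^sub>M M)"]) (auto simp: C_def space_PiM rK W'_def space_pair_measure simp del: restrict_apply)
  also have "\<dots> = prob ?A * prob ?B"
    using mA by (simp add: measure_def emeasure_pair_measure_Times enn2real_mult)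
  finally show ?thesis .
qed

section \<open>Gaussian random variables and the normal tail\<close>

text \<open>For a centred Gaussian variable, possibly degenerate, the characteristic and the moment generating
  function at one are determined by the second moment. Applied to linear combinations this is all
  that is used about joint normality.\<close>

lemma gaussian_rv_moments:
  assumes M: "prob_space M" and Z: "gaussian_rv M Z" and mean: "(\<integral>x. Z x \<partial>M) = 0"
  shows "integrable M (\<lambda>x. (Z x)\<^sup>2)"
    and "(CLINT x|M. iexp (Z x)) = of_real (exp (- (\<integral>x. (Z x)\<^sup>2 \<partial>M) / 2))"
    and "integrable M (\<lambda>x. exp (Z x))"
    and "(\<integral>x. exp (Z x) \<partial>M) = exp ((\<integral>x. (Z x)\<^sup>2 \<partial>M) / 2)"
proof -
  interpret prob_space M by fact
  have [measurable]: "Z \<in> borel_measurable M" using Z by (simp add: gaussian_rv_def)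
  have "integrable M (\<lambda>x. (Z x)\<^sup>2) \<and>
     (CLINT x|M. iexp (Z x)) = of_real (exp (- (\<integral>x. (Z x)\<^sup>2 \<partial>M) / 2)) \<and>
     integrable M (\<lambda>x. exp (Z x)) \<and>
     (\<integral>x. exp (Z x) \<partial>M) = exp ((\<integral>x. (Z x)\<^sup>2 \<partial>M) / 2)"
  proof (cases "\<exists>\<mu>. AE \<omega> in M. Z \<omega> = \<mu>")
    case True
    then obtain \<mu> where \<mu>: "AE \<omega> in M. Z \<omega> = \<mu>" by blast
    have "(\<integral>x. Z x \<partial>M) = (\<integral>x. \<mu> \<partial>M)" by (rule integral_cong_AE) (use \<mu> in auto)
    then have "\<mu> = 0" using mean by (simp add: prob_space)
    then have z: "AE \<omega> in M. Z \<omega> = 0" using \<mu> by simp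
    have "integrable M (\<lambda>x. (Z x)\<^sup>2) = integrable M (\<lambda>x. 0::real)"
      by (rule integrable_cong_AE) (use z in auto)
    moreover have "(\<integral>x. (Z x)\<^sup>2 \<partial>M) = (\<integral>x. 0 \<partial>M)"
      by (rule integral_cong_AE) (use z in auto)
    moreover have "(CLINT x|M. iexp (Z x)) = (CLINT x|M. 1)"
      by (rule integral_cong_AE) (use z in auto)
    moreover have "integrable M (\<lambda>x. exp (Z x)) = integrable M (\<lambda>x. 1::real)"
      by (rule integrable_cong_AE) (use z in auto)
    moreover have "(\<integral>x. exp (Z x) \<partial>M) = (\<integral>x. 1 \<partial>M)"
      by (rule integral_cong_AE) (use z in auto)
    ultimately show ?thesis by (simp add: prob_space)
  next
    case False
    then obtain \<mu> \<sigma> where s: "0 < \<sigma>" and D: "distributed M lborel Z (normal_density \<mu> \<sigma>)"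
      using Z by (auto simp: gaussian_rv_def)
    have "(\<integral>x. Z x \<partial>M) = (\<integral>x. normal_density \<mu> \<sigma> x * x \<partial>lborel)"
      by (rule distributed_integral[OF D, symmetric]) auto
    then have [simp]: "\<mu> = 0" using mean integral_normal_moment_nz_1[OF s, of \<mu>] by simp
    have D0: "distributed M lborel Z (normal_density 0 \<sigma>)" using D by simp
    have int2: "integrable M (\<lambda>x. (Z x)\<^sup>2)"
      using integrable_normal_moment[OF s, of 0 2]
      by (subst distributed_integrable[OF D0, symmetric]) auto
    have var: "(\<integral>x. (Z x)\<^sup>2 \<partial>M) = \<sigma>\<^sup>2"
      using integral_normal_moment_even[OF s, of 0 1]
      by (subst distributed_integral[OF D0, symmetric]) (auto simp: fact_numeral)
    have S: "distributed M lborel (\<lambda>x. (Z x - 0) / \<sigma>) std_normal_density"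
      using D0 normal_standard_normal_convert[OF s, of Z 0] by simp
    have "distr M borel (\<lambda>x. Z x / \<sigma>) = std_normal_distribution"
      using distributed_distr_eq_density[OF S] by (simp cong: distr_cong)
    then have "char (distr M borel (\<lambda>x. Z x / \<sigma>)) \<sigma> = of_real (exp (- \<sigma>\<^sup>2 / 2))"
      using fun_cong[OF char_std_normal_distribution, of \<sigma>] by simp
    moreover have "char (distr M borel (\<lambda>x. Z x / \<sigma>)) \<sigma> = (CLINT x|M. iexp (Z x))"
      unfolding char_def using s by (subst integral_distr) auto
    ultimately have ch: "(CLINT x|M. iexp (Z x)) = of_real (exp (- \<sigma>\<^sup>2 / 2))" by simp
    \<comment> \<open>Exponential tilting moves the mean of a normal density to \<open>\<sigma>^2\<close>.\<close>
    have tilt: "normal_density 0 \<sigma> x * exp x = exp (\<sigma>\<^sup>2 / 2) * normal_density (\<sigma>\<^sup>2) \<sigma> x" for x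
      using s unfolding normal_density_def
      by (simp add: exp_add[symmetric] field_simps power2_eq_square)
    have "integrable lborel (\<lambda>x. normal_density 0 \<sigma> x * exp x)"
      unfolding tilt using s by simp
    then have iexp: "integrable M (\<lambda>x. exp (Z x))"
      by (subst distributed_integrable[OF D0, symmetric]) auto
    have "(\<integral>x. exp (Z x) \<partial>M) = (\<integral>x. normal_density 0 \<sigma> x * exp x \<partial>lborel)"
      by (rule distributed_integral[OF D0, symmetric]) auto
    also have "\<dots> = exp (\<sigma>\<^sup>2 / 2)"
      unfolding tilt using s by simp
    finally show ?thesis using int2 var ch iexp by simp
  qed
  then show "integrable M (\<lambda>x. (Z x)\<^sup>2)"
    and "(CLINT x|M. iexp (Z x)) = of_real (exp (- (\<integral>x. (Z x)\<^sup>2 \<partial>M) / 2))"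
    and "integrable M (\<lambda>x. exp (Z x))"
    and "(\<integral>x. exp (Z x) \<partial>M) = exp ((\<integral>x. (Z x)\<^sup>2 \<partial>M) / 2)" by blast+
qed

lemma gaussian_rv_transfer:
  assumes Z: "gaussian_rv M Z" and Z': "Z' \<in> borel_measurable N"
    and eq: "distr M borel Z = distr N borel Z'"
  shows "gaussian_rv N Z'"
proof -
  have Zm: "Z \<in> borel_measurable M" using Z by (simp add: gaussian_rv_def)
  consider \<mu> where "AE \<omega> in M. Z \<omega> = \<mu>"
    | \<mu> \<sigma> where "0 < \<sigma>" "distributed M lborel Z (normal_density \<mu> \<sigma>)"
    using Z by (auto simp: gaussian_rv_def)
  then show ?thesis
  proof cases
    case (1 \<mu>)
    then have "AE y in distr M borel Z. y = \<mu>"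
      using Zm by (subst AE_distr_iff) auto
    then have "AE \<omega> in N. Z' \<omega> = \<mu>"
      unfolding eq using Z' by (subst (asm) AE_distr_iff) auto
    then show ?thesis using Z' by (auto simp: gaussian_rv_def)
  next
    case (2 \<mu> \<sigma>)
    have "distr M lborel Z = distr M borel Z" "distr N lborel Z' = distr N borel Z'"
      by (simp_all cong: distr_cong)
    then have "distributed N lborel Z' (normal_density \<mu> \<sigma>)"
      using 2(2) Z' eq by (simp add: distributed_def)
    then show ?thesis using Z' 2(1) by (auto simp: gaussian_rv_def)
  qed
qed

definition normal_tail :: "real \<Rightarrow> real" where
  "normal_tail u = measure std_normal_distribution {u<..}"

text \<open>The function \<open>- \<phi>(x) / x\<close> is an antiderivative of \<open>\<phi>(x) (1 + 1 / x^2)\<close>, whose integral over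
  the half-line is therefore \<open>\<phi>(v) / v\<close>; on that half-line the additional factor lies between \<open>1\<close>
  and \<open>1 + 1 / v^2\<close>.\<close>

lemma normal_tail_bounds:
  assumes v: "0 < v"
  shows "normal_tail v \<le> std_normal_density v / v"
    and "std_normal_density v / v \<le> (1 + 1 / v\<^sup>2) * normal_tail v"
proof -
  let ?\<phi> = std_normal_density
  have fin: "finite_measure std_normal_distribution"
    using real_dist_normal_dist by (simp add: real_distribution_def prob_space_def)
  interpret finite_measure std_normal_distribution by (fact fin)
  have "emeasure std_normal_distribution {v<..} = (\<integral>\<^sup>+x. ennreal (?\<phi> x) * indicator {v<..} x \<partial>lborel)"
    by (subst emeasure_density) auto
  also have "\<dots> = (\<integral>\<^sup>+x. ennreal (?\<phi> x) * indicator {v..} x \<partial>lborel)"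
    by (rule nn_integral_cong_AE)
      (use AE_lborel_singleton[of v] in \<open>auto elim!: eventually_mono simp: indicator_def\<close>)
  finally have q: "ennreal (normal_tail v) = (\<integral>\<^sup>+x. ennreal (?\<phi> x) * indicator {v..} x \<partial>lborel)"
    by (simp add: normal_tail_def emeasure_eq_measure)
  have lim: "((\<lambda>x. - (?\<phi> x / x)) \<longlongrightarrow> 0) at_top"
    unfolding std_normal_density_def by real_asymp
  have "(\<integral>\<^sup>+x. ennreal (?\<phi> x * (1 + 1 / x\<^sup>2)) * indicator {v..} x \<partial>lborel) = 0 - (- (?\<phi> v / v))"
  proof (rule nn_integral_FTC_atLeast[OF _ _ _ lim])
    fix x assume "v \<le> x"
    then have x: "x > 0" using v by simp
    define c where "c = 1 / sqrt (2 * pi)"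
    have \<phi>: "?\<phi> = (\<lambda>x. c * exp (- x\<^sup>2 / 2))" by (simp add: fun_eq_iff std_normal_density_def c_def)
    show "((\<lambda>x. - (?\<phi> x / x)) has_real_derivative ?\<phi> x * (1 + 1 / x\<^sup>2)) (at x)"
      unfolding \<phi> using x
      by (auto intro!: derivative_eq_intros simp: field_simps power2_eq_square)
    show "0 \<le> ?\<phi> x * (1 + 1 / x\<^sup>2)" by simp
  qed simp
  then have h: "(\<integral>\<^sup>+x. ennreal (?\<phi> x * (1 + 1 / x\<^sup>2)) * indicator {v..} x \<partial>lborel) = ennreal (?\<phi> v / v)"
    by simp
  have q0: "0 \<le> normal_tail v" by (simp add: normal_tail_def)
  have h0: "0 \<le> ?\<phi> v / v" using v by simp
  have "ennreal (normal_tail v) \<le> ennreal (?\<phi> v / v)"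
    unfolding q h[symmetric] by (intro nn_integral_mono mult_right_mono ennreal_leI) (auto simp: algebra_simps)
  then show "normal_tail v \<le> ?\<phi> v / v" using h0 by simp
  have "ennreal (?\<phi> v / v) \<le> (\<integral>\<^sup>+x. ennreal (1 + 1 / v\<^sup>2) * (ennreal (?\<phi> x) * indicator {v..} x) \<partial>lborel)"
    unfolding h[symmetric]
  proof (rule nn_integral_mono)
    fix x :: real
    show "ennreal (?\<phi> x * (1 + 1 / x\<^sup>2)) * indicator {v..} x \<le> ennreal (1 + 1 / v\<^sup>2) * (ennreal (?\<phi> x) * indicator {v..} x)"
    proof (cases "v \<le> x")
      case True
      then have "1 / x\<^sup>2 \<le> 1 / v\<^sup>2" using v by (intro divide_left_mono power_mono) auto
      then have "?\<phi> x * (1 + 1 / x\<^sup>2) \<le> (1 + 1 / v\<^sup>2) * ?\<phi> x"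
        by (subst mult.commute) (intro mult_right_mono, auto)
      then show ?thesis using True by (simp add: ennreal_mult'[symmetric] ennreal_leI del: ennreal_plus)
    qed simp
  qed
  also have "\<dots> = ennreal ((1 + 1 / v\<^sup>2) * normal_tail v)"
    by (subst nn_integral_cmult) (auto simp: q[symmetric] ennreal_mult'[symmetric] simp del: ennreal_plus)
  finally show "?\<phi> v / v \<le> (1 + 1 / v\<^sup>2) * normal_tail v"
    by (subst (asm) ennreal_le_iff) (use q0 in auto)
qed

section \<open>Independent Gaussian columns\<close>

text \<open>Column \<open>j\<close> is the sequence \<open>Y j\<close>. Only second order properties of the columns are recorded, next
  to joint normality within a column and independence between columns; \<open>\<rho>\<close> is the common
  covariance function.\<close>

locale gaussian_columns = prob_space M for M :: "'a measure" +
  fixes Y :: "nat \<Rightarrow> int \<Rightarrow> 'a \<Rightarrow> real" and d r :: nat and \<rho> :: "nat \<Rightarrow> real"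
  assumes r: "1 \<le> r" "r \<le> d"
    and indep: "indep_vars (\<lambda>_. seq_space) (\<lambda>j \<omega> i. Y j i \<omega>) {1..d}"
    and gauss: "j \<in> {1..d} \<Longrightarrow> gaussian_seq M (Y j)"
    and mean: "j \<in> {1..d} \<Longrightarrow> expectation (Y j i) = 0"
    and cov: "j \<in> {1..d} \<Longrightarrow> expectation (\<lambda>\<omega>. Y j i \<omega> * Y j k \<omega>) = \<rho> (nat \<bar>i - k\<bar>)"
    and \<rho>0: "\<rho> 0 = 1"
begin

lemma Y_gaussian: "j \<in> {1..d} \<Longrightarrow> finite I \<Longrightarrow> gaussian_rv M (\<lambda>\<omega>. \<Sum>i\<in>I. c i * Y j i \<omega>)"
  using gauss unfolding gaussian_seq_def by blast

lemma Y_measurable [measurable]: "j \<in> {1..d} \<Longrightarrow> Y j i \<in> borel_measurable M"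
  using Y_gaussian[of j "{i}" "\<lambda>_. 1"] by (simp add: gaussian_rv_def)

text \<open>The Bochner integral of a non-integrable function is zero, so integrability is not part of the
  assumption on the mean; it comes from normality.\<close>

lemma Y_integrable: assumes j: "j \<in> {1..d}" shows "integrable M (Y j i)"
proof (rule ccontr)
  assume ni: "\<not> integrable M (Y j i)"
  have "expectation (Y j i) = 0" using mean j by simp
  with ni gaussian_rv_moments(1)[OF prob_space_axioms Y_gaussian[OF j, of "{i}" "\<lambda>_. 1"]]
  have "integrable M (\<lambda>x. (Y j i x)\<^sup>2)" by simp
  then have "integrable M (\<lambda>x. 1 + (Y j i x)\<^sup>2)" by simp
  then have "integrable M (Y j i)"
  proof (rule Bochner_Integration.integrable_bound)
    show "AE x in M. norm (Y j i x) \<le> norm (1 + (Y j i x)\<^sup>2)"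
    proof (rule AE_I2)
      fix x
      have "0 \<le> (\<bar>Y j i x\<bar> - 1)\<^sup>2" by simp
      then show "norm (Y j i x) \<le> norm (1 + (Y j i x)\<^sup>2)"
        by (simp add: power2_eq_square algebra_simps)
    qed
  qed (use j in measurable)
  with ni show False by simp
qed

lemma Y_square_integrable: "j \<in> {1..d} \<Longrightarrow> integrable M (\<lambda>x. (Y j i x)\<^sup>2)"
  using gaussian_rv_moments(1)[OF prob_space_axioms Y_gaussian[of j "{i}" "\<lambda>_. 1"]] mean[of j i] by simp

lemma Y_product_integrable:
  assumes j: "j \<in> {1..d}" shows "integrable M (\<lambda>x. Y j i x * Y j k x)"
proof (rule Bochner_Integration.integrable_bound)
  show "integrable M (\<lambda>x. (Y j i x)\<^sup>2 + (Y j k x)\<^sup>2)"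
    using Y_square_integrable[OF j] by simp
  show "AE x in M. norm (Y j i x * Y j k x) \<le> norm ((Y j i x)\<^sup>2 + (Y j k x)\<^sup>2)"
  proof (rule AE_I2)
    fix x
    have "2 * (\<bar>Y j i x\<bar> * \<bar>Y j k x\<bar>) \<le> (Y j i x)\<^sup>2 + (Y j k x)\<^sup>2"
      using sum_squares_bound[of "\<bar>Y j i x\<bar>" "\<bar>Y j k x\<bar>"] by (simp add: mult.assoc)
    moreover have "0 \<le> \<bar>Y j i x\<bar> * \<bar>Y j k x\<bar>" by simp
    ultimately show "norm (Y j i x * Y j k x) \<le> norm ((Y j i x)\<^sup>2 + (Y j k x)\<^sup>2)"
      unfolding real_norm_def abs_mult by linarith
  qed
qed (use j in measurable)

lemma combination_moments:
  fixes c :: "int \<Rightarrow> real"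
  assumes j: "j \<in> {1..d}" and I: "finite I"
  defines "S \<equiv> \<lambda>\<omega>. \<Sum>i\<in>I. c i * Y j i \<omega>"
  shows "integrable M (\<lambda>x. (S x)\<^sup>2)"
    and "(CLINT x|M. iexp (S x)) = of_real (exp (- (\<integral>x. (S x)\<^sup>2 \<partial>M) / 2))"
    and "integrable M (\<lambda>x. exp (S x))"
    and "(\<integral>x. exp (S x) \<partial>M) = exp ((\<integral>x. (S x)\<^sup>2 \<partial>M) / 2)"
proof -
  have "(\<integral>x. S x \<partial>M) = 0"
    unfolding S_def using Y_integrable[OF j] mean[OF j] by simp
  note * = gaussian_rv_moments[OF prob_space_axioms Y_gaussian[OF j I, of c, folded S_def] this]
  show "integrable M (\<lambda>x. (S x)\<^sup>2)"
    "(CLINT x|M. iexp (S x)) = of_real (exp (- (\<integral>x. (S x)\<^sup>2 \<partial>M) / 2))"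
    "integrable M (\<lambda>x. exp (S x))"
    "(\<integral>x. exp (S x) \<partial>M) = exp ((\<integral>x. (S x)\<^sup>2 \<partial>M) / 2)" by (fact *)+
qed

lemma Y_distr: assumes j: "j \<in> {1..d}" shows "distr M borel (Y j i) = std_normal_distribution"
proof (rule Levy_uniqueness[OF _ real_dist_normal_dist])
  show "real_distribution (distr M borel (Y j i))" using j by simp
  show "char (distr M borel (Y j i)) = char std_normal_distribution"
  proof
    fix t
    have "(\<integral>x. (t * Y j i x)\<^sup>2 \<partial>M) = t\<^sup>2 * (\<integral>x. Y j i x * Y j i x \<partial>M)"
      by (subst integral_mult_right_zero[symmetric]) (simp add: power2_eq_square mult_ac)
    then have "(\<integral>x. (t * Y j i x)\<^sup>2 \<partial>M) = t\<^sup>2" using cov[OF j, of i i] \<rho>0 by simp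
    then have "(CLINT x|M. iexp (t * Y j i x)) = of_real (exp (- t\<^sup>2 / 2))"
      using combination_moments(2)[OF j, of "{i}" "\<lambda>_. t"] by simp
    then show "char (distr M borel (Y j i)) t = char std_normal_distribution t"
      unfolding char_std_normal_distribution using j by (simp add: char_def integral_distr)
  qed
qed

lemma prob_Y_gt: assumes j: "j \<in> {1..d}"
  shows "prob {\<omega>\<in>space M. v < Y j i \<omega>} = normal_tail v"
proof -
  have "normal_tail v = measure (distr M borel (Y j i)) {v<..}"
    unfolding normal_tail_def Y_distr[OF j] ..
  also have "\<dots> = prob (Y j i -` {v<..} \<inter> space M)"
    using j by (intro measure_distr) auto
  finally show ?thesis by (simp add: vimage_def Int_def conj_commute)
qed

lemma columns_indep_events:
  assumes A: "\<And>j. j \<in> {1..d} \<Longrightarrow> A j \<in> sets borel"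
  shows "prob {\<omega>\<in>space M. \<forall>j\<in>{1..d}. Y j i \<omega> \<in> A j} = (\<Prod>j\<in>{1..d}. prob {\<omega>\<in>space M. Y j i \<omega> \<in> A j})"
proof -
  have "indep_vars (\<lambda>_. borel) (\<lambda>j \<omega>. (\<lambda>f. f i) (\<lambda>i. Y j i \<omega>)) {1..d}"
    by (rule indep_vars_compose2[OF indep]) simp
  then have "indep_vars (\<lambda>_. borel) (\<lambda>j. Y j i) {1..d}" by simp
  from indep_varsD[OF this, of "{1..d}" A] r A
  have "prob (\<Inter>j\<in>{1..d}. Y j i -` A j \<inter> space M) = (\<Prod>j\<in>{1..d}. prob (Y j i -` A j \<inter> space M))"
    by auto
  moreover have "(\<Inter>j\<in>{1..d}. Y j i -` A j \<inter> space M) = {\<omega>\<in>space M. \<forall>j\<in>{1..d}. Y j i \<omega> \<in> A j}"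
    using r by force
  moreover have "Y j i -` A j \<inter> space M = {\<omega>\<in>space M. Y j i \<omega> \<in> A j}" for j by auto
  ultimately show ?thesis by simp
qed

lemma columns_indep_integral:
  fixes g :: "nat \<Rightarrow> (int \<Rightarrow> real) \<Rightarrow> 'b::{real_normed_field,banach,second_countable_topology}"
  assumes g: "\<And>j. j \<in> {1..d} \<Longrightarrow> g j \<in> borel_measurable seq_space"
    and int: "\<And>j. j \<in> {1..d} \<Longrightarrow> integrable M (\<lambda>\<omega>. g j (\<lambda>i. Y j i \<omega>))"
  shows "integrable M (\<lambda>\<omega>. \<Prod>j\<in>{1..d}. g j (\<lambda>i. Y j i \<omega>))"
    and "(\<integral>\<omega>. (\<Prod>j\<in>{1..d}. g j (\<lambda>i. Y j i \<omega>)) \<partial>M) = (\<Prod>j\<in>{1..d}. \<integral>\<omega>. g j (\<lambda>i. Y j i \<omega>) \<partial>M)"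
proof -
  have "indep_vars (\<lambda>_. borel) (\<lambda>j \<omega>. g j (\<lambda>i. Y j i \<omega>)) {1..d}"
    by (rule indep_vars_compose2[OF indep]) (use g in auto)
  from indep_vars_integrable[OF _ this int] indep_vars_lebesgue_integral[OF _ this int]
  show "integrable M (\<lambda>\<omega>. \<Prod>j\<in>{1..d}. g j (\<lambda>i. Y j i \<omega>))"
    "(\<integral>\<omega>. (\<Prod>j\<in>{1..d}. g j (\<lambda>i. Y j i \<omega>)) \<partial>M) = (\<Prod>j\<in>{1..d}. \<integral>\<omega>. g j (\<lambda>i. Y j i \<omega>) \<partial>M)"
    by auto
qed

definition exceedance :: "real \<Rightarrow> int \<Rightarrow> 'a set" where
  "exceedance v i = {\<omega>\<in>space M. exceeds d r v (\<lambda>j. Y j i \<omega>)}"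

lemma exceedance_sets [measurable]: "exceedance v i \<in> sets M"
  unfolding exceedance_def by measurable

lemma exceedance_antimono: "v \<le> v' \<Longrightarrow> exceedance v' i \<subseteq> exceedance v i"
  by (auto simp: exceedance_def elim!: exceeds_mono)

lemma chernoff: assumes j: "j \<in> {1..d}" and R: "0 \<le> R"
  shows "prob {\<omega>\<in>space M. R < \<bar>Y j i \<omega>\<bar>} \<le> 2 * exp (- R\<^sup>2 / 2)"
proof -
  have one: "prob {\<omega>\<in>space M. R < s * Y j i \<omega>} \<le> exp (- R\<^sup>2 / 2)" if s: "s\<^sup>2 = 1" for s
  proof -
    have "(\<integral>x. (R * s * Y j i x)\<^sup>2 \<partial>M) = (\<integral>x. R\<^sup>2 * (Y j i x * Y j i x) \<partial>M)"
      using s by (intro Bochner_Integration.integral_cong) (auto simp: power_mult_distrib power2_eq_square)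
    also have "\<dots> = R\<^sup>2" using cov[OF j, of i i] \<rho>0 by simp
    finally have v: "(\<integral>x. (R * s * Y j i x)\<^sup>2 \<partial>M) = R\<^sup>2" .
    have m: "integrable M (\<lambda>x. exp (R * s * Y j i x))" "(\<integral>x. exp (R * s * Y j i x) \<partial>M) = exp (R\<^sup>2 / 2)"
      using combination_moments(3,4)[OF j, of "{i}" "\<lambda>_. R * s"] v by simp_all
    have "prob {\<omega>\<in>space M. R < s * Y j i \<omega>} = (\<integral>x. indicator {\<omega>\<in>space M. R < s * Y j i \<omega>} x \<partial>M)"
      using j by simp
    also have "\<dots> \<le> (\<integral>x. exp (- R\<^sup>2) * exp (R * s * Y j i x) \<partial>M)"
    proof (rule integral_mono)
      show "integrable M (\<lambda>x. exp (- R\<^sup>2) * exp (R * s * Y j i x))" using m by simp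
      have "{\<omega>\<in>space M. R < s * Y j i \<omega>} \<in> sets M" using j by measurable
      then show "integrable M (indicat_real {\<omega>\<in>space M. R < s * Y j i \<omega>})"
        by (simp add: emeasure_eq_measure)
      fix x
      show "indicator {\<omega>\<in>space M. R < s * Y j i \<omega>} x \<le> exp (- R\<^sup>2) * exp (R * s * Y j i x)"
      proof (cases "R < s * Y j i x")
        case True
        then have "R\<^sup>2 \<le> R * (s * Y j i x)" unfolding power2_eq_square using R by (intro mult_left_mono) auto
        then show ?thesis by (simp add: exp_add[symmetric] indicator_def mult.assoc)
      qed simp
    qed
    also have "\<dots> = exp (- R\<^sup>2) * exp (R\<^sup>2 / 2)"
      using m(2) by (simp only: integral_mult_right_zero)
    also have "\<dots> = exp (- R\<^sup>2 / 2)"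
      by (simp add: exp_add[symmetric])
    finally show ?thesis .
  qed
  have "{\<omega>\<in>space M. R < \<bar>Y j i \<omega>\<bar>} = {\<omega>\<in>space M. R < 1 * Y j i \<omega>} \<union> {\<omega>\<in>space M. R < (-1) * Y j i \<omega>}"
    by auto
  moreover have "prob ({\<omega>\<in>space M. R < 1 * Y j i \<omega>} \<union> {\<omega>\<in>space M. R < (-1) * Y j i \<omega>})
     \<le> prob {\<omega>\<in>space M. R < 1 * Y j i \<omega>} + prob {\<omega>\<in>space M. R < (-1) * Y j i \<omega>}"
    by (rule measure_Un_le) (use j in measurable)
  ultimately show ?thesis using one[of 1] one[of "-1"] by simp
qed

lemma prob_exceedance_upper: "prob (exceedance v i) \<le> real (d choose r) * normal_tail v ^ r"
proof -
  let ?J = "{J. J \<subseteq> {1..d} \<and> card J = r}"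
  have fin: "finite ?J" by (rule finite_subset[of _ "Pow {1..d}"]) auto
  have m: "{\<omega>\<in>space M. \<forall>j\<in>J. v < Y j i \<omega>} \<in> sets M" if "J \<subseteq> {1..d}" for J
  proof -
    have [measurable]: "j \<in> J \<Longrightarrow> Y j i \<in> borel_measurable M" for j using that by auto
    have "finite J" using that finite_subset by auto
    then show ?thesis by measurable
  qed
  have "prob (exceedance v i) \<le> prob (\<Union>J\<in>?J. {\<omega>\<in>space M. \<forall>j\<in>J. v < Y j i \<omega>})"
  proof (rule finite_measure_mono)
    show "exceedance v i \<subseteq> (\<Union>J\<in>?J. {\<omega>\<in>space M. \<forall>j\<in>J. v < Y j i \<omega>})"
    proof
      fix \<omega> assume "\<omega> \<in> exceedance v i"
      then have "exceeds d r v (\<lambda>j. Y j i \<omega>)" and s: "\<omega> \<in> space M" by (auto simp: exceedance_def)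
      then obtain J where "J \<subseteq> {1..d}" "card J = r" "\<And>j. j \<in> J \<Longrightarrow> v < Y j i \<omega>" using exceeds_subset by metis
      with s show "\<omega> \<in> (\<Union>J\<in>?J. {\<omega>\<in>space M. \<forall>j\<in>J. v < Y j i \<omega>})" by blast
    qed
    show "(\<Union>J\<in>?J. {\<omega>\<in>space M. \<forall>j\<in>J. v < Y j i \<omega>}) \<in> sets M"
      using fin m by (intro sets.finite_UN) auto
  qed
  also have "\<dots> \<le> (\<Sum>J\<in>?J. prob {\<omega>\<in>space M. \<forall>j\<in>J. v < Y j i \<omega>})"
    using fin m by (intro finite_measure_subadditive_finite) auto
  also have "\<dots> = (\<Sum>J\<in>?J. normal_tail v ^ r)"
  proof (rule sum.cong[OF refl])
    fix J assume J: "J \<in> ?J"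
    define A where "A j = (if j \<in> J then {v<..} else UNIV)" for j
    have "prob {\<omega>\<in>space M. \<forall>j\<in>J. v < Y j i \<omega>} = prob {\<omega>\<in>space M. \<forall>j\<in>{1..d}. Y j i \<omega> \<in> A j}"
      using J by (intro arg_cong[where f=prob]) (auto simp: A_def subset_iff)
    also have "\<dots> = (\<Prod>j\<in>{1..d}. prob {\<omega>\<in>space M. Y j i \<omega> \<in> A j})"
      by (rule columns_indep_events) (auto simp: A_def)
    also have "\<dots> = (\<Prod>j\<in>{1..d}. if j \<in> J then normal_tail v else 1)"
      using prob_Y_gt by (intro prod.cong) (auto simp: A_def prob_space)
    also have "\<dots> = normal_tail v ^ r"
      using J by (subst prod.If_cases) (auto simp: Int_absorb1)
    finally show "prob {\<omega>\<in>space M. \<forall>j\<in>J. v < Y j i \<omega>} = normal_tail v ^ r" .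
  qed
  also have "\<dots> = real (d choose r) * normal_tail v ^ r"
    using n_subsets[of "{1..d}" r] by simp
  finally show ?thesis .
qed

text \<open>The events that exactly the columns in \<open>J\<close> exceed the level are disjoint for different \<open>J\<close>, which
  gives a lower bound of the same form as the union bound.\<close>

lemma prob_exceedance_lower: "real (d choose r) * normal_tail v ^ r * (1 - normal_tail v) ^ d \<le> prob (exceedance v i)"
proof -
  let ?J = "{J. J \<subseteq> {1..d} \<and> card J = r}"
  let ?E = "\<lambda>J. {\<omega>\<in>space M. \<forall>j\<in>{1..d}. Y j i \<omega> \<in> (if j \<in> J then {v<..} else {..v})}"
  have q: "0 \<le> normal_tail v" "normal_tail v \<le> 1"
    using prob_Y_gt[of 1 v 0, symmetric] r by (simp_all add: normal_tail_def)
  have fin: "finite ?J" by (rule finite_subset[of _ "Pow {1..d}"]) auto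
  have m: "?E J \<in> sets M" for J
  proof -
    have [measurable]: "(if j \<in> J then {v<..} else {..v}) \<in> sets borel" for j by simp
    show ?thesis by measurable
  qed
  have disj: "disjoint_family_on ?E ?J"
    unfolding disjoint_family_on_def
  proof (intro ballI impI)
    fix J J' assume J: "J \<in> ?J" "J' \<in> ?J" "J \<noteq> J'"
    then obtain j where j: "j \<in> {1..d}" "(j \<in> J) \<noteq> (j \<in> J')" by blast
    show "?E J \<inter> ?E J' = {}"
    proof (rule equals0I)
      fix \<omega> assume "\<omega> \<in> ?E J \<inter> ?E J'"
      with j have "Y j i \<omega> \<in> (if j \<in> J then {v<..} else {..v})" "Y j i \<omega> \<in> (if j \<in> J' then {v<..} else {..v})"
        by blast+
      with j show False by (auto split: if_splits)
    qed
  qed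
  have pE: "normal_tail v ^ r * (1 - normal_tail v) ^ d \<le> prob (?E J)" if J: "J \<in> ?J" for J
  proof -
    have le: "prob {\<omega>\<in>space M. Y j i \<omega> \<le> v} = 1 - normal_tail v" if "j \<in> {1..d}" for j
    proof -
      have "{\<omega>\<in>space M. Y j i \<omega> \<le> v} = space M - {\<omega>\<in>space M. v < Y j i \<omega>}" by auto
      moreover have "{\<omega>\<in>space M. v < Y j i \<omega>} \<in> sets M" using that by measurable
      ultimately show ?thesis using prob_Y_gt[OF that] by (simp add: prob_compl)
    qed
    have "prob (?E J) = (\<Prod>j\<in>{1..d}. prob {\<omega>\<in>space M. Y j i \<omega> \<in> (if j \<in> J then {v<..} else {..v})})"
      by (rule columns_indep_events) auto
    also have "\<dots> = (\<Prod>j\<in>{1..d}. if j \<in> J then normal_tail v else 1 - normal_tail v)"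
      using prob_Y_gt le by (intro prod.cong) auto
    also have "\<dots> = normal_tail v ^ r * (1 - normal_tail v) ^ card ({1..d} - J)"
      using J by (subst prod.If_cases) (auto simp: Int_absorb1 Diff_eq)
    also have "\<dots> \<ge> normal_tail v ^ r * (1 - normal_tail v) ^ d"
      using q J by (intro mult_left_mono power_decreasing) (auto simp: card_Diff_subset finite_subset)
    finally show ?thesis .
  qed
  have "real (d choose r) * normal_tail v ^ r * (1 - normal_tail v) ^ d = (\<Sum>J\<in>?J. normal_tail v ^ r * (1 - normal_tail v) ^ d)"
    using n_subsets[of "{1..d}" r] by simp
  also have "\<dots> \<le> (\<Sum>J\<in>?J. prob (?E J))" using pE by (rule sum_mono)
  also have "\<dots> = prob (\<Union>J\<in>?J. ?E J)"
    using fin disj m by (intro finite_measure_finite_Union[symmetric]) auto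
  also have "\<dots> \<le> prob (exceedance v i)"
  proof (rule finite_measure_mono)
    show "(\<Union>J\<in>?J. ?E J) \<subseteq> exceedance v i"
    proof
      fix \<omega> assume "\<omega> \<in> (\<Union>J\<in>?J. ?E J)"
      then obtain J where J: "J \<subseteq> {1..d}" "card J = r" "\<omega> \<in> ?E J" by blast
      have "v < Y j i \<omega>" if "j \<in> J" for j using that J by force
      then show "\<omega> \<in> exceedance v i" using J exceedsI[of J d r v "\<lambda>j. Y j i \<omega>"] by (auto simp: exceedance_def)
    qed
  qed simp
  finally show ?thesis .
qed

text \<open>If \<open>r\<close> columns exceed at each of two indices, then the sum of these \<open>2 r\<close> entries is at least
  \<open>2 r a\<close>, while its variance is at most \<open>2 r (1 + \<delta>)\<close>: an entry is correlated only with the entry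
  of the same column at the other index. Markov's inequality for the exponential moment with the
  optimal parameter \<open>\<theta> = a / (1 + \<delta>)\<close> gives the bound. For \<open>\<delta> < 1\<close> the exponent beats
  \<open>r a^2 / 2\<close>, the exponent of a single exceedance.\<close>

lemma joint_exceedance:
  assumes \<delta>: "0 \<le> \<delta>" "\<rho> (nat \<bar>i - l\<bar>) \<le> \<delta>" and il: "i \<noteq> l" and v: "0 < a" "a \<le> v" "a \<le> v'"
  shows "prob (exceedance v i \<inter> exceedance v' l) \<le> (real (d choose r))\<^sup>2 * exp (- (real r * a\<^sup>2 / (1 + \<delta>)))"
proof -
  let ?J = "{J. J \<subseteq> {1..d} \<and> card J = r}"
  have fin: "finite ?J" by (rule finite_subset[of _ "Pow {1..d}"]) auto
  define \<theta> where "\<theta> = a / (1 + \<delta>)"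
  have \<theta>: "0 < \<theta>" using v \<delta> by (simp add: \<theta>_def)
  define S where "S J J' j \<omega> = indicator J j * \<theta> * Y j i \<omega> + indicator J' j * \<theta> * Y j l \<omega>" for J J' j \<omega>
  let ?E = "\<lambda>J J'. {\<omega>\<in>space M. 2 * real r * a * \<theta> \<le> (\<Sum>j\<in>{1..d}. S J J' j \<omega>)}"
  have Sm[measurable]: "j \<in> {1..d} \<Longrightarrow> S J J' j \<in> borel_measurable M" for J J' j
    unfolding S_def[abs_def] by measurable
  have m: "?E J J' \<in> sets M" for J J' by measurable
  have pE: "prob (?E J J') \<le> exp (- (real r * a\<^sup>2 / (1 + \<delta>)))" if J: "J \<in> ?J" "J' \<in> ?J" for J J'
  proof -
    have mgf: "integrable M (\<lambda>x. exp (S J J' j x))"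
      "(\<integral>x. exp (S J J' j x) \<partial>M) \<le> exp (\<theta>\<^sup>2 * (1 + \<delta>) * (indicator J j + indicator J' j) / 2)" if j: "j \<in> {1..d}" for j
    proof -
      define c where "c = (indicator J j :: real)"
      define c' where "c' = (indicator J' j :: real)"
      \<comment> \<open>Indicators are idempotent, and \<open>c * c' \<le> (c + c') / 2\<close> bounds the mixed term by the diagonal ones.\<close>
      have cc: "c * c = c" "c' * c' = c'" "0 \<le> c * c'" "c * c' \<le> (c + c') / 2"
        by (auto simp: c_def c'_def indicator_def)
      have Ssum: "S J J' j x = (\<Sum>k\<in>{i, l}. (if k = i then c * \<theta> else c' * \<theta>) * Y j k x)" for x
        using il by (auto simp: S_def c_def c'_def)
      have "(\<integral>x. (S J J' j x)\<^sup>2 \<partial>M) = (\<integral>x. \<theta>\<^sup>2 * (c * (Y j i x * Y j i x) + 2 * (c * c') * (Y j i x * Y j l x) + c' * (Y j l x * Y j l x)) \<partial>M)"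
      proof (intro Bochner_Integration.integral_cong refl)
        fix x
        have "(S J J' j x)\<^sup>2 = \<theta>\<^sup>2 * ((c * c) * (Y j i x * Y j i x) + 2 * (c * c') * (Y j i x * Y j l x) + (c' * c') * (Y j l x * Y j l x))"
          by (simp add: S_def c_def[symmetric] c'_def[symmetric] power2_eq_square algebra_simps)
        then show "(S J J' j x)\<^sup>2 = \<theta>\<^sup>2 * (c * (Y j i x * Y j i x) + 2 * (c * c') * (Y j i x * Y j l x) + c' * (Y j l x * Y j l x))"
          by (simp only: cc)
      qed
      also have "\<dots> = \<theta>\<^sup>2 * (c + 2 * (c * c') * \<rho> (nat \<bar>i - l\<bar>) + c')"
        using Y_product_integrable[OF j] cov[OF j] \<rho>0 by simp
      also have "\<dots> \<le> \<theta>\<^sup>2 * ((1 + \<delta>) * (c + c'))"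
      proof -
        have "2 * (c * c') * \<rho> (nat \<bar>i - l\<bar>) \<le> 2 * (c * c') * \<delta>" using cc \<delta> by (intro mult_left_mono) auto
        also have "\<dots> \<le> (c + c') * \<delta>" using cc \<delta> by (intro mult_right_mono) auto
        finally show ?thesis by (intro mult_left_mono) (auto simp: algebra_simps)
      qed
      finally have var: "(\<integral>x. (S J J' j x)\<^sup>2 \<partial>M) \<le> \<theta>\<^sup>2 * (1 + \<delta>) * (c + c')" by (simp add: mult.assoc)
      show "integrable M (\<lambda>x. exp (S J J' j x))"
        unfolding Ssum by (rule combination_moments(3)[OF j]) simp
      have "(\<integral>x. exp (S J J' j x) \<partial>M) = exp ((\<integral>x. (S J J' j x)\<^sup>2 \<partial>M) / 2)"
        unfolding Ssum by (rule combination_moments(4)[OF j]) simp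
      with var show "(\<integral>x. exp (S J J' j x) \<partial>M) \<le> exp (\<theta>\<^sup>2 * (1 + \<delta>) * (indicator J j + indicator J' j) / 2)"
        by (simp add: c_def c'_def)
    qed
    define g where "g j f = exp (indicator J j * \<theta> * f i + indicator J' j * \<theta> * f l)" for j and f :: "int \<Rightarrow> real"
    have gm: "g j \<in> borel_measurable seq_space" for j
    proof -
      have [measurable]: "(\<lambda>f. f k) \<in> borel_measurable seq_space" for k :: int by simp
      show ?thesis unfolding g_def[abs_def] by measurable
    qed
    have gS: "g j (\<lambda>k. Y j k x) = exp (S J J' j x)" for j x by (simp add: g_def S_def)
    have gi: "j \<in> {1..d} \<Longrightarrow> integrable M (\<lambda>x. g j (\<lambda>k. Y j k x))" for j
      unfolding gS by (rule mgf(1))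
    note prodint = columns_indep_integral[of g, OF gm gi, unfolded gS]
    have card: "(\<Sum>j\<in>{1..d}. indicator J j + indicator J' j) = 2 * real r"
    proof -
      have "(\<Sum>j\<in>{1..d}. indicator J j) = real r" if "J \<in> ?J" for J
        using that by (auto simp: indicator_def Int_absorb1 if_distrib sum.If_cases cong: if_cong)
      then show ?thesis using J by (simp add: sum.distrib)
    qed
    have "prob (?E J J') = (\<integral>x. indicator (?E J J') x \<partial>M)" using m by simp
    also have "\<dots> \<le> (\<integral>x. exp (- (2 * real r * a * \<theta>)) * (\<Prod>j\<in>{1..d}. exp (S J J' j x)) \<partial>M)"
    proof (rule integral_mono)
      show "integrable M (indicat_real (?E J J'))" using m[of J J'] by (simp add: emeasure_eq_measure)
      show "integrable M (\<lambda>x. exp (- (2 * real r * a * \<theta>)) * (\<Prod>j\<in>{1..d}. exp (S J J' j x)))"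
        using prodint(1) by simp
      fix x
      show "indicator (?E J J') x \<le> exp (- (2 * real r * a * \<theta>)) * (\<Prod>j\<in>{1..d}. exp (S J J' j x))"
        by (auto simp: indicator_def exp_sum[symmetric] exp_add[symmetric] prod_nonneg)
    qed
    also have "\<dots> = exp (- (2 * real r * a * \<theta>)) * (\<Prod>j\<in>{1..d}. (\<integral>x. exp (S J J' j x) \<partial>M))"
      using prodint(2) by simp
    also have "\<dots> \<le> exp (- (2 * real r * a * \<theta>)) * (\<Prod>j\<in>{1..d}. exp (\<theta>\<^sup>2 * (1 + \<delta>) * (indicator J j + indicator J' j) / 2))"
      using mgf by (intro mult_left_mono prod_mono) (auto intro!: integral_nonneg_AE)
    also have "\<dots> = exp (- (2 * real r * a * \<theta>) + \<theta>\<^sup>2 * (1 + \<delta>) * (2 * real r) / 2)"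
    proof -
      have "(\<Sum>j\<in>{1..d}. \<theta>\<^sup>2 * (1 + \<delta>) * (indicator J j + indicator J' j) / 2) = \<theta>\<^sup>2 * (1 + \<delta>) * (2 * real r) / 2"
        unfolding card[symmetric] by (simp add: sum_distrib_left sum_divide_distrib)
      then show ?thesis by (simp add: exp_sum[symmetric] exp_add[symmetric])
    qed
    also have "- (2 * real r * a * \<theta>) + \<theta>\<^sup>2 * (1 + \<delta>) * (2 * real r) / 2 = - (real r * a\<^sup>2 / (1 + \<delta>))"
    proof -
      have "\<theta>\<^sup>2 * (1 + \<delta>) = a * \<theta>" using \<delta> by (simp add: \<theta>_def power2_eq_square)
      then have "- (2 * real r * a * \<theta>) + \<theta>\<^sup>2 * (1 + \<delta>) * (2 * real r) / 2 = - (real r * (a * \<theta>))"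
        by simp
      then show ?thesis by (simp add: \<theta>_def power2_eq_square)
    qed
    finally show ?thesis .
  qed
  have "prob (exceedance v i \<inter> exceedance v' l) \<le> prob (\<Union>p\<in>?J\<times>?J. ?E (fst p) (snd p))"
  proof (rule finite_measure_mono)
    show "(\<Union>p\<in>?J\<times>?J. ?E (fst p) (snd p)) \<in> sets M" using fin m by (intro sets.finite_UN) auto
    show "exceedance v i \<inter> exceedance v' l \<subseteq> (\<Union>p\<in>?J\<times>?J. ?E (fst p) (snd p))"
    proof
      fix \<omega> assume w: "\<omega> \<in> exceedance v i \<inter> exceedance v' l"
      then obtain J where J: "J \<subseteq> {1..d}" "card J = r" "\<And>j. j \<in> J \<Longrightarrow> v < Y j i \<omega>"
        by (auto simp: exceedance_def elim: exceeds_subset)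
      from w obtain J' where J': "J' \<subseteq> {1..d}" "card J' = r" "\<And>j. j \<in> J' \<Longrightarrow> v' < Y j l \<omega>"
        by (auto simp: exceedance_def elim: exceeds_subset)
      have part: "real r * (a * \<theta>) \<le> (\<Sum>j\<in>{1..d}. indicator K j * \<theta> * Y j k \<omega>)"
        if K: "K \<subseteq> {1..d}" "card K = r" "\<And>j. j \<in> K \<Longrightarrow> a \<le> Y j k \<omega>" for K k
      proof -
        have "real r * (a * \<theta>) = (\<Sum>j\<in>K. a * \<theta>)" using K by simp
        also have "\<dots> \<le> (\<Sum>j\<in>K. \<theta> * Y j k \<omega>)" 
          using K \<theta> by (intro sum_mono) (simp add: mult.commute)
        also have "\<dots> = (\<Sum>j\<in>{1..d}. indicator K j * \<theta> * Y j k \<omega>)"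
          using K by (intro sum.mono_neutral_cong_left) auto
        finally show ?thesis .
      qed
      have "2 * real r * a * \<theta> \<le> (\<Sum>j\<in>{1..d}. S J J' j \<omega>)"
      proof -
        have "a \<le> Y j i \<omega>" if "j \<in> J" for j using J(3)[OF that] v by linarith
        moreover have "a \<le> Y j l \<omega>" if "j \<in> J'" for j using J'(3)[OF that] v by linarith
        ultimately show ?thesis
          using part[OF J(1,2), of i] part[OF J'(1,2), of l] by (simp add: S_def sum.distrib)
      qed
      then show "\<omega> \<in> (\<Union>p\<in>?J\<times>?J. ?E (fst p) (snd p))"
        using w J J' by (auto simp: exceedance_def intro!: bexI[of _ "(J, J')"])
    qed
  qed
  also have "\<dots> \<le> (\<Sum>p\<in>?J\<times>?J. prob (?E (fst p) (snd p)))"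
    using fin m by (intro finite_measure_subadditive_finite) auto
  also have "\<dots> \<le> (\<Sum>p\<in>?J\<times>?J. exp (- (real r * a\<^sup>2 / (1 + \<delta>))))"
    by (intro sum_mono pE) auto
  also have "\<dots> = (real (d choose r))\<^sup>2 * exp (- (real r * a\<^sup>2 / (1 + \<delta>)))"
    using n_subsets[of "{1..d}" r] by (simp add: card_cartesian_product power2_eq_square)
  finally show ?thesis .
qed

text \<open>If some correlation \<open>\<rho> n\<close> with \<open>n \<ge> 1\<close> were at least \<open>1\<close>, then \<open>Y (i + n) = Y i\<close> almost surely
  for all \<open>i\<close>, and \<open>\<rho>\<close> would equal \<open>1\<close> on all multiples of \<open>n\<close>, which contradicts \<open>\<rho> n \<rightarrow> 0\<close>.\<close>

lemma correlation_bounded_away: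
  assumes decay: "(\<lambda>n. \<rho> n * ln (real n)) \<longlonglongrightarrow> 0"
  obtains \<delta> where "0 \<le> \<delta>" "\<delta> < 1" "\<And>n. 1 \<le> n \<Longrightarrow> \<rho> n \<le> \<delta>"
proof -
  have "eventually (\<lambda>n. 3 \<le> n) sequentially" by (rule eventually_ge_at_top)
  then have ev: "\<forall>\<^sub>F n in sequentially. norm (\<rho> n) \<le> \<bar>\<rho> n * ln (real n)\<bar>"
  proof eventually_elim
    case (elim n)
    have "exp 1 \<le> real n" using exp_le elim by (simp add: of_nat_le_iff[symmetric])
    then have "1 \<le> ln (real n)" using elim by (subst ln_ge_iff) auto
    then have "\<bar>\<rho> n\<bar> * 1 \<le> \<bar>\<rho> n\<bar> * \<bar>ln (real n)\<bar>" by (intro mult_left_mono) auto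
    then show ?case by (simp add: abs_mult)
  qed
  have lim: "\<rho> \<longlonglongrightarrow> 0"
    by (rule Lim_null_comparison[OF ev]) (use decay in \<open>simp add: tendsto_rabs_zero_iff\<close>)
  have lt1: "\<rho> n < 1" if n: "1 \<le> n" for n
  proof (rule ccontr)
    assume "\<not> \<rho> n < 1"
    then have ge: "1 \<le> \<rho> n" by simp
    have j: "1 \<in> {1..d}" using r by simp
    have step: "AE x in M. Y 1 (i + int n) x = Y 1 i x" for i
    proof -
      have sqi: "integrable M (\<lambda>x. (Y 1 (i + int n) x - Y 1 i x)\<^sup>2)"
      proof -
        have "(Y 1 (i + int n) x - Y 1 i x)\<^sup>2 = Y 1 (i + int n) x * Y 1 (i + int n) x - 2 * (Y 1 (i + int n) x * Y 1 i x) + Y 1 i x * Y 1 i x" for x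
          by (simp add: power2_eq_square algebra_simps)
        then show ?thesis using Y_product_integrable[OF j] by simp
      qed
      have "(\<integral>x. (Y 1 (i + int n) x - Y 1 i x)\<^sup>2 \<partial>M) = (\<integral>x. Y 1 (i + int n) x * Y 1 (i + int n) x - 2 * (Y 1 (i + int n) x * Y 1 i x) + Y 1 i x * Y 1 i x \<partial>M)"
        by (intro Bochner_Integration.integral_cong) (auto simp: power2_eq_square algebra_simps)
      also have "\<dots> = 2 - 2 * \<rho> n"
        using Y_product_integrable[OF j] cov[OF j] \<rho>0 by simp
      finally have "(\<integral>x. (Y 1 (i + int n) x - Y 1 i x)\<^sup>2 \<partial>M) \<le> 0" using ge by simp
      moreover have "0 \<le> (\<integral>x. (Y 1 (i + int n) x - Y 1 i x)\<^sup>2 \<partial>M)" by (intro integral_nonneg_AE) auto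
      ultimately have "(\<integral>x. (Y 1 (i + int n) x - Y 1 i x)\<^sup>2 \<partial>M) = 0" by (rule antisym)
      then have "AE x in M. (Y 1 (i + int n) x - Y 1 i x)\<^sup>2 = 0"
        using integral_nonneg_eq_0_iff_AE[OF sqi] by simp
      then show ?thesis by simp
    qed
    have eq: "AE x in M. Y 1 (int (k * n)) x = Y 1 0 x" for k
    proof (induction k)
      case (Suc k)
      have e: "int (Suc k * n) = int (k * n) + int n" by simp
      show ?case using Suc step[of "int (k * n)"] unfolding e by eventually_elim simp
    qed simp
    have "\<rho> (k * n) = 1" for k
    proof -
      have "\<rho> (k * n) = (\<integral>x. Y 1 (int (k * n)) x * Y 1 0 x \<partial>M)" using cov[OF j, of "int (k * n)" 0] by (simp del: of_nat_mult)
      also have "\<dots> = (\<integral>x. Y 1 0 x * Y 1 0 x \<partial>M)"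
        by (rule integral_cong_AE) (use eq[of k] j in auto)
      finally show ?thesis using cov[OF j, of 0 0] \<rho>0 by simp
    qed
    then have "(\<lambda>k. \<rho> (k * n)) \<longlonglongrightarrow> 1" by simp
    moreover have "(\<lambda>k. \<rho> (k * n)) \<longlonglongrightarrow> 0"
    proof (rule LIMSEQ_subseq_LIMSEQ[OF lim, unfolded o_def])
      show "strict_mono (\<lambda>k. k * n)" using n by (intro strict_monoI) simp
    qed
    ultimately show False using LIMSEQ_unique by fastforce
  qed
  obtain N where N: "\<And>n. N \<le> n \<Longrightarrow> \<rho> n < 1 / 2"
    using order_tendstoD(2)[OF lim, of "1/2"] by (auto simp: eventually_sequentially)
  define \<delta> where "\<delta> = Max (insert (1 / 2) (\<rho> ` {1..<N}))"
  show ?thesis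
  proof
    show "0 \<le> \<delta>" unfolding \<delta>_def by (rule order_trans[of _ "1/2"]) (simp, rule Max_ge, auto)
    show "\<delta> < 1" unfolding \<delta>_def using lt1 by (subst Max_less_iff) auto
    show "\<rho> n \<le> \<delta>" if "1 \<le> n" for n
    proof (cases "n < N")
      case True
      then show ?thesis unfolding \<delta>_def using that by (intro Max_ge) auto
    next
      case False
      then have "\<rho> n \<le> 1 / 2" using N[of n] by simp
      also have "\<dots> \<le> \<delta>" unfolding \<delta>_def by (intro Max_ge) auto
      finally show ?thesis .
    qed
  qed
qed

end

section \<open>Decoupling one index from distant ones\<close>

context gaussian_columns
begin

text \<open>The part of \<open>Y j l\<close> that is uncorrelated with \<open>Y j i\<close>; the regression coefficient is the
  correlation because all variances are \<open>1\<close>.\<close>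

definition residual :: "int \<Rightarrow> nat \<Rightarrow> int \<Rightarrow> 'a \<Rightarrow> real" where
  "residual i j l \<omega> = Y j l \<omega> - \<rho> (nat \<bar>l - i\<bar>) * Y j i \<omega>"

lemma residual_measurable [measurable]: "j \<in> {1..d} \<Longrightarrow> residual i j l \<in> borel_measurable M"
  unfolding residual_def[abs_def] by measurable

lemma residual_combination:
  fixes s :: real and t :: "int \<Rightarrow> real"
  assumes F: "finite F"
  obtains c where "\<And>j \<omega>. (\<Sum>l\<in>insert i F. c l * Y j l \<omega>) = s * Y j i \<omega> + (\<Sum>l\<in>F. t l * residual i j l \<omega>)"
proof
  define c where "c l = (if l = i then s - (\<Sum>l\<in>F. t l * \<rho> (nat \<bar>l - i\<bar>)) else 0) + (if l \<in> F then t l else 0)" for l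
  fix j \<omega>
  have "(\<Sum>l\<in>insert i F. c l * Y j l \<omega>) = (\<Sum>l\<in>insert i F. (if l = i then s - (\<Sum>l\<in>F. t l * \<rho> (nat \<bar>l - i\<bar>)) else 0) * Y j l \<omega>)
      + (\<Sum>l\<in>insert i F. (if l \<in> F then t l else 0) * Y j l \<omega>)"
    by (simp add: c_def ring_distribs sum.distrib)
  also have "(\<Sum>l\<in>insert i F. (if l = i then s - (\<Sum>l\<in>F. t l * \<rho> (nat \<bar>l - i\<bar>)) else 0) * Y j l \<omega>)
      = (s - (\<Sum>l\<in>F. t l * \<rho> (nat \<bar>l - i\<bar>))) * Y j i \<omega>"
    using F by (subst sum.remove[of _ i]) auto
  also have "(\<Sum>l\<in>insert i F. (if l \<in> F then t l else 0) * Y j l \<omega>) = (\<Sum>l\<in>F. t l * Y j l \<omega>)"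
    using F by (intro sum.mono_neutral_cong_right) auto
  finally show "(\<Sum>l\<in>insert i F. c l * Y j l \<omega>) = s * Y j i \<omega> + (\<Sum>l\<in>F. t l * residual i j l \<omega>)"
    by (simp add: residual_def algebra_simps sum_subtractf sum_distrib_left)
qed

text \<open>The variable \<open>Y j i\<close> and any combination of residuals are uncorrelated, so the variance of their sum
  is the sum of the variances, and the Gaussian characteristic function factorizes.\<close>

lemma residual_char:
  assumes j: "j \<in> {1..d}" and F: "finite F"
  shows "(CLINT x|M. iexp (s * Y j i x + (\<Sum>l\<in>F. t l * residual i j l x)))
    = (CLINT x|M. iexp (s * Y j i x)) * (CLINT x|M. iexp (\<Sum>l\<in>F. t l * residual i j l x))"
proof -
  define T where "T x = (\<Sum>l\<in>F. t l * residual i j l x)" for x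
  obtain c where c: "\<And>j \<omega>. (\<Sum>l\<in>insert i F. c l * Y j l \<omega>) = s * Y j i \<omega> + (\<Sum>l\<in>F. t l * residual i j l \<omega>)"
    using residual_combination[OF F, of i s t] by blast
  obtain c' where c': "\<And>j \<omega>. (\<Sum>l\<in>insert i F. c' l * Y j l \<omega>) = 0 * Y j i \<omega> + (\<Sum>l\<in>F. t l * residual i j l \<omega>)"
    using residual_combination[OF F, of i 0 t] by blast
  have fi: "finite (insert i F)" using F by simp
  have YT: "integrable M (\<lambda>x. Y j i x * T x)" "(\<integral>x. Y j i x * T x \<partial>M) = 0"
  proof -
    have e: "Y j i x * T x = (\<Sum>l\<in>F. t l * (Y j l x * Y j i x) - t l * \<rho> (nat \<bar>l - i\<bar>) * (Y j i x * Y j i x))" for x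
      unfolding T_def residual_def by (simp add: sum_distrib_left algebra_simps)
    show "integrable M (\<lambda>x. Y j i x * T x)"
      unfolding e using Y_product_integrable[OF j] by (intro Bochner_Integration.integrable_sum) simp
    show "(\<integral>x. Y j i x * T x \<partial>M) = 0"
      unfolding e using Y_product_integrable[OF j] cov[OF j] \<rho>0 by simp
  qed
  have T2: "integrable M (\<lambda>x. (T x)\<^sup>2)"
    using combination_moments(1)[OF j fi, of c'] unfolding c' by (simp add: T_def)
  have Y2: "(\<integral>x. (Y j i x)\<^sup>2 \<partial>M) = 1"
    using cov[OF j, of i i] \<rho>0 by (simp add: power2_eq_square)
  have "(\<integral>x. (s * Y j i x + T x)\<^sup>2 \<partial>M) = (\<integral>x. s\<^sup>2 * (Y j i x)\<^sup>2 + 2 * s * (Y j i x * T x) + (T x)\<^sup>2 \<partial>M)"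
    by (intro Bochner_Integration.integral_cong) (auto simp: power2_eq_square algebra_simps)
  also have "\<dots> = s\<^sup>2 + (\<integral>x. (T x)\<^sup>2 \<partial>M)"
    using Y_square_integrable[OF j] YT T2 Y2 by simp
  finally have v: "(\<integral>x. (s * Y j i x + T x)\<^sup>2 \<partial>M) = s\<^sup>2 + (\<integral>x. (T x)\<^sup>2 \<partial>M)" .
  have s: "(\<integral>x. (s * Y j i x)\<^sup>2 \<partial>M) = s\<^sup>2" using Y2 by (simp add: power_mult_distrib)
  have "(CLINT x|M. iexp (s * Y j i x + T x)) = of_real (exp (- (s\<^sup>2 + (\<integral>x. (T x)\<^sup>2 \<partial>M)) / 2))"
    using combination_moments(2)[OF j fi, of c] unfolding c T_def[symmetric] v .
  also have "\<dots> = of_real (exp (- s\<^sup>2 / 2)) * of_real (exp (- (\<integral>x. (T x)\<^sup>2 \<partial>M) / 2))"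
    by (simp add: exp_add[symmetric] add_divide_distrib flip: of_real_mult)
  also have "of_real (exp (- s\<^sup>2 / 2)) = (CLINT x|M. iexp (s * Y j i x))"
    using combination_moments(2)[OF j, of "{i}" "\<lambda>_. s"] s by simp
  also have "of_real (exp (- (\<integral>x. (T x)\<^sup>2 \<partial>M) / 2)) = (CLINT x|M. iexp (T x))"
    using combination_moments(2)[OF j fi, of c'] unfolding c' by (simp add: T_def)
  finally show ?thesis by (simp add: T_def)
qed

text \<open>The factorization holds in every column and the columns are independent, so it holds for all columns
  together.\<close>

lemma residual_independence:
  assumes F: "finite F"
    and A: "A \<in> sets (PiM {1..d} (\<lambda>_. borel))" and B: "B \<in> sets (PiM ({1..d} \<times> F) (\<lambda>_. borel))"
  shows "prob {\<omega>\<in>space M. (\<lambda>j\<in>{1..d}. Y j i \<omega>) \<in> A \<and> (\<lambda>p\<in>{1..d}\<times>F. residual i (fst p) (snd p) \<omega>) \<in> B}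
    = prob {\<omega>\<in>space M. (\<lambda>j\<in>{1..d}. Y j i \<omega>) \<in> A} * prob {\<omega>\<in>space M. (\<lambda>p\<in>{1..d}\<times>F. residual i (fst p) (snd p) \<omega>) \<in> B}"
proof (rule independence_from_char_factorization[OF _ _ _ _ _ A B])
  show "finite {1..d}" "finite ({1..d} \<times> F)" using F by simp_all
  show "Y k i \<in> borel_measurable M" if "k \<in> {1..d}" for k using that by simp
  show "residual i (fst p) (snd p) \<in> borel_measurable M" if "p \<in> {1..d} \<times> F" for p
    using that by (auto intro: residual_measurable)
  fix s :: "nat \<Rightarrow> real" and t :: "nat \<times> int \<Rightarrow> real"
  define T where "T j x = (\<Sum>l\<in>F. t (j, l) * residual i j l x)" for j x
  define R where "R f j l = f l - \<rho> (nat \<bar>l - i\<bar>) * f i" for f :: "int \<Rightarrow> real" and j :: nat and l :: int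
  have sumT: "(\<Sum>p\<in>{1..d}\<times>F. t p * residual i (fst p) (snd p) x) = (\<Sum>j\<in>{1..d}. T j x)" for x
    unfolding T_def by (subst sum.Sigma) (use F in \<open>auto intro!: sum.cong\<close>)
  have prodexp: "iexp (\<Sum>j\<in>{1..d}. G j) = (\<Prod>j\<in>{1..d}. iexp (G j))" for G :: "nat \<Rightarrow> real"
    by (simp add: exp_sum sum_distrib_left)
  \<comment> \<open>The parameter \<open>b\<close> switches the residuals on or off, so that one computation serves all three
  integrals.\<close>
  have E: "(CLINT x|M. iexp (\<Sum>j\<in>{1..d}. a j * Y j i x + b * T j x)) = (\<Prod>j\<in>{1..d}. CLINT x|M. iexp (a j * Y j i x + b * T j x))"
    for a :: "nat \<Rightarrow> real" and b :: real
  proof -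
    define g where "g j f = iexp (a j * f i + b * (\<Sum>l\<in>F. t (j, l) * R f j l))" for j and f :: "int \<Rightarrow> real"
    have gm: "g j \<in> borel_measurable seq_space" for j
    proof -
      have [measurable]: "(\<lambda>f. f l) \<in> borel_measurable seq_space" for l :: int by simp
      show ?thesis unfolding g_def[abs_def] R_def by measurable
    qed
    have gY: "g j (\<lambda>i. Y j i x) = iexp (a j * Y j i x + b * T j x)" for j x
      by (simp add: g_def T_def R_def residual_def)
    have "integrable M (\<lambda>\<omega>. g j (\<lambda>i. Y j i \<omega>))" if j: "j \<in> {1..d}" for j
    proof (rule integrable_const_bound[where B=1])
      show "(\<lambda>\<omega>. g j (\<lambda>i. Y j i \<omega>)) \<in> borel_measurable M"
        unfolding gY T_def using j by measurable
      show "AE \<omega> in M. norm (g j (\<lambda>i. Y j i \<omega>)) \<le> 1" unfolding gY by simp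
    qed
    from columns_indep_integral(2)[of g, OF gm this] show ?thesis
      by (simp only: gY prodexp)
  qed
  have "(CLINT x|M. iexp ((\<Sum>k\<in>{1..d}. s k * Y k i x) + (\<Sum>p\<in>{1..d}\<times>F. t p * residual i (fst p) (snd p) x)))
    = (CLINT x|M. iexp (\<Sum>j\<in>{1..d}. s j * Y j i x + 1 * T j x))"
    unfolding sumT by (simp add: sum.distrib)
  also have "\<dots> = (\<Prod>j\<in>{1..d}. (CLINT x|M. iexp (s j * Y j i x + 0 * T j x)) * (CLINT x|M. iexp (0 * Y j i x + 1 * T j x)))"
    unfolding E by (intro prod.cong refl) (simp only: T_def mult_1 mult_zero_left add_0_right add_0_left residual_char[OF _ F])
  also have "\<dots> = (CLINT x|M. iexp (\<Sum>j\<in>{1..d}. s j * Y j i x + 0 * T j x)) * (CLINT x|M. iexp (\<Sum>j\<in>{1..d}. (\<lambda>_. 0) j * Y j i x + 1 * T j x))"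
    unfolding prod.distrib E ..
  finally show "(CLINT x|M. iexp ((\<Sum>k\<in>{1..d}. s k * Y k i x) + (\<Sum>p\<in>{1..d}\<times>F. t p * residual i (fst p) (snd p) x)))
    = (CLINT x|M. iexp (\<Sum>k\<in>{1..d}. s k * Y k i x)) * (CLINT x|M. iexp (\<Sum>p\<in>{1..d}\<times>F. t p * residual i (fst p) (snd p) x))"
    unfolding sumT by simp
qed

text \<open>No exceedance on the set \<open>F\<close> of indices when the level at \<open>l\<close> is \<open>v l\<close>.\<close>

definition quiet :: "(int \<Rightarrow> real) \<Rightarrow> int set \<Rightarrow> 'a set" where
  "quiet v F = {\<omega>\<in>space M. \<forall>l\<in>F. \<omega> \<notin> exceedance (v l) l}"

lemma quiet_sets [measurable]: "quiet v F \<in> sets M"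
proof -
  have "quiet v F = space M - (\<Union>l\<in>F. exceedance (v l) l)" by (auto simp: quiet_def)
  moreover have "(\<Union>l\<in>F. exceedance (v l) l) \<in> sets M" by (intro sets.countable_UN') auto
  ultimately show ?thesis by simp
qed

lemma quiet_mono: "(\<And>l. l \<in> F \<Longrightarrow> v l \<le> v' l) \<Longrightarrow> quiet v F \<subseteq> quiet v' F"
  unfolding quiet_def using exceedance_antimono by blast

lemma quiet_diff_le:
  assumes F: "finite F" and v: "\<And>l. l \<in> F \<Longrightarrow> v l \<le> v' l"
  shows "prob (quiet v' F) - prob (quiet v F) \<le> (\<Sum>l\<in>F. prob (exceedance (v l) l) - prob (exceedance (v' l) l))"
proof -
  have "prob (quiet v' F) - prob (quiet v F) = prob (quiet v' F - quiet v F)"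
    using F v quiet_mono[of F v v'] by (subst finite_measure_Diff) auto
  also have "\<dots> \<le> prob (\<Union>l\<in>F. exceedance (v l) l - exceedance (v' l) l)"
    using F by (intro finite_measure_mono) (auto simp: quiet_def)
  also have "\<dots> \<le> (\<Sum>l\<in>F. prob (exceedance (v l) l - exceedance (v' l) l))"
    using F by (intro finite_measure_subadditive_finite) auto
  also have "\<dots> = (\<Sum>l\<in>F. prob (exceedance (v l) l) - prob (exceedance (v' l) l))"
    using v exceedance_antimono by (intro sum.cong refl finite_measure_Diff) auto
  finally show ?thesis .
qed

definition large :: "real \<Rightarrow> int \<Rightarrow> 'a set" where
  "large R i = {\<omega>\<in>space M. \<exists>j\<in>{1..d}. R < \<bar>Y j i \<omega>\<bar>}"

lemma large_sets [measurable]: "large R i \<in> sets M"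
  unfolding large_def by measurable

lemma prob_large: assumes R: "0 \<le> R" shows "prob (large R i) \<le> 2 * real d * exp (- R\<^sup>2 / 2)"
proof -
  have "prob (large R i) \<le> prob (\<Union>j\<in>{1..d}. {\<omega>\<in>space M. R < \<bar>Y j i \<omega>\<bar>})"
    by (intro finite_measure_mono) (auto simp: large_def)
  also have "\<dots> \<le> (\<Sum>j\<in>{1..d}. prob {\<omega>\<in>space M. R < \<bar>Y j i \<omega>\<bar>})"
    by (intro finite_measure_subadditive_finite) auto
  also have "\<dots> \<le> (\<Sum>j\<in>{1..d}. 2 * exp (- R\<^sup>2 / 2))"
    using chernoff R by (intro sum_mono) auto
  finally show ?thesis by simp
qed

lemma residual_quiet_independent:
  assumes F: "finite F"
  shows "prob ({\<omega>\<in>space M. \<forall>l\<in>F. \<not> exceeds d r (v l) (\<lambda>j. residual i j l \<omega>)} \<inter> exceedance u i)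
    = prob {\<omega>\<in>space M. \<forall>l\<in>F. \<not> exceeds d r (v l) (\<lambda>j. residual i j l \<omega>)} * prob (exceedance u i)"
proof -
  let ?PA = "PiM {1..d} (\<lambda>_. borel :: real measure)" and ?PB = "PiM ({1..d}\<times>F) (\<lambda>_. borel :: real measure)"
  define A where "A = {f\<in>space ?PA. exceeds d r u f}"
  define B where "B = {g\<in>space ?PB. \<forall>l\<in>F. \<not> exceeds d r (v l) (\<lambda>j. g (j, l))}"
  have A: "A \<in> sets ?PA"
    unfolding A_def by measurable
  have B: "B \<in> sets ?PB"
  proof -
    have "Measurable.pred ?PB (\<lambda>g. exceeds d r (v l) (\<lambda>j. g (j, l)))" if "l \<in> F" for l
      using that by (intro exceeds_measurable measurable_component_singleton) auto
    with F show ?thesis unfolding B_def by measurable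
  qed
  have cong: "exceeds d r w f \<longleftrightarrow> exceeds d r w g" if "\<And>j. j \<in> {1..d} \<Longrightarrow> f j = g j" for w f g
    using exceeds_mono[of d r w f w g] exceeds_mono[of d r w g w f] that by auto
  have a: "(\<lambda>j\<in>{1..d}. Y j i \<omega>) \<in> A \<longleftrightarrow> exceeds d r u (\<lambda>j. Y j i \<omega>)" for \<omega>
    unfolding A_def using cong[of "\<lambda>j\<in>{1..d}. Y j i \<omega>" "\<lambda>j. Y j i \<omega>" u] by (simp add: space_PiM)
  have b: "(\<lambda>p\<in>{1..d}\<times>F. residual i (fst p) (snd p) \<omega>) \<in> B \<longleftrightarrow> (\<forall>l\<in>F. \<not> exceeds d r (v l) (\<lambda>j. residual i j l \<omega>))" for \<omega>
  proof -
    have "exceeds d r (v l) (\<lambda>j. (\<lambda>p\<in>{1..d}\<times>F. residual i (fst p) (snd p) \<omega>) (j, l)) \<longleftrightarrow> exceeds d r (v l) (\<lambda>j. residual i j l \<omega>)"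
      if "l \<in> F" for l using that by (intro cong) simp
    then show ?thesis unfolding B_def by (simp add: space_PiM del: restrict_apply)
  qed
  have "{\<omega>\<in>space M. \<forall>l\<in>F. \<not> exceeds d r (v l) (\<lambda>j. residual i j l \<omega>)} \<inter> exceedance u i
      = {\<omega>\<in>space M. exceeds d r u (\<lambda>j. Y j i \<omega>) \<and> (\<forall>l\<in>F. \<not> exceeds d r (v l) (\<lambda>j. residual i j l \<omega>))}"
    by (auto simp: exceedance_def)
  then show ?thesis
    using residual_independence[OF F A B, of i] unfolding a b by (simp add: exceedance_def mult.commute)
qed

text \<open>Outside the event that some \<open>Y j i\<close> exceeds \<open>R\<close> in absolute value, original and residual variables
  differ by at most \<open>\<eta>\<close>, so being quiet for one family implies being quiet for the other at levels
  raised by \<open>\<eta>\<close>. The residual event is independent of the exceedance at \<open>i\<close>. Going from the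
  original to the residual family and back costs a shift of the levels by \<open>2 * \<eta>\<close>, whose effect is
  bounded by the change in the expected number of exceedances.\<close>

lemma mixing_estimate:
  assumes F: "finite F" and R: "0 \<le> R"
    and small: "\<And>l. l \<in> F \<Longrightarrow> \<bar>\<rho> (nat \<bar>l - i\<bar>)\<bar> * R \<le> \<eta>"
  shows "\<bar>prob (quiet v F \<inter> exceedance u i) - prob (quiet v F) * prob (exceedance u i)\<bar>
    \<le> prob (exceedance u i) * (\<Sum>l\<in>F. prob (exceedance (v l - 2 * \<eta>) l) - prob (exceedance (v l + 2 * \<eta>) l))
      + 2 * prob (large R i)"
proof (cases "F = {}")
  case True
  have "quiet v {} = space M" by (simp add: quiet_def)
  then show ?thesis using True by (simp add: prob_space sets.Int_space_eq1)
next
  case False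
  then obtain l0 where "l0 \<in> F" by blast
  then have \<eta>: "0 \<le> \<eta>" using small[of l0] R by (meson abs_ge_zero mult_nonneg_nonneg order_trans)
  \<comment> \<open>The events \<open>A s\<close> and \<open>B s\<close> say that the original and the residual family, respectively, are quiet at levels shifted by \<open>s\<close>.\<close>
  define B where "B s = {\<omega>\<in>space M. \<forall>l\<in>F. \<not> exceeds d r (v l + s) (\<lambda>j. residual i j l \<omega>)}" for s
  define A where "A s = quiet (\<lambda>l. v l + s) F" for s
  let ?E = "exceedance u i" and ?L = "large R i"
  have [measurable]: "B s \<in> sets M" for s
    using F unfolding B_def by measurable
  have [measurable]: "A s \<in> sets M" for s using F unfolding A_def by measurable
  have close: "\<bar>Y j l \<omega> - residual i j l \<omega>\<bar> \<le> \<eta>" if "\<omega> \<in> space M - ?L" "l \<in> F" "j \<in> {1..d}" for \<omega> l j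
  proof -
    have "\<bar>Y j i \<omega>\<bar> \<le> R" using that by (auto simp: large_def not_less)
    then have "\<bar>\<rho> (nat \<bar>l - i\<bar>)\<bar> * \<bar>Y j i \<omega>\<bar> \<le> \<bar>\<rho> (nat \<bar>l - i\<bar>)\<bar> * R" by (intro mult_left_mono) auto
    also have "\<dots> \<le> \<eta>" using small that by blast
    finally show ?thesis by (simp add: residual_def abs_mult)
  qed
  have AB: "A s - ?L \<subseteq> B (s + \<eta>)" for s
  proof
    fix \<omega> assume w: "\<omega> \<in> A s - ?L"
    have "\<not> exceeds d r (v l + (s + \<eta>)) (\<lambda>j. residual i j l \<omega>)" if l: "l \<in> F" for l
    proof
      assume "exceeds d r (v l + (s + \<eta>)) (\<lambda>j. residual i j l \<omega>)"
      then have "exceeds d r (v l + s) (\<lambda>j. Y j l \<omega>)"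
      proof (rule exceeds_mono)
        fix j assume "j \<in> {1..d}" "v l + (s + \<eta>) < residual i j l \<omega>"
        then show "v l + s < Y j l \<omega>" using close[of \<omega> l j] l w by (auto simp: A_def quiet_def abs_le_iff)
      qed
      then show False using w l by (auto simp: A_def quiet_def exceedance_def)
    qed
    then show "\<omega> \<in> B (s + \<eta>)" using w by (auto simp: B_def A_def quiet_def)
  qed
  have BA: "B s - ?L \<subseteq> A (s + \<eta>)" for s
  proof
    fix \<omega> assume w: "\<omega> \<in> B s - ?L"
    have "\<not> exceeds d r (v l + (s + \<eta>)) (\<lambda>j. Y j l \<omega>)" if l: "l \<in> F" for l
    proof
      assume "exceeds d r (v l + (s + \<eta>)) (\<lambda>j. Y j l \<omega>)"
      then have "exceeds d r (v l + s) (\<lambda>j. residual i j l \<omega>)"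
      proof (rule exceeds_mono)
        fix j assume "j \<in> {1..d}" "v l + (s + \<eta>) < Y j l \<omega>"
        then show "v l + s < residual i j l \<omega>" using close[of \<omega> l j] l w by (auto simp: B_def abs_le_iff)
      qed
      then show False using w l by (auto simp: B_def)
    qed
    then show "\<omega> \<in> A (s + \<eta>)" using w by (auto simp: A_def quiet_def B_def exceedance_def)
  qed
  have up: "prob X \<le> prob Z + prob ?L" if "X - ?L \<subseteq> Z" "X \<in> sets M" "Z \<in> sets M" for X Z
  proof -
    have "prob X \<le> prob (Z \<union> ?L)" using that by (intro finite_measure_mono) auto
    also have "\<dots> \<le> prob Z + prob ?L" using that by (intro measure_Un_le) auto
    finally show ?thesis .
  qed
  have E1: "0 \<le> prob ?E" "prob ?E \<le> 1" "0 \<le> prob ?L" by auto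
  have q0: "quiet v F = A 0" by (simp add: A_def)
  have upper: "prob (A 0 \<inter> ?E) \<le> prob ?E * prob (A (2 * \<eta>)) + 2 * prob ?L"
  proof -
    have "prob (A 0 \<inter> ?E) \<le> prob (B \<eta> \<inter> ?E) + prob ?L"
      using AB[of 0] by (intro up) auto
    also have "prob (B \<eta> \<inter> ?E) = prob (B \<eta>) * prob ?E"
      unfolding B_def by (rule residual_quiet_independent[OF F])
    also have "prob (B \<eta>) * prob ?E \<le> (prob (A (2 * \<eta>)) + prob ?L) * prob ?E"
      using BA[of \<eta>] by (intro mult_right_mono up) auto
    also have "\<dots> \<le> prob ?E * prob (A (2 * \<eta>)) + prob ?L"
      using mult_left_le[OF E1(2,3)] by (simp add: algebra_simps)
    finally show ?thesis by simp
  qed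
  have lower: "prob ?E * prob (A (- 2 * \<eta>)) \<le> prob (A 0 \<inter> ?E) + 2 * prob ?L"
  proof -
    have "prob ?E * prob (A (- 2 * \<eta>)) \<le> prob ?E * (prob (B (- \<eta>)) + prob ?L)"
      using AB[of "- 2 * \<eta>"] by (intro mult_left_mono up) auto
    also have "\<dots> \<le> prob (B (- \<eta>)) * prob ?E + prob ?L"
      using mult_left_le[OF E1(2,3)] by (simp add: algebra_simps)
    also have "prob (B (- \<eta>)) * prob ?E = prob (B (- \<eta>) \<inter> ?E)"
      unfolding B_def by (rule residual_quiet_independent[OF F, symmetric])
    also have "\<dots> \<le> prob (A 0 \<inter> ?E) + prob ?L"
      using BA[of "- \<eta>"] by (intro up) auto
    finally show ?thesis by simp
  qed
  have mono: "prob (A (- 2 * \<eta>)) \<le> prob (A 0)" "prob (A 0) \<le> prob (A (2 * \<eta>))"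
    using \<eta> F unfolding A_def by (auto intro!: finite_measure_mono quiet_mono quiet_sets)
  have D: "prob (A (2 * \<eta>)) - prob (A (- 2 * \<eta>)) \<le> (\<Sum>l\<in>F. prob (exceedance (v l - 2 * \<eta>) l) - prob (exceedance (v l + 2 * \<eta>) l))"
    using quiet_diff_le[OF F, of "\<lambda>l. v l + - 2 * \<eta>" "\<lambda>l. v l + 2 * \<eta>"] \<eta> by (simp add: A_def)
  have "\<bar>prob (A 0 \<inter> ?E) - prob (A 0) * prob ?E\<bar> \<le> prob ?E * (prob (A (2 * \<eta>)) - prob (A (- 2 * \<eta>))) + 2 * prob ?L"
    using upper lower mult_left_mono[OF mono(1) E1(1)] mult_left_mono[OF mono(2) E1(1)]
    by (simp add: abs_le_iff algebra_simps)
  also have "\<dots> \<le> prob ?E * (\<Sum>l\<in>F. prob (exceedance (v l - 2 * \<eta>) l) - prob (exceedance (v l + 2 * \<eta>) l)) + 2 * prob ?L"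
    using D E1 by (intro add_right_mono mult_left_mono) auto
  finally show ?thesis unfolding q0 .
qed

end

section \<open>Poisson approximation for a finite set of indices\<close>

lemma exp_minus_bounds:
  fixes p :: real assumes "0 \<le> p"
  shows "\<bar>(1 - p) - exp (- p)\<bar> \<le> p * p"
proof -
  have "1 - p \<le> exp (- p)" using exp_ge_add_one_self[of "- p"] by simp
  moreover have "exp (- p) \<le> 1 - p + p * p"
  proof -
    have "1 \<le> (1 + p) * (1 - p + p * p)" using assms by (simp add: algebra_simps)
    also have "\<dots> \<le> exp p * (1 - p + p * p)"
    proof (rule mult_right_mono)
      show "1 + p \<le> exp p" by (rule exp_ge_add_one_self)
      have "0 \<le> (p - 1)\<^sup>2 + p" using assms by simp
      then show "0 \<le> 1 - p + p * p" by (simp add: power2_eq_square algebra_simps)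
    qed
    finally have "exp (- p) * 1 \<le> exp (- p) * (exp p * (1 - p + p * p))" by (intro mult_left_mono) auto
    then show ?thesis by (simp add: mult.assoc[symmetric] exp_add[symmetric])
  qed
  ultimately show ?thesis by (simp add: abs_le_iff)
qed

lemma prod_one_minus_approx_exp:
  fixes p :: "'i \<Rightarrow> real"
  assumes "\<And>i. i \<in> I \<Longrightarrow> 0 \<le> p i" "\<And>i. i \<in> I \<Longrightarrow> p i \<le> 1" "\<And>i. i \<in> I \<Longrightarrow> p i \<le> m"
  shows "\<bar>(\<Prod>i\<in>I. 1 - p i) - exp (- (\<Sum>i\<in>I. p i))\<bar> \<le> m * (\<Sum>i\<in>I. p i)"
proof (cases "finite I")
  case True
  have "\<bar>(\<Prod>i\<in>I. 1 - p i) - (\<Prod>i\<in>I. exp (- p i))\<bar> \<le> (\<Sum>i\<in>I. \<bar>(1 - p i) - exp (- p i)\<bar>)"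
    using norm_prod_diff[of I "\<lambda>i. 1 - p i" "\<lambda>i. exp (- p i)"] assms by simp
  also have "\<dots> \<le> (\<Sum>i\<in>I. m * p i)"
  proof (rule sum_mono)
    fix i assume "i \<in> I"
    then have "p i * p i \<le> m * p i" using assms by (intro mult_right_mono) auto
    then show "\<bar>(1 - p i) - exp (- p i)\<bar> \<le> m * p i" using exp_minus_bounds[of "p i"] assms \<open>i \<in> I\<close> by auto
  qed
  finally show ?thesis by (simp add: exp_sum[OF True, symmetric] sum_negf sum_distrib_left)
qed simp

text \<open>Adding the largest index \<open>b\<close> multiplies the approximating product by \<open>1 - P(E b)\<close> and changes the
  probability by \<open>P(A \<inter> E b)\<close>, where \<open>A\<close> is the event for the smaller indices; as \<open>1 - P(E b)\<close>
  is at most one, the errors simply add up.\<close>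

lemma (in prob_space) no_event_approx_product:
  fixes E :: "int \<Rightarrow> 'a set"
  assumes I: "finite I" and E: "\<And>i. E i \<in> sets M"
  defines "N \<equiv> \<lambda>F. {\<omega>\<in>space M. \<forall>l\<in>F. \<omega> \<notin> E l}"
  shows "\<bar>prob (N I) - (\<Prod>i\<in>I. 1 - prob (E i))\<bar>
    \<le> (\<Sum>i\<in>I. \<bar>prob (N {l\<in>I. l < i} \<inter> E i) - prob (N {l\<in>I. l < i}) * prob (E i)\<bar>)"
  using I
proof (induction I rule: finite_linorder_max_induct)
  case empty
  then show ?case by (simp add: N_def prob_space)
next
  case (insert b I)
  have Nm: "N F \<in> sets M" if "finite F" for F
    unfolding N_def using that E by measurable
  have bI: "b \<notin> I" using insert by auto
  have s1: "{l \<in> insert b I. l < b} = I" using insert by auto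
  have s2: "{l \<in> insert b I. l < i} = {l\<in>I. l < i}" if "i \<in> I" for i using insert that by force
  have "N (insert b I) = N I - (N I \<inter> E b)" by (auto simp: N_def)
  then have p: "prob (N (insert b I)) = prob (N I) - prob (N I \<inter> E b)"
    using Nm[OF insert.hyps(1)] E by (simp add: finite_measure_Diff)
  let ?err = "\<lambda>I i. \<bar>prob (N {l\<in>I. l < i} \<inter> E i) - prob (N {l\<in>I. l < i}) * prob (E i)\<bar>"
  have sum: "(\<Sum>i\<in>insert b I. ?err (insert b I) i) = \<bar>prob (N I \<inter> E b) - prob (N I) * prob (E b)\<bar> + (\<Sum>i\<in>I. ?err I i)"
    unfolding sum.insert[OF insert.hyps(1) bI] s1 by (simp only: s2 cong: sum.cong)
  have "prob (N (insert b I)) - (\<Prod>i\<in>insert b I. 1 - prob (E i))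
      = (1 - prob (E b)) * (prob (N I) - (\<Prod>i\<in>I. 1 - prob (E i))) - (prob (N I \<inter> E b) - prob (N I) * prob (E b))"
    using insert.hyps(1) bI by (simp add: p algebra_simps)
  then have "\<bar>prob (N (insert b I)) - (\<Prod>i\<in>insert b I. 1 - prob (E i))\<bar>
      \<le> \<bar>1 - prob (E b)\<bar> * \<bar>prob (N I) - (\<Prod>i\<in>I. 1 - prob (E i))\<bar> + \<bar>prob (N I \<inter> E b) - prob (N I) * prob (E b)\<bar>"
    unfolding abs_mult[symmetric] by linarith
  also have "\<bar>1 - prob (E b)\<bar> * \<bar>prob (N I) - (\<Prod>i\<in>I. 1 - prob (E i))\<bar> \<le> 1 * \<bar>prob (N I) - (\<Prod>i\<in>I. 1 - prob (E i))\<bar>"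
    by (intro mult_right_mono) auto
  also have "\<dots> \<le> (\<Sum>i\<in>I. ?err I i)" using insert.IH by simp
  finally show ?case unfolding sum by simp
qed

context gaussian_columns
begin

text \<open>The five error terms come from pairs of exceedances at distance at most \<open>L\<close>, from leaving the close
  past out of the product, from the shift of the levels in \<open>mixing_estimate\<close>, from unusually large
  values at the current index, and from replacing \<open>1 - p\<close> by \<open>exp (- p)\<close>.\<close>

lemma quiet_poisson_bound:
  assumes I: "finite I" and a: "0 < a" "\<And>i. i \<in> I \<Longrightarrow> a \<le> v i"
    and \<delta>: "0 \<le> \<delta>" "\<And>n. 1 \<le> n \<Longrightarrow> \<rho> n \<le> \<delta>"
    and R: "0 \<le> R" and \<eta>: "\<And>n. L < n \<Longrightarrow> \<bar>\<rho> n\<bar> * R \<le> \<eta>" "0 \<le> \<eta>"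
    and m: "\<And>i. i \<in> I \<Longrightarrow> prob (exceedance (v i) i) \<le> m"
  defines "\<Lambda> \<equiv> \<Sum>i\<in>I. prob (exceedance (v i) i)"
    and "D \<equiv> \<Sum>i\<in>I. prob (exceedance (v i - 2 * \<eta>) i) - prob (exceedance (v i + 2 * \<eta>) i)"
  shows "\<bar>prob (quiet v I) - exp (- \<Lambda>)\<bar>
    \<le> real (card I) * real L * ((real (d choose r))\<^sup>2 * exp (- (real r * a\<^sup>2 / (1 + \<delta>))))
      + \<Lambda> * (real L * m) + \<Lambda> * D + real (card I) * (4 * real d * exp (- R\<^sup>2 / 2)) + m * \<Lambda>"
proof -
  define E where "E i = exceedance (v i) i" for i
  define p where "p i = prob (E i)" for i
  have E: "E i \<in> sets M" for i by (simp add: E_def)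
  have q: "quiet v F = {\<omega>\<in>space M. \<forall>l\<in>F. \<omega> \<notin> E l}" for F by (simp add: quiet_def E_def)
  have p: "0 \<le> p i" "p i \<le> 1" for i by (auto simp: p_def)
  have pm: "i \<in> I \<Longrightarrow> p i \<le> m" for i using m by (simp add: p_def E_def)
  let ?c = "(real (d choose r))\<^sup>2 * exp (- (real r * a\<^sup>2 / (1 + \<delta>)))"
  have err: "\<bar>prob (quiet v {l\<in>I. l < i} \<inter> E i) - prob (quiet v {l\<in>I. l < i}) * p i\<bar>
     \<le> real L * ?c + p i * (real L * m) + p i * D + 4 * real d * exp (- R\<^sup>2 / 2)" if i: "i \<in> I" for i
  proof -
    \<comment> \<open>The past of \<open>i\<close> splits into a near part \<open>Fn\<close> and a far part \<open>Ff\<close>.\<close>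
    define Fn where "Fn = {l\<in>I. l < i \<and> nat \<bar>l - i\<bar> \<le> L}"
    define Ff where "Ff = {l\<in>I. l < i \<and> L < nat \<bar>l - i\<bar>}"
    have fin: "finite Fn" "finite Ff" using I by (auto simp: Fn_def Ff_def)
    have split: "quiet v {l\<in>I. l < i} = quiet v Ff - (\<Union>l\<in>Fn. E l)"
    proof -
      have "{l\<in>I. l < i} = Ff \<union> Fn" by (auto simp: Fn_def Ff_def not_less)
      then show ?thesis by (auto simp: q)
    qed
    have cardn: "card Fn \<le> L"
    proof -
      have "Fn \<subseteq> {i - int L..<i}" by (auto simp: Fn_def)
      then have "card Fn \<le> card {i - int L..<i}" by (intro card_mono) auto
      then show ?thesis by simp
    qed
    have up: "prob (quiet v {l\<in>I. l < i} \<inter> B) \<le> prob (quiet v Ff \<inter> B)" if "B \<in> sets M" for B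
      unfolding split using fin that E by (intro finite_measure_mono) auto
    have low: "prob (quiet v Ff \<inter> B) \<le> prob (quiet v {l\<in>I. l < i} \<inter> B) + (\<Sum>l\<in>Fn. prob (E l \<inter> B))"
      if B: "B \<in> sets M" for B
    proof -
      have "prob (quiet v Ff \<inter> B) \<le> prob ((quiet v {l\<in>I. l < i} \<inter> B) \<union> (\<Union>l\<in>Fn. E l \<inter> B))"
        using I fin E B by (intro finite_measure_mono) (auto simp: split)
      also have "\<dots> \<le> prob (quiet v {l\<in>I. l < i} \<inter> B) + prob (\<Union>l\<in>Fn. E l \<inter> B)"
        using I fin E B by (intro measure_Un_le) auto
      also have "prob (\<Union>l\<in>Fn. E l \<inter> B) \<le> (\<Sum>l\<in>Fn. prob (E l \<inter> B))"
        using I fin E B by (intro finite_measure_subadditive_finite) auto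
      finally show ?thesis by simp
    qed
    have qs: "quiet v F \<inter> space M = quiet v F" for F by (auto simp: quiet_def)
    have near1: "(\<Sum>l\<in>Fn. prob (E l \<inter> E i)) \<le> real L * ?c"
    proof -
      have "(\<Sum>l\<in>Fn. prob (E l \<inter> E i)) \<le> (\<Sum>l\<in>Fn. ?c)"
      proof (rule sum_mono)
        fix l assume l: "l \<in> Fn"
        have "\<rho> (nat \<bar>l - i\<bar>) \<le> \<delta>" using l by (intro \<delta>) (auto simp: Fn_def)
        then show "prob (E l \<inter> E i) \<le> ?c"
          unfolding E_def using l a i \<delta>(1) by (intro joint_exceedance) (auto simp: Fn_def)
      qed
      also have "\<dots> \<le> real L * ?c" using cardn by (simp add: mult_right_mono)
      finally show ?thesis .
    qed
    have near2: "(\<Sum>l\<in>Fn. prob (E l \<inter> space M)) \<le> real L * m"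
    proof -
      have "(\<Sum>l\<in>Fn. prob (E l \<inter> space M)) = (\<Sum>l\<in>Fn. p l)"
        using sets.sets_into_space[OF E] by (simp add: p_def Int_absorb2)
      also have "\<dots> \<le> (\<Sum>l\<in>Fn. m)" using pm by (intro sum_mono) (auto simp: Fn_def)
      also have "\<dots> \<le> real L * m" using cardn p(1)[of i] pm[OF i] by (simp add: mult_right_mono)
      finally show ?thesis .
    qed
    have far: "\<bar>prob (quiet v Ff \<inter> E i) - prob (quiet v Ff) * p i\<bar> \<le> p i * D + 4 * real d * exp (- R\<^sup>2 / 2)"
    proof -
      have "\<bar>prob (quiet v Ff \<inter> E i) - prob (quiet v Ff) * p i\<bar>
        \<le> p i * (\<Sum>l\<in>Ff. prob (exceedance (v l - 2 * \<eta>) l) - prob (exceedance (v l + 2 * \<eta>) l)) + 2 * prob (large R i)"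
        unfolding E_def p_def using \<eta> by (intro mixing_estimate[OF fin(2) R]) (auto simp: Ff_def)
      also have "(\<Sum>l\<in>Ff. prob (exceedance (v l - 2 * \<eta>) l) - prob (exceedance (v l + 2 * \<eta>) l)) \<le> D"
        unfolding D_def
      proof (rule sum_mono2[OF I])
        fix b
        have "exceedance (v b + 2 * \<eta>) b \<subseteq> exceedance (v b - 2 * \<eta>) b"
          using \<eta>(2) by (intro exceedance_antimono) simp
        then show "0 \<le> prob (exceedance (v b - 2 * \<eta>) b) - prob (exceedance (v b + 2 * \<eta>) b)"
          by (simp add: finite_measure_mono)
      qed (auto simp: Ff_def)
      finally show ?thesis using prob_large[OF R, of i] p[of i] by (simp add: mult_left_mono)
    qed
    have "prob (quiet v {l\<in>I. l < i}) * p i \<le> prob (quiet v Ff) * p i"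
      using up[of "space M"] p by (intro mult_right_mono) (auto simp: qs)
    moreover have "prob (quiet v Ff) * p i \<le> prob (quiet v {l\<in>I. l < i}) * p i + p i * (real L * m)"
    proof -
      have "prob (quiet v Ff) \<le> prob (quiet v {l\<in>I. l < i}) + real L * m"
        using low[of "space M"] near2 by (simp add: qs)
      from mult_right_mono[OF this p(1)[of i]] show ?thesis by (simp add: algebra_simps)
    qed
    ultimately show ?thesis
      using far up[OF E, of i] low[OF E, of i] near1 p(1)[of i] by (simp only: abs_le_iff) linarith
  qed
  have "\<bar>prob (quiet v I) - (\<Prod>i\<in>I. 1 - p i)\<bar>
    \<le> (\<Sum>i\<in>I. real L * ?c + p i * (real L * m) + p i * D + 4 * real d * exp (- R\<^sup>2 / 2))"
    using no_event_approx_product[OF I E] sum_mono[OF err]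
    unfolding p_def q by (rule order_trans)
  also have "\<dots> = real (card I) * real L * ?c + \<Lambda> * (real L * m) + \<Lambda> * D + real (card I) * (4 * real d * exp (- R\<^sup>2 / 2))"
    by (simp add: sum.distrib sum_distrib_right[symmetric] \<Lambda>_def p_def E_def)
  finally have 1: "\<bar>prob (quiet v I) - (\<Prod>i\<in>I. 1 - p i)\<bar>
    \<le> real (card I) * real L * ?c + \<Lambda> * (real L * m) + \<Lambda> * D + real (card I) * (4 * real d * exp (- R\<^sup>2 / 2))" .
  have 2: "\<bar>(\<Prod>i\<in>I. 1 - p i) - exp (- \<Lambda>)\<bar> \<le> m * \<Lambda>"
    using prod_one_minus_approx_exp[of I p m] p pm by (simp add: \<Lambda>_def p_def E_def)
  from 1 2 show ?thesis by linarith
qed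

end

section \<open>Sums of tail probabilities along a line\<close>

definition tail_const :: "nat \<Rightarrow> nat \<Rightarrow> real" where
  "tail_const d r = real (d choose r) * (1 / sqrt (2 * pi)) ^ r"

text \<open>The asymptotic form of the probability that an order statistic exceeds \<open>v\<close>, namely
  \<open>(d choose r)\<close> times the \<open>r\<close>-th power of \<open>\<phi>(v) / v\<close>; see \<open>tail_rate_eq\<close>.\<close>

definition tail_rate :: "nat \<Rightarrow> nat \<Rightarrow> real \<Rightarrow> real" where
  "tail_rate d r v = tail_const d r * exp (- real r * v\<^sup>2 / 2) / v ^ r"

text \<open>Asymptotically the integral of \<open>tail_rate\<close> over \<open>{v..}\<close>.\<close>

definition tail_mass :: "nat \<Rightarrow> nat \<Rightarrow> real \<Rightarrow> real" where
  "tail_mass d r v = tail_const d r / real r * exp (- real r * v\<^sup>2 / 2) / v ^ (r + 1)"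

lemma tail_const_pos: "r \<le> d \<Longrightarrow> 0 < tail_const d r"
  by (simp add: tail_const_def)

lemma tail_rate_nonneg: "0 \<le> v \<Longrightarrow> 0 \<le> tail_rate d r v"
  by (simp add: tail_rate_def tail_const_def)

lemma tail_rate_antimono:
  assumes "0 < u" "u \<le> v" shows "tail_rate d r v \<le> tail_rate d r u"
proof -
  have "exp (- real r * v\<^sup>2 / 2) \<le> exp (- real r * u\<^sup>2 / 2)"
    using assms by (simp add: mult_left_mono power_mono)
  then show ?thesis
    unfolding tail_rate_def using assms
    by (intro frac_le mult_left_mono power_mono) (auto simp: tail_const_def)
qed

lemma tail_mass_pos: "1 \<le> r \<Longrightarrow> r \<le> d \<Longrightarrow> 0 < v \<Longrightarrow> 0 < tail_mass d r v"
  using tail_const_pos by (simp add: tail_mass_def)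

lemma tail_mass_deriv:
  assumes "1 \<le> r" "0 < v"
  shows "(tail_mass d r has_real_derivative - (tail_rate d r v * (1 + (real r + 1) / (real r * v\<^sup>2)))) (at v)"
proof -
  obtain n where n: "r = Suc n" using assms(1) by (cases r) auto
  define k where "k = real r"
  have k: "k > 0" using n by (simp add: k_def)
  have 1: "((\<lambda>v. tail_const d r / k * exp (- k * v\<^sup>2 / 2)) has_real_derivative
      tail_const d r / k * (exp (- k * v\<^sup>2 / 2) * (- k * (2 * v) / 2))) (at v)"
    using k by (auto intro!: derivative_eq_intros simp: field_simps)
  have 2: "((\<lambda>v. v ^ (r + 1)) has_real_derivative real (r + 1) * v ^ r) (at v)"
    using DERIV_pow[of "r + 1" v] by simp
  have "((\<lambda>v. tail_const d r / k * exp (- k * v\<^sup>2 / 2) / v ^ (r + 1)) has_real_derivative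
     (tail_const d r / k * (exp (- k * v\<^sup>2 / 2) * (- k * (2 * v) / 2)) * v ^ (r + 1)
       - tail_const d r / k * exp (- k * v\<^sup>2 / 2) * (real (r + 1) * v ^ r)) / (v ^ (r + 1) * v ^ (r + 1))) (at v)"
    using DERIV_divide[OF 1 2] assms(2) by simp
  moreover have "(tail_const d r / k * (exp (- k * v\<^sup>2 / 2) * (- k * (2 * v) / 2)) * v ^ (r + 1)
       - tail_const d r / k * exp (- k * v\<^sup>2 / 2) * (real (r + 1) * v ^ r)) / (v ^ (r + 1) * v ^ (r + 1))
     = - (tail_rate d r v * (1 + (k + 1) / (k * v\<^sup>2)))"
  proof -
    define e where "e = exp (- k * v\<^sup>2 / 2)"
    define p where "p = v ^ r"
    have p: "p \<noteq> 0" using assms(2) by (simp add: p_def)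
    have kr: "real (r + 1) = k + 1" by (simp add: k_def)
    have vp: "v ^ (r + 1) = v * p" by (simp add: p_def)
    show ?thesis
      unfolding tail_rate_def k_def[symmetric] e_def[symmetric] p_def[symmetric] vp kr
      using k p assms(2) by (simp add: field_simps power2_eq_square)
  qed
  ultimately show ?thesis unfolding tail_mass_def[abs_def] k_def by simp
qed

text \<open>By the mean value theorem, an increment of \<open>tail_mass\<close> over a step of length \<open>\<beta>\<close> is \<open>\<beta>\<close> times
  \<open>tail_rate\<close> at an intermediate point, up to a factor close to one; as \<open>tail_rate\<close> decreases, the
  sums over the points \<open>\<beta> * i\<close> can be compared with telescoping sums.\<close>

lemma tail_mass_increment:
  assumes r: "1 \<le> r" and u: "0 < u" and \<beta>: "0 < \<beta>"
  shows "\<beta> * tail_rate d r (u + \<beta>) \<le> tail_mass d r u - tail_mass d r (u + \<beta>)"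
    and "tail_mass d r u - tail_mass d r (u + \<beta>) \<le> \<beta> * (tail_rate d r u * (1 + (real r + 1) / (real r * u\<^sup>2)))"
proof -
  obtain z where z: "u < z" "z < u + \<beta>"
    and eq: "tail_mass d r (u + \<beta>) - tail_mass d r u = (u + \<beta> - u) * - (tail_rate d r z * (1 + (real r + 1) / (real r * z\<^sup>2)))"
    using MVT2[of u "u + \<beta>" "tail_mass d r" "\<lambda>v. - (tail_rate d r v * (1 + (real r + 1) / (real r * v\<^sup>2)))"]
      tail_mass_deriv[OF r, of _ d] u \<beta> by auto
  from eq have eq: "tail_mass d r u - tail_mass d r (u + \<beta>) = \<beta> * (tail_rate d r z * (1 + (real r + 1) / (real r * z\<^sup>2)))"
    by simp
  have nn: "0 \<le> tail_rate d r z" "0 \<le> tail_rate d r u" using tail_rate_nonneg u z by auto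
  have "tail_rate d r (u + \<beta>) * 1 \<le> tail_rate d r z * (1 + (real r + 1) / (real r * z\<^sup>2))"
    using z u nn by (intro mult_mono tail_rate_antimono) auto
  then show "\<beta> * tail_rate d r (u + \<beta>) \<le> tail_mass d r u - tail_mass d r (u + \<beta>)"
    unfolding eq using \<beta> by (intro mult_left_mono) auto
  have "(real r + 1) / (real r * z\<^sup>2) \<le> (real r + 1) / (real r * u\<^sup>2)"
    using z u r by (intro divide_left_mono mult_left_mono power_mono mult_pos_pos) auto
  then have "tail_rate d r z * (1 + (real r + 1) / (real r * z\<^sup>2)) \<le> tail_rate d r u * (1 + (real r + 1) / (real r * u\<^sup>2))"
    using z u nn by (intro mult_mono tail_rate_antimono add_left_mono) auto
  then show "tail_mass d r u - tail_mass d r (u + \<beta>) \<le> \<beta> * (tail_rate d r u * (1 + (real r + 1) / (real r * u\<^sup>2)))"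
    unfolding eq using \<beta> by (intro mult_left_mono) auto
qed

lemma sum_tail_rate_upper:
  fixes \<beta> :: real
  assumes r: "1 \<le> r" "r \<le> d" and \<beta>: "0 < \<beta>" and m: "0 < m" "m \<le> n"
  shows "\<beta> * (\<Sum>i\<in>{m<..n::int}. tail_rate d r (\<beta> * i)) \<le> tail_mass d r (\<beta> * m)"
proof -
  have "\<beta> * (\<Sum>i\<in>{m<..n}. tail_rate d r (\<beta> * i)) \<le> tail_mass d r (\<beta> * m) - tail_mass d r (\<beta> * n)"
    using m(2)
  proof (induction n rule: int_ge_induct)
    case base
    then show ?case by simp
  next
    case (step n)
    have "{m<..n + 1} = insert (n + 1) {m<..n}" using step by auto
    then have "\<beta> * (\<Sum>i\<in>{m<..n + 1}. tail_rate d r (\<beta> * i)) = \<beta> * tail_rate d r (\<beta> * n + \<beta>) + \<beta> * (\<Sum>i\<in>{m<..n}. tail_rate d r (\<beta> * i))"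
      by (simp add: algebra_simps)
    also have "\<dots> \<le> tail_mass d r (\<beta> * m) - tail_mass d r (\<beta> * n + \<beta>)"
      using tail_mass_increment(1)[OF r(1), of "\<beta> * n" \<beta> d] step \<beta> m by simp
    finally show ?case by (simp add: algebra_simps)
  qed
  moreover have "0 \<le> tail_mass d r (\<beta> * n)" using tail_mass_pos[OF r, of "\<beta> * n"] \<beta> m by simp
  ultimately show ?thesis by simp
qed

lemma sum_tail_rate_lower:
  fixes \<beta> :: real
  assumes r: "1 \<le> r" "r \<le> d" and \<beta>: "0 < \<beta>" and m: "0 < m" "m \<le> n"
  shows "tail_mass d r (\<beta> * (m + 1)) - tail_mass d r (\<beta> * (n + 1))
    \<le> \<beta> * ((\<Sum>i\<in>{m<..n::int}. tail_rate d r (\<beta> * i)) * (1 + (real r + 1) / (real r * (\<beta> * m)\<^sup>2)))"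
  using m(2)
proof (induction n rule: int_ge_induct)
  case base
  then show ?case by simp
next
  case (step n)
  let ?K = "1 + (real r + 1) / (real r * (\<beta> * m)\<^sup>2)"
  have n: "0 < \<beta> * (n + 1)" using step m \<beta> by simp
  have "{m<..n + 1} = insert (n + 1) {m<..n}" using step by auto
  then have e: "\<beta> * ((\<Sum>i\<in>{m<..n + 1}. tail_rate d r (\<beta> * i)) * ?K) = \<beta> * (tail_rate d r (\<beta> * (n + 1)) * ?K) + \<beta> * ((\<Sum>i\<in>{m<..n}. tail_rate d r (\<beta> * i)) * ?K)"
    by (simp add: algebra_simps)
  have "(real r + 1) / (real r * (\<beta> * (n + 1))\<^sup>2) \<le> (real r + 1) / (real r * (\<beta> * m)\<^sup>2)"
    using step m \<beta> r by (intro divide_left_mono mult_left_mono power_mono mult_pos_pos) auto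
  then have "\<beta> * (tail_rate d r (\<beta> * (n + 1)) * (1 + (real r + 1) / (real r * (\<beta> * (n + 1))\<^sup>2))) \<le> \<beta> * (tail_rate d r (\<beta> * (n + 1)) * ?K)"
    using \<beta> tail_rate_nonneg[of "\<beta> * (n + 1)" d r] n by (intro mult_left_mono add_left_mono) auto
  then have "tail_mass d r (\<beta> * (n + 1)) - tail_mass d r (\<beta> * (n + 1) + \<beta>) \<le> \<beta> * (tail_rate d r (\<beta> * (n + 1)) * ?K)"
    using tail_mass_increment(2)[OF r(1) n \<beta>, of d] by linarith
  then show ?case using step.IH e by (simp add: algebra_simps)
qed

section \<open>The normalisation\<close>

lemma floor_multiple_bounds:
  fixes \<beta> z :: real
  assumes "0 < \<beta>"
  shows "\<beta> * \<lfloor>z / \<beta>\<rfloor> \<le> z" "z < \<beta> * \<lfloor>z / \<beta>\<rfloor> + \<beta>"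
proof -
  have "\<beta> * \<lfloor>z / \<beta>\<rfloor> \<le> \<beta> * (z / \<beta>)" using assms by (intro mult_left_mono) auto
  also have "\<dots> = z" using assms by simp
  finally show "\<beta> * \<lfloor>z / \<beta>\<rfloor> \<le> z" .
  have "z / \<beta> < \<lfloor>z / \<beta>\<rfloor> + 1" by linarith
  then show "z < \<beta> * \<lfloor>z / \<beta>\<rfloor> + \<beta>" using assms by (simp add: pos_divide_less_eq algebra_simps)
qed

lemma ln_inverse_at_top: "filterlim (\<lambda>\<beta>::real. ln (1 / \<beta>)) at_top (at_right 0)"
  by real_asymp

lemma eventually_at_right_pos: "\<forall>\<^sub>F \<beta>::real in at_right 0. 0 < \<beta>"
  by (simp add: eventually_at_right_less)

context
  fixes d r :: nat
  assumes r: "1 \<le> r" "r \<le> d"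
begin

private abbreviation "a \<equiv> norm_a d r"

text \<open>The leading term of \<open>norm_a\<close>.\<close>

private definition "B \<beta> = sqrt (2 / real r * ln (1 / \<beta>))" for \<beta> :: real
text \<open>The expression under the square root in \<open>norm_a\<close>, without the factor \<open>2 / r\<close>.\<close>

private definition "A \<beta> = ln (1 / \<beta>) - (real r + 1) / 2 * ln (2 / real r * ln (1 / \<beta>)) + ln (tail_const d r / real r)" for \<beta> :: real

private lemma const_eq: "real (d choose r) / real r * (2 * pi) powr (- real r / 2) = tail_const d r / real r"
proof -
  have "(2 * pi) powr (- real r / 2) = inverse ((2 * pi) powr (1/2)) powr real r"
    by (simp add: powr_powr powr_minus[symmetric])
  also have "\<dots> = (1 / sqrt (2 * pi)) ^ r"
    by (simp add: powr_realpow powr_half_sqrt inverse_eq_divide)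
  finally show ?thesis by (simp add: tail_const_def)
qed

private lemma a_eq: "a \<beta> = sqrt (2 / real r * A \<beta>)"
  unfolding norm_a_def const_eq A_def ..

private lemma A_asymp: "((\<lambda>\<beta>. A \<beta> / ln (1 / \<beta>)) \<longlongrightarrow> 1) (at_right 0)"
proof -
  define k where "k = real r"
  define c where "c = ln (tail_const d r / real r)"
  have k: "k > 0" using r by (simp add: k_def)
  have "((\<lambda>s. (s - (k + 1) / 2 * ln (2 / k * s) + c) / s) \<longlongrightarrow> 1) at_top"
    using k by real_asymp
  from filterlim_compose[OF this ln_inverse_at_top] show ?thesis
    unfolding A_def k_def c_def by simp
qed

private lemma A_at_top: "filterlim A at_top (at_right 0)"
proof -
  have "filterlim (\<lambda>\<beta>. A \<beta> / ln (1 / \<beta>) * ln (1 / \<beta>)) at_top (at_right 0)"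
    by (rule filterlim_tendsto_pos_mult_at_top[OF A_asymp _ ln_inverse_at_top]) simp
  moreover have "\<forall>\<^sub>F \<beta> in at_right 0. 0 < ln (1 / \<beta> :: real)"
    using ln_inverse_at_top by (simp add: filterlim_at_top_dense)
  then have "\<forall>\<^sub>F \<beta> in at_right 0. A \<beta> / ln (1 / \<beta>) * ln (1 / \<beta>) = A \<beta>"
    by eventually_elim simp
  ultimately show ?thesis by (simp cong: filterlim_cong)
qed

lemma norm_a_at_top: "filterlim (norm_a d r) at_top (at_right 0)"
proof -
  have "filterlim (\<lambda>\<beta>. 2 / real r * A \<beta>) at_top (at_right 0)"
    by (rule filterlim_tendsto_pos_mult_at_top[OF tendsto_const _ A_at_top]) (use r in simp)
  then show ?thesis unfolding a_eq[abs_def] by (rule filterlim_compose[OF sqrt_at_top])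
qed

private lemma B_at_top: "filterlim B at_top (at_right 0)"
proof -
  have "filterlim (\<lambda>\<beta>. 2 / real r * ln (1 / \<beta>)) at_top (at_right 0)"
    by (rule filterlim_tendsto_pos_mult_at_top[OF tendsto_const _ ln_inverse_at_top]) (use r in simp)
  then show ?thesis unfolding B_def[abs_def] by (rule filterlim_compose[OF sqrt_at_top])
qed

private lemma a_over_B: "((\<lambda>\<beta>. a \<beta> / B \<beta>) \<longlongrightarrow> 1) (at_right 0)"
proof -
  have "((\<lambda>\<beta>. sqrt (A \<beta> / ln (1 / \<beta>))) \<longlongrightarrow> sqrt 1) (at_right 0)"
    by (intro tendsto_real_sqrt A_asymp)
  moreover have "sqrt (A \<beta> / ln (1 / \<beta>)) = a \<beta> / B \<beta>" for \<beta>
    unfolding a_eq B_def real_sqrt_divide[symmetric] using r by simp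
  ultimately show ?thesis by simp
qed

text \<open>This is what \<open>norm_a\<close> is designed for: the logarithmic corrections in its definition turn
  \<open>exp (- r a^2 / 2)\<close> into \<open>\<beta>\<close> times the power of the leading term that compensates the denominator
  of \<open>tail_mass\<close>.\<close>

private lemma exp_a: "\<forall>\<^sub>F \<beta> in at_right 0. tail_const d r / real r * exp (- real r * (a \<beta>)\<^sup>2 / 2) = \<beta> * B \<beta> ^ (r + 1)"
proof -
  have "\<forall>\<^sub>F \<beta> in at_right 0. 0 < A \<beta>" using A_at_top by (simp add: filterlim_at_top_dense)
  moreover have "\<forall>\<^sub>F \<beta> in at_right 0. 0 < ln (1 / \<beta> :: real)"
    using ln_inverse_at_top by (simp add: filterlim_at_top_dense)
  moreover note eventually_at_right_pos
  ultimately show ?thesis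
  proof eventually_elim
    case (elim \<beta>)
    let ?s = "2 / real r * ln (1 / \<beta>)"
    have s: "0 < ?s" using elim r by simp
    have c: "0 < tail_const d r / real r" using tail_const_pos[of r d] r by simp
    have "(a \<beta>)\<^sup>2 = 2 / real r * A \<beta>" unfolding a_eq using elim r by simp
    then have "- real r * (a \<beta>)\<^sup>2 / 2 = - A \<beta>" using r by simp
    also have "\<dots> = ln \<beta> + (real r + 1) / 2 * ln ?s - ln (tail_const d r / real r)"
      unfolding A_def using elim by (simp add: ln_div)
    finally have "exp (- real r * (a \<beta>)\<^sup>2 / 2) = \<beta> * ?s powr ((real r + 1) / 2) / (tail_const d r / real r)"
      using c elim s by (simp only: exp_add exp_diff exp_ln powr_def) simp
    moreover have "?s powr ((real r + 1) / 2) = B \<beta> ^ (r + 1)"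
    proof -
      have "B \<beta> ^ (r + 1) = (?s powr (1/2)) powr real (r + 1)"
        unfolding B_def using s by (subst powr_realpow) (auto simp: powr_half_sqrt)
      then show ?thesis by (simp add: powr_powr add.commute)
    qed
    ultimately have e: "exp (- real r * (a \<beta>)\<^sup>2 / 2) = \<beta> * B \<beta> ^ (r + 1) / (tail_const d r / real r)" by simp
    show ?case unfolding e using c by (simp only: times_divide_eq_right nonzero_mult_div_cancel_left less_imp_neq[symmetric] simp_thms)
  qed
qed

lemma tail_mass_norm_a:
  assumes w: "((\<lambda>\<beta>. w \<beta> / norm_a d r \<beta>) \<longlongrightarrow> 0) (at_right 0)"
    and e: "((\<lambda>\<beta>. exp (- real r * (norm_a d r \<beta> * w \<beta> + (w \<beta>)\<^sup>2 / 2))) \<longlongrightarrow> l) (at_right 0)"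
  shows "((\<lambda>\<beta>. tail_mass d r (norm_a d r \<beta> + w \<beta>) / \<beta>) \<longlongrightarrow> l) (at_right 0)"
proof -
  have "((\<lambda>\<beta>. 1 / (a \<beta> / B \<beta> * (1 + w \<beta> / a \<beta>))) \<longlongrightarrow> 1 / (1 * (1 + 0))) (at_right 0)"
    by (intro tendsto_intros a_over_B w) simp
  then have "((\<lambda>\<beta>. (1 / (a \<beta> / B \<beta> * (1 + w \<beta> / a \<beta>))) ^ (r + 1) * exp (- real r * (a \<beta> * w \<beta> + (w \<beta>)\<^sup>2 / 2)))
      \<longlongrightarrow> (1 / (1 * (1 + 0))) ^ (r + 1) * l) (at_right 0)"
    by (intro tendsto_mult tendsto_power e)
  then have lim: "((\<lambda>\<beta>. (1 / (a \<beta> / B \<beta> * (1 + w \<beta> / a \<beta>))) ^ (r + 1) * exp (- real r * (a \<beta> * w \<beta> + (w \<beta>)\<^sup>2 / 2))) \<longlongrightarrow> l) (at_right 0)"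
    by simp
  have "\<forall>\<^sub>F \<beta> in at_right 0. 0 < a \<beta>" using norm_a_at_top by (simp add: filterlim_at_top_dense)
  moreover have "\<forall>\<^sub>F \<beta> in at_right 0. 0 < B \<beta>" using B_at_top by (simp add: filterlim_at_top_dense)
  moreover note exp_a eventually_at_right_pos
  ultimately have "\<forall>\<^sub>F \<beta> in at_right 0. (1 / (a \<beta> / B \<beta> * (1 + w \<beta> / a \<beta>))) ^ (r + 1) * exp (- real r * (a \<beta> * w \<beta> + (w \<beta>)\<^sup>2 / 2)) = tail_mass d r (a \<beta> + w \<beta>) / \<beta>"
  proof eventually_elim
    case (elim \<beta>)
    have 1: "1 / (a \<beta> / B \<beta> * (1 + w \<beta> / a \<beta>)) = B \<beta> / (a \<beta> + w \<beta>)"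
    proof -
      have "a \<beta> / B \<beta> * (1 + w \<beta> / a \<beta>) = (a \<beta> + w \<beta>) / B \<beta>" using elim by (simp add: field_simps)
      then show ?thesis by simp
    qed
    have "- real r * (a \<beta> + w \<beta>)\<^sup>2 / 2 = - real r * (a \<beta>)\<^sup>2 / 2 + - real r * (a \<beta> * w \<beta> + (w \<beta>)\<^sup>2 / 2)"
      by (simp add: power2_eq_square field_simps)
    then have "tail_mass d r (a \<beta> + w \<beta>) = (tail_const d r / real r * exp (- real r * (a \<beta>)\<^sup>2 / 2)) * exp (- real r * (a \<beta> * w \<beta> + (w \<beta>)\<^sup>2 / 2)) / (a \<beta> + w \<beta>) ^ (r + 1)"
      unfolding tail_mass_def by (simp only: exp_add mult.assoc)
    also have "\<dots> = \<beta> * B \<beta> ^ (r + 1) * exp (- real r * (a \<beta> * w \<beta> + (w \<beta>)\<^sup>2 / 2)) / (a \<beta> + w \<beta>) ^ (r + 1)"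
      by (simp only: elim)
    finally show ?case unfolding 1 using elim by (simp add: power_divide)
  qed
  with lim show ?thesis by (rule Lim_transform_eventually)
qed

text \<open>Together with \<open>inverse_drift_le\<close> this allows all error terms to be expressed by \<open>norm_a\<close> alone.\<close>

lemma drift_le: "\<forall>\<^sub>F \<beta> in at_right 0. \<beta> \<le> exp (- real r * (norm_a d r \<beta>)\<^sup>2 / 2)"
proof -
  have c: "0 < tail_const d r / real r" using tail_const_pos[of r d] r by simp
  have "\<forall>\<^sub>F \<beta> in at_right 0. max 1 (tail_const d r / real r) \<le> B \<beta>"
    using B_at_top unfolding filterlim_at_top by blast
  moreover note exp_a eventually_at_right_pos
  ultimately show ?thesis
  proof eventually_elim
    case (elim \<beta>)
    have "tail_const d r / real r * \<beta> \<le> B \<beta> * \<beta>" using elim by (intro mult_right_mono) auto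
    also have "\<dots> \<le> B \<beta> ^ (r + 1) * \<beta>" using elim by (intro mult_right_mono self_le_power) auto
    also have "\<dots> = tail_const d r / real r * exp (- real r * (a \<beta>)\<^sup>2 / 2)" using elim by simp
    finally show ?case using c by (simp only: mult_le_cancel_left_pos)
  qed
qed

lemma inverse_drift_le: "\<forall>\<^sub>F \<beta> in at_right 0. 1 / \<beta> \<le> exp (real r * (norm_a d r \<beta>)\<^sup>2 / 2 + norm_a d r \<beta>)"
proof -
  have c: "0 < tail_const d r / real r" using tail_const_pos[of r d] r by simp
  define n where "n = r + 1"
  have "((\<lambda>x::real. (2 * x) ^ n / exp x) \<longlongrightarrow> 0) at_top"
  proof -
    have "((\<lambda>x::real. 2 ^ n * (x ^ n / exp x)) \<longlongrightarrow> 2 ^ n * 0) at_top"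
      by (intro tendsto_mult tendsto_const tendsto_power_div_exp_0)
    then show ?thesis by (simp add: power_mult_distrib)
  qed
  then have "\<forall>\<^sub>F x::real in at_top. (2 * x) ^ n / exp x < tail_const d r / real r"
    using c by (rule order_tendstoD)
  then have "\<forall>\<^sub>F \<beta> in at_right 0. (2 * a \<beta>) ^ n / exp (a \<beta>) < tail_const d r / real r"
    using norm_a_at_top by (rule eventually_compose_filterlim)
  moreover have "\<forall>\<^sub>F \<beta> in at_right 0. 1 / 2 < a \<beta> / B \<beta>" using a_over_B by (rule order_tendstoD) simp
  moreover have "\<forall>\<^sub>F \<beta> in at_right 0. 0 < B \<beta>" using B_at_top by (simp add: filterlim_at_top_dense)
  moreover note exp_a eventually_at_right_pos
  ultimately show ?thesis
  proof eventually_elim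
    case (elim \<beta>)
    have "B \<beta> ^ n \<le> (2 * a \<beta>) ^ n" using elim by (intro power_mono) (auto simp: field_simps)
    also have "\<dots> \<le> tail_const d r / real r * exp (a \<beta>)" using elim by (simp add: field_simps)
    finally have "\<beta> * B \<beta> ^ n \<le> \<beta> * (tail_const d r / real r * exp (a \<beta>))"
      using elim by (intro mult_left_mono) auto
    then have "tail_const d r / real r * exp (- real r * (a \<beta>)\<^sup>2 / 2) \<le> tail_const d r / real r * (\<beta> * exp (a \<beta>))"
      using elim by (simp add: n_def mult_ac)
    then have "exp (- real r * (a \<beta>)\<^sup>2 / 2) \<le> \<beta> * exp (a \<beta>)" using c by (simp only: mult_le_cancel_left_pos)
    then have "exp (real r * (a \<beta>)\<^sup>2 / 2) * exp (- real r * (a \<beta>)\<^sup>2 / 2) \<le> exp (real r * (a \<beta>)\<^sup>2 / 2) * (\<beta> * exp (a \<beta>))"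
      by (intro mult_left_mono) auto
    moreover have "exp (real r * (a \<beta>)\<^sup>2 / 2) * exp (- real r * (a \<beta>)\<^sup>2 / 2) = 1"
      by (simp add: exp_add[symmetric])
    ultimately have "1 \<le> exp (real r * (a \<beta>)\<^sup>2 / 2) * exp (a \<beta>) * \<beta>" by (simp only: mult_ac)
    then show ?case using elim by (simp only: exp_add pos_divide_le_eq)
  qed
qed

lemma norm_a_times_drift: "((\<lambda>\<beta>. norm_a d r \<beta> * \<beta>) \<longlongrightarrow> 0) (at_right 0)"
proof (rule Lim_null_comparison)
  have "((\<lambda>x::real. x * exp (- x\<^sup>2 / 2)) \<longlongrightarrow> 0) at_top" by real_asymp
  from filterlim_compose[OF this norm_a_at_top]
  show "((\<lambda>\<beta>. norm_a d r \<beta> * exp (- (norm_a d r \<beta>)\<^sup>2 / 2)) \<longlongrightarrow> 0) (at_right 0)" .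
  have "\<forall>\<^sub>F \<beta> in at_right 0. 0 < a \<beta>" using norm_a_at_top by (simp add: filterlim_at_top_dense)
  moreover note drift_le eventually_at_right_pos
  ultimately show "\<forall>\<^sub>F \<beta> in at_right 0. norm (norm_a d r \<beta> * \<beta>) \<le> norm_a d r \<beta> * exp (- (norm_a d r \<beta>)\<^sup>2 / 2)"
  proof eventually_elim
    case (elim \<beta>)
    have "1 * (a \<beta>)\<^sup>2 \<le> real r * (a \<beta>)\<^sup>2" using r by (intro mult_right_mono) auto
    then have "exp (- real r * (a \<beta>)\<^sup>2 / 2) \<le> exp (- (a \<beta>)\<^sup>2 / 2)" by simp
    then have "\<beta> \<le> exp (- (a \<beta>)\<^sup>2 / 2)" using elim by linarith
    then show ?case using elim by (simp add: abs_mult mult_left_mono)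
  qed
qed

text \<open>A level that exceeds \<open>a\<close> by \<open>z / a\<close> lowers \<open>exp (- r v^2 / 2)\<close> by the factor \<open>exp (- r z)\<close> in the
  limit.\<close>

lemma tail_mass_at_level:
  assumes v: "((\<lambda>\<beta>. norm_a d r \<beta> * (v \<beta> - norm_a d r \<beta>)) \<longlongrightarrow> z) (at_right 0)"
  shows "((\<lambda>\<beta>. tail_mass d r (v \<beta>) / \<beta>) \<longlongrightarrow> exp (- real r * z)) (at_right 0)"
proof -
  define w where "w \<beta> = v \<beta> - a \<beta>" for \<beta> :: real
  have inv: "((\<lambda>\<beta>. inverse (a \<beta>)) \<longlongrightarrow> 0) (at_right 0)"
    by (rule filterlim_compose[OF tendsto_inverse_0_at_top[OF filterlim_ident] norm_a_at_top])
  have aw: "((\<lambda>\<beta>. a \<beta> * w \<beta>) \<longlongrightarrow> z) (at_right 0)" using v by (simp add: w_def)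
  have pos: "\<forall>\<^sub>F \<beta> in at_right 0. 0 < a \<beta>" using norm_a_at_top by (simp add: filterlim_at_top_dense)
  have w0: "(w \<longlongrightarrow> 0) (at_right 0)"
  proof (rule Lim_transform_eventually)
    show "((\<lambda>\<beta>. a \<beta> * w \<beta> * inverse (a \<beta>)) \<longlongrightarrow> 0) (at_right 0)"
      using tendsto_mult[OF aw inv] by simp
    show "\<forall>\<^sub>F \<beta> in at_right 0. a \<beta> * w \<beta> * inverse (a \<beta>) = w \<beta>"
      using pos by eventually_elim simp
  qed
  have "((\<lambda>\<beta>. tail_mass d r (a \<beta> + w \<beta>) / \<beta>) \<longlongrightarrow> exp (- real r * z)) (at_right 0)"
  proof (rule tail_mass_norm_a)
    show "((\<lambda>\<beta>. w \<beta> / a \<beta>) \<longlongrightarrow> 0) (at_right 0)"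
      using tendsto_mult[OF w0 inv] by (simp add: divide_inverse)
    have "((\<lambda>\<beta>. exp (- real r * (a \<beta> * w \<beta> + (w \<beta>)\<^sup>2 / 2))) \<longlongrightarrow> exp (- real r * (z + 0\<^sup>2 / 2))) (at_right 0)"
      by (intro tendsto_intros aw w0) simp
    then show "((\<lambda>\<beta>. exp (- real r * (a \<beta> * w \<beta> + (w \<beta>)\<^sup>2 / 2))) \<longlongrightarrow> exp (- real r * z)) (at_right 0)" by simp
  qed
  then show ?thesis by (simp add: w_def)
qed

text \<open>One unit above \<open>a\<close> nothing is left, which permits truncation to indices with \<open>\<beta> \<bar>i\<bar> \<le> a + 1\<close>.\<close>

lemma tail_mass_beyond:
  assumes v: "((\<lambda>\<beta>. v \<beta> - norm_a d r \<beta>) \<longlongrightarrow> 1) (at_right 0)"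
  shows "((\<lambda>\<beta>. tail_mass d r (v \<beta>) / \<beta>) \<longlongrightarrow> 0) (at_right 0)"
proof -
  define w where "w \<beta> = v \<beta> - a \<beta>" for \<beta> :: real
  have inv: "((\<lambda>\<beta>. inverse (a \<beta>)) \<longlongrightarrow> 0) (at_right 0)"
    by (rule filterlim_compose[OF tendsto_inverse_0_at_top[OF filterlim_ident] norm_a_at_top])
  have w: "(w \<longlongrightarrow> 1) (at_right 0)" using v by (simp add: w_def[abs_def])
  have "((\<lambda>\<beta>. tail_mass d r (a \<beta> + w \<beta>) / \<beta>) \<longlongrightarrow> 0) (at_right 0)"
  proof (rule tail_mass_norm_a)
    show "((\<lambda>\<beta>. w \<beta> / a \<beta>) \<longlongrightarrow> 0) (at_right 0)"
      using tendsto_mult[OF w inv] by (simp add: divide_inverse)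
    have "filterlim (\<lambda>\<beta>. w \<beta> * a \<beta>) at_top (at_right 0)"
      by (rule filterlim_tendsto_pos_mult_at_top[OF w _ norm_a_at_top]) simp
    moreover have "((\<lambda>\<beta>. (w \<beta>)\<^sup>2 / 2) \<longlongrightarrow> 1\<^sup>2 / 2) (at_right 0)" by (intro tendsto_intros w) simp
    ultimately have "filterlim (\<lambda>\<beta>. (w \<beta>)\<^sup>2 / 2 + w \<beta> * a \<beta>) at_top (at_right 0)"
      by (intro filterlim_tendsto_add_at_top)
    then have "filterlim (\<lambda>\<beta>. - real r * ((w \<beta>)\<^sup>2 / 2 + w \<beta> * a \<beta>)) at_bot (at_right 0)"
      by (rule filterlim_tendsto_neg_mult_at_bot[OF tendsto_const, rotated]) (use r in simp)
    from filterlim_compose[OF exp_at_bot this]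
    show "((\<lambda>\<beta>. exp (- real r * (a \<beta> * w \<beta> + (w \<beta>)\<^sup>2 / 2))) \<longlongrightarrow> 0) (at_right 0)" by (simp add: mult.commute add.commute)
  qed
  then show ?thesis by (simp add: w_def)
qed

text \<open>The expected number of exceedances with index beyond \<open>u(x)\<close> and \<open>\<beta> i \<le> a + 1\<close>. Rounding
  \<open>u(x)\<close> to an integer moves the level by at most \<open>\<beta>\<close>, which is negligible because \<open>a \<beta> \<rightarrow> 0\<close>.\<close>

lemma window_sum_limit:
  "((\<lambda>\<beta>::real. \<Sum>i\<in>{\<lfloor>norm_u d r \<beta> x\<rfloor><..\<lfloor>(norm_a d r \<beta> + 1) / \<beta>\<rfloor>}. tail_rate d r (\<beta> * i)) \<longlongrightarrow> exp (- x)) (at_right 0)"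
proof -
  define c where "c \<beta> = a \<beta> + x / (real r * a \<beta>)" for \<beta> :: real
  have u: "norm_u d r \<beta> x = c \<beta> / \<beta>" for \<beta> by (simp add: norm_u_def c_def)
  define m where "m \<beta> = \<lfloor>c \<beta> / \<beta>\<rfloor>" for \<beta> :: real
  define n where "n \<beta> = \<lfloor>(a \<beta> + 1) / \<beta>\<rfloor>" for \<beta> :: real
  define S where "S \<beta> = (\<Sum>i\<in>{m \<beta><..n \<beta>}. tail_rate d r (\<beta> * i))" for \<beta> :: real
  have inv: "((\<lambda>\<beta>. inverse (a \<beta>)) \<longlongrightarrow> 0) (at_right 0)"
    by (rule filterlim_compose[OF tendsto_inverse_0_at_top[OF filterlim_ident] norm_a_at_top])
  have id: "((\<lambda>\<beta>. \<beta>) \<longlongrightarrow> 0) (at_right (0::real))" by (rule tendsto_ident_at)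
  have pos: "\<forall>\<^sub>F \<beta> in at_right 0. 4 < a \<beta>" using norm_a_at_top by (simp add: filterlim_at_top_dense)
  have x0: "((\<lambda>\<beta>. x / (real r * a \<beta>)) \<longlongrightarrow> 0) (at_right 0)"
    using tendsto_mult[OF tendsto_const[of "x / real r"] inv] by (simp add: field_simps)
  have xs: "\<forall>\<^sub>F \<beta> in at_right 0. x / (real r * a \<beta>) < 1" "\<forall>\<^sub>F \<beta> in at_right 0. - 1 < x / (real r * a \<beta>)"
    using order_tendstoD[OF x0] by auto
  have small: "\<forall>\<^sub>F \<beta> in at_right (0::real). \<beta> < 1" using order_tendstoD(2)[OF id] by simp
  have level: "((\<lambda>\<beta>. a \<beta> * (\<beta> * (m \<beta> + s) - a \<beta>)) \<longlongrightarrow> x / real r) (at_right 0)" if s: "s = 0 \<or> s = 1" for s :: real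
  proof -
    have "((\<lambda>\<beta>. a \<beta> * (\<beta> * (m \<beta> + s) - a \<beta>) - x / real r) \<longlongrightarrow> 0) (at_right 0)"
    proof (rule Lim_null_comparison[OF _ norm_a_times_drift])
      show "\<forall>\<^sub>F \<beta> in at_right 0. norm (a \<beta> * (\<beta> * (m \<beta> + s) - a \<beta>) - x / real r) \<le> a \<beta> * \<beta>"
        using pos eventually_at_right_pos
      proof eventually_elim
        case (elim \<beta>)
        have "a \<beta> * (\<beta> * (m \<beta> + s) - a \<beta>) - x / real r = a \<beta> * (\<beta> * (m \<beta> + s) - c \<beta>)"
          using elim r by (simp add: c_def algebra_simps)
        moreover have "\<bar>\<beta> * (m \<beta> + s) - c \<beta>\<bar> \<le> \<beta>"
          using floor_multiple_bounds[OF elim(2), of "c \<beta>"] s elim unfolding m_def by (auto simp: algebra_simps)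
        ultimately show ?case using elim by (simp add: abs_mult mult_left_mono)
      qed
    qed
    from tendsto_add[OF this tendsto_const[of "x / real r"]] show ?thesis by simp
  qed
  have Q: "((\<lambda>\<beta>. tail_mass d r (\<beta> * (m \<beta> + s)) / \<beta>) \<longlongrightarrow> exp (- x)) (at_right 0)" if s: "s = 0 \<or> s = 1" for s :: real
    using tail_mass_at_level[OF level[OF s]] r by simp
  have top: "((\<lambda>\<beta>. tail_mass d r (\<beta> * (n \<beta> + 1)) / \<beta>) \<longlongrightarrow> 0) (at_right 0)"
  proof (rule tail_mass_beyond)
    have "((\<lambda>\<beta>. \<beta> * (n \<beta> + 1) - a \<beta> - 1) \<longlongrightarrow> 0) (at_right 0)"
    proof (rule Lim_null_comparison[OF _ id])
      show "\<forall>\<^sub>F \<beta> in at_right 0. norm (\<beta> * (n \<beta> + 1) - a \<beta> - 1) \<le> \<beta>"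
        using eventually_at_right_pos
      proof eventually_elim
        case (elim \<beta>)
        then show ?case using floor_multiple_bounds[OF elim, of "a \<beta> + 1"] unfolding n_def by (simp add: algebra_simps)
      qed
    qed
    from tendsto_add[OF this tendsto_const[of 1]] show "((\<lambda>\<beta>. \<beta> * (n \<beta> + 1) - a \<beta>) \<longlongrightarrow> 1) (at_right 0)" by simp
  qed
  have "(S \<longlongrightarrow> exp (- x)) (at_right 0)"
  proof -
    let ?lo = "\<lambda>\<beta>. (tail_mass d r (\<beta> * (m \<beta> + 1)) / \<beta> - tail_mass d r (\<beta> * (n \<beta> + 1)) / \<beta>) / (1 + 2 * inverse (a \<beta>))"
    have "(?lo \<longlongrightarrow> (exp (- x) - 0) / (1 + 2 * 0)) (at_right 0)"
      using Q[of 1] by (intro tendsto_intros top inv) auto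
    then have lo: "(?lo \<longlongrightarrow> exp (- x)) (at_right 0)" by simp
    have hi: "((\<lambda>\<beta>::real. tail_mass d r (\<beta> * real_of_int (m \<beta>)) / \<beta>) \<longlongrightarrow> exp (- x)) (at_right 0)"
      using Q[of 0] by simp
    have mn: "\<forall>\<^sub>F \<beta>::real in at_right 0. 0 < m \<beta> \<and> m \<beta> \<le> n \<beta> \<and> a \<beta> - 2 \<le> \<beta> * real_of_int (m \<beta>)"
      using pos xs small eventually_at_right_pos
    proof eventually_elim
      case (elim \<beta>)
      have c: "3 < c \<beta>" "c \<beta> \<le> a \<beta> + 1" "a \<beta> - 1 \<le> c \<beta>" using elim by (auto simp: c_def)
      have "1 \<le> c \<beta> / \<beta>" using c elim by (simp add: field_simps)
      then have "0 < m \<beta>" unfolding m_def by linarith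
      moreover have "m \<beta> \<le> n \<beta>" unfolding m_def n_def using c elim by (intro floor_mono divide_right_mono) auto
      moreover have "a \<beta> - 2 \<le> \<beta> * real_of_int (m \<beta>)"
        using floor_multiple_bounds(2)[OF elim(5), of "c \<beta>"] c(3) elim(4) unfolding m_def by linarith
      ultimately show ?case by blast
    qed
    have le: "\<forall>\<^sub>F \<beta>::real in at_right 0. S \<beta> \<le> tail_mass d r (\<beta> * real_of_int (m \<beta>)) / \<beta>"
      using mn eventually_at_right_pos
    proof eventually_elim
      case (elim \<beta>)
      then show ?case using sum_tail_rate_upper[OF r, of \<beta> "m \<beta>" "n \<beta>"]
        by (simp add: S_def pos_le_divide_eq mult.commute)
    qed
    have ge: "\<forall>\<^sub>F \<beta>::real in at_right 0. ?lo \<beta> \<le> S \<beta>"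
      using mn eventually_at_right_pos pos
    proof eventually_elim
      case (elim \<beta>)
      have S: "0 \<le> S \<beta>" unfolding S_def using elim by (intro sum_nonneg tail_rate_nonneg) auto
      have K: "(real r + 1) / (real r * (\<beta> * real_of_int (m \<beta>))\<^sup>2) \<le> 2 * inverse (a \<beta>)"
      proof -
        have am: "a \<beta> / 2 \<le> \<beta> * real_of_int (m \<beta>)" "2 \<le> \<beta> * real_of_int (m \<beta>)" using elim by auto
        have "(\<beta> * real_of_int (m \<beta>)) * 2 \<le> (\<beta> * real_of_int (m \<beta>)) * (\<beta> * real_of_int (m \<beta>))" using am by (intro mult_left_mono) auto
        then have sq: "a \<beta> \<le> (\<beta> * real_of_int (m \<beta>))\<^sup>2" using am by (simp add: power2_eq_square)
        have "(real r + 1) / (real r * (\<beta> * real_of_int (m \<beta>))\<^sup>2) = ((real r + 1) / real r) * inverse ((\<beta> * real_of_int (m \<beta>))\<^sup>2)"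
          by (simp add: field_simps)
        also have "\<dots> \<le> 2 * inverse (a \<beta>)"
          using sq elim r by (intro mult_mono le_imp_inverse_le) (auto simp: field_simps)
        finally show ?thesis .
      qed
      have "tail_mass d r (\<beta> * (m \<beta> + 1)) - tail_mass d r (\<beta> * (n \<beta> + 1)) \<le> \<beta> * (S \<beta> * (1 + (real r + 1) / (real r * (\<beta> * real_of_int (m \<beta>))\<^sup>2)))"
        using sum_tail_rate_lower[OF r, of \<beta> "m \<beta>" "n \<beta>"] elim by (simp add: S_def)
      also have "\<dots> \<le> \<beta> * (S \<beta> * (1 + 2 * inverse (a \<beta>)))"
        using K S elim by (intro mult_left_mono add_left_mono) auto
      finally have "(tail_mass d r (\<beta> * (m \<beta> + 1)) - tail_mass d r (\<beta> * (n \<beta> + 1))) / \<beta> \<le> S \<beta> * (1 + 2 * inverse (a \<beta>))"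
        using elim by (simp add: pos_divide_le_eq mult.commute)
      moreover have "0 < 1 + 2 * inverse (a \<beta>)" using elim by (simp add: add_pos_pos)
      ultimately show ?case by (simp only: pos_divide_le_eq diff_divide_distrib[symmetric])
    qed
    show ?thesis by (rule tendsto_sandwich[OF ge le lo hi])
  qed
  then show ?thesis unfolding S_def m_def n_def u .
qed

end

section \<open>Uniform tail estimates\<close>

text \<open>A factor tending to one that relates \<open>tail_rate\<close> to the true exceedance probability. This
  particular lower bound is chosen because it is monotone, so that its value at the lowest level
  serves a whole window of levels.\<close>

definition tail_factor :: "nat \<Rightarrow> nat \<Rightarrow> real \<Rightarrow> real" where
  "tail_factor d r v = (1 / (1 + 1 / v\<^sup>2)) ^ r * (1 - 1 / v) ^ d"

lemma tail_factor_nonneg: "1 \<le> v \<Longrightarrow> 0 \<le> tail_factor d r v"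
  by (simp add: tail_factor_def)

lemma tail_factor_mono:
  assumes "1 \<le> u" "u \<le> v" shows "tail_factor d r u \<le> tail_factor d r v"
proof -
  have "1 / v\<^sup>2 \<le> 1 / u\<^sup>2" using assms by (intro divide_left_mono power_mono mult_pos_pos) auto
  moreover have "0 < 1 + 1 / v\<^sup>2" by (simp add: add_pos_nonneg)
  ultimately have "1 / (1 + 1 / u\<^sup>2) \<le> 1 / (1 + 1 / v\<^sup>2)"
    using frac_le[of 1 1 "1 + 1 / v\<^sup>2" "1 + 1 / u\<^sup>2"] by simp
  moreover have "1 - 1 / u \<le> 1 - 1 / v" using assms by (simp add: divide_left_mono)
  ultimately show ?thesis
    unfolding tail_factor_def using assms by (intro mult_mono power_mono) auto
qed

lemma tail_factor_tendsto: "(tail_factor d r \<longlongrightarrow> 1) at_top"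
proof -
  have "((\<lambda>v::real. 1 / (1 + 1 / v\<^sup>2)) \<longlongrightarrow> 1) at_top" "((\<lambda>v::real. 1 - 1 / v) \<longlongrightarrow> 1) at_top"
    by real_asymp+
  then have "((\<lambda>v::real. (1 / (1 + 1 / v\<^sup>2)) ^ r * (1 - 1 / v) ^ d) \<longlongrightarrow> 1 ^ r * 1 ^ d) at_top"
    by (intro tendsto_mult tendsto_power)
  then show ?thesis by (simp add: tail_factor_def[abs_def])
qed

lemma tail_rate_eq: "tail_rate d r v = real (d choose r) * (std_normal_density v / v) ^ r"
  by (simp add: tail_rate_def tail_const_def std_normal_density_def power_divide power_mult_distrib
      exp_of_nat_mult[symmetric])

lemma tail_rate_shift_left:
  assumes v: "1 \<le> v" and s: "0 \<le> s" "v * s \<le> t" and t: "t < 1"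
  shows "tail_rate d r (v - s) \<le> (1 / (1 - t)) ^ r * exp (real r * t) * tail_rate d r v"
proof -
  have "s \<le> v * s" using v s by (simp add: mult_le_cancel_right1)
  then have st: "s \<le> t" "0 \<le> t" using s by auto
  have "t \<le> t * v" using st v by (simp add: mult_le_cancel_left1)
  then have low: "v * (1 - t) \<le> v - s" using st by (simp add: algebra_simps)
  have pos: "0 < v * (1 - t)" using v t by simp
  have sq: "(v - s)\<^sup>2 = v\<^sup>2 - 2 * (v * s) + s\<^sup>2" by (simp add: power2_eq_square algebra_simps)
  have "v\<^sup>2 - 2 * t \<le> (v - s)\<^sup>2" unfolding sq using s by (smt (verit) zero_le_power2)
  then have "real r * (v\<^sup>2 - 2 * t) \<le> real r * (v - s)\<^sup>2" by (intro mult_left_mono) auto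
  then have "exp (- real r * (v - s)\<^sup>2 / 2) \<le> exp (- real r * v\<^sup>2 / 2 + real r * t)" by (simp add: algebra_simps)
  then have "tail_rate d r (v - s) \<le> tail_const d r * exp (- real r * v\<^sup>2 / 2 + real r * t) / (v * (1 - t)) ^ r"
    unfolding tail_rate_def using low pos
    by (intro frac_le mult_left_mono power_mono) (auto simp: tail_const_def)
  also have "\<dots> = (1 / (1 - t)) ^ r * exp (real r * t) * tail_rate d r v"
    unfolding tail_rate_def by (simp only: exp_add power_mult_distrib power_divide power_one) (simp add: mult_ac)
  finally show ?thesis .
qed

lemma tail_rate_shift_right:
  assumes v: "1 \<le> v" and s: "0 \<le> s" "v * s \<le> t"
  shows "(1 / (1 + t)) ^ r * exp (- real r * (t + t\<^sup>2 / 2)) * tail_rate d r v \<le> tail_rate d r (v + s)"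
proof -
  have "s \<le> v * s" using v s by (simp add: mult_le_cancel_right1)
  then have st: "s \<le> t" "0 \<le> t" using s by auto
  have "t \<le> t * v" using st v by (simp add: mult_le_cancel_left1)
  then have low: "v + s \<le> v * (1 + t)" using st by (simp add: algebra_simps)
  have pos: "0 < v + s" using v s by simp
  have sq: "(v + s)\<^sup>2 = v\<^sup>2 + 2 * (v * s) + s\<^sup>2" by (simp add: power2_eq_square algebra_simps)
  have "s\<^sup>2 \<le> t\<^sup>2" using st s by (intro power_mono)
  then have "(v + s)\<^sup>2 \<le> v\<^sup>2 + 2 * (t + t\<^sup>2 / 2)" unfolding sq using s by simp
  then have "real r * (v + s)\<^sup>2 \<le> real r * (v\<^sup>2 + 2 * (t + t\<^sup>2 / 2))" by (intro mult_left_mono) auto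
  then have e: "exp (- real r * v\<^sup>2 / 2 + - real r * (t + t\<^sup>2 / 2)) \<le> exp (- real r * (v + s)\<^sup>2 / 2)" by (simp add: field_simps)
  have "(1 / (1 + t)) ^ r * exp (- real r * (t + t\<^sup>2 / 2)) * tail_rate d r v
      = tail_const d r * exp (- real r * v\<^sup>2 / 2 + - real r * (t + t\<^sup>2 / 2)) / (v * (1 + t)) ^ r"
    unfolding tail_rate_def by (simp only: exp_add power_mult_distrib power_divide power_one) (simp add: mult_ac)
  also have "\<dots> \<le> tail_rate d r (v + s)"
    unfolding tail_rate_def using low pos e
    by (intro frac_le mult_left_mono power_mono) (auto simp: tail_const_def)
  finally show ?thesis .
qed

text \<open>Bounds the relative change of the expected number of exceedances when levels \<open>v\<close> are shifted down
  and up by \<open>s\<close> with \<open>v * s \<le> t\<close>; it vanishes for \<open>\<kappa> = 1\<close> and \<open>t = 0\<close>.\<close>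

definition shift_gap :: "nat \<Rightarrow> real \<Rightarrow> real \<Rightarrow> real" where
  "shift_gap r \<kappa> t = (1 / (1 - t)) ^ r * exp (real r * t) - \<kappa> * ((1 / (1 + t)) ^ r * exp (- real r * (t + t\<^sup>2 / 2)))"

text \<open>The envelope is the supremum of \<open>\<bar>f n\<bar>\<close> over \<open>n > exp x\<close>. For these \<open>n\<close> one has
  \<open>ln n > x\<close>, so \<open>f n ln n \<rightarrow> 0\<close> makes it \<open>o(1 / x)\<close>.\<close>

lemma log_decay_envelope:
  fixes f :: "nat \<Rightarrow> real"
  assumes f: "(\<lambda>n. f n * ln (real n)) \<longlonglongrightarrow> 0"
  obtains \<tau> where "\<And>x. 0 \<le> \<tau> x" "\<And>x n. exp x < real n \<Longrightarrow> \<bar>f n\<bar> \<le> \<tau> x" "((\<lambda>x. x * \<tau> x) \<longlongrightarrow> 0) at_top"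
proof
  have small: "\<exists>N. \<forall>n\<ge>N. \<bar>f n * ln (real n)\<bar> < \<theta>" if "0 < \<theta>" for \<theta>
    using LIMSEQ_D[OF f that] by simp
  obtain N where N: "\<And>n. N \<le> n \<Longrightarrow> \<bar>f n * ln (real n)\<bar> < 1" using small[of 1] by auto
  have bdd: "bdd_above (range (\<lambda>n. \<bar>f n\<bar>))"
  proof -
    have "\<bar>f n\<bar> \<le> 1" if "max N 3 \<le> n" for n
    proof -
      have "exp 1 \<le> real n" using exp_le that by (simp add: of_nat_le_iff[symmetric])
      then have "1 \<le> ln (real n)" using that by (subst ln_ge_iff) auto
      then have "\<bar>f n\<bar> * 1 \<le> \<bar>f n\<bar> * \<bar>ln (real n)\<bar>" by (intro mult_left_mono) auto
      also have "\<dots> < 1" using N[of n] that by (simp add: abs_mult)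
      finally show ?thesis by simp
    qed
    then have "\<bar>f n\<bar> \<in> (\<lambda>n. \<bar>f n\<bar>) ` {..<max N 3} \<union> {..1}" for n
      by (cases "n < max N 3") (blast, metis UnI2 atMost_iff not_less)
    then have "range (\<lambda>n. \<bar>f n\<bar>) \<subseteq> (\<lambda>n. \<bar>f n\<bar>) ` {..<max N 3} \<union> {..1}"
      by blast
    moreover have "bdd_above ((\<lambda>n. \<bar>f n\<bar>) ` {..<max N 3} \<union> {..1})" by simp
    ultimately show ?thesis by (rule bdd_above_mono[rotated])
  qed
  define \<tau> where "\<tau> x = (SUP n\<in>{n. exp x < real n}. \<bar>f n\<bar>)" for x
  have ne: "{n. exp x < real n} \<noteq> {}" for x using reals_Archimedean2[of "exp x"] by auto
  have bdd': "bdd_above ((\<lambda>n. \<bar>f n\<bar>) ` {n. exp x < real n})" for x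
    by (rule bdd_above_mono[OF bdd]) auto
  show le: "exp x < real n \<Longrightarrow> \<bar>f n\<bar> \<le> \<tau> x" for x n
    unfolding \<tau>_def by (rule cSUP_upper[OF _ bdd']) simp
  show nn: "0 \<le> \<tau> x" for x
    using ne[of x] le[of x] by (auto intro: order_trans[OF abs_ge_zero])
  show "((\<lambda>x. x * \<tau> x) \<longlongrightarrow> 0) at_top"
  proof (rule tendstoI)
    fix e :: real assume e: "0 < e"
    obtain N where N: "\<And>n. N \<le> n \<Longrightarrow> \<bar>f n * ln (real n)\<bar> < e / 2" using small[of "e / 2"] e by auto
    have "\<forall>\<^sub>F x::real in at_top. real N \<le> exp x"
      using exp_at_top by (simp add: filterlim_at_top)
    then show "\<forall>\<^sub>F x in at_top. dist (x * \<tau> x) 0 < e"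
      using eventually_gt_at_top[of 0]
    proof eventually_elim
      case (elim x)
      have "\<tau> x \<le> e / 2 / x"
        unfolding \<tau>_def
      proof (rule cSUP_least[OF ne])
        fix n assume "n \<in> {n. exp x < real n}"
        then have n: "exp x < real n" by simp
        then have n0: "0 < real n" using exp_gt_zero[of x] by linarith
        have "x < ln (real n)" using n n0 by (metis exp_less_cancel_iff exp_ln)
        then have "\<bar>f n\<bar> * x \<le> \<bar>f n\<bar> * \<bar>ln (real n)\<bar>" by (intro mult_left_mono) auto
        also have "\<dots> < e / 2" using N[of n] n elim by (simp add: abs_mult)
        finally show "\<bar>f n\<bar> \<le> e / 2 / x" using elim by (simp add: pos_le_divide_eq)
      qed
      then have "x * \<tau> x \<le> e / 2" using elim by (simp only: pos_le_divide_eq mult.commute)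
      then show ?case using e nn[of x] elim by simp
    qed
  qed
qed

lemma gaussian_decay:
  fixes k l c :: real
  assumes "0 < k"
  shows "((\<lambda>x. (2 * x + 3) * exp (- k * x\<^sup>2 + l * x + c)) \<longlongrightarrow> 0) at_top"
proof (rule Lim_null_comparison)
  have "filterlim (\<lambda>x::real. k * x - l) at_top at_top" using assms by real_asymp
  note grow = this[unfolded filterlim_at_top, rule_format, of 1]
  show "\<forall>\<^sub>F x in at_top. norm ((2 * x + 3) * exp (- k * x\<^sup>2 + l * x + c)) \<le> (2 * x + 3) * exp (- x + c)"
    using grow eventually_gt_at_top[of 0]
  proof eventually_elim
    case (elim x)
    have "x * 1 \<le> x * (k * x - l)" using elim by (intro mult_left_mono) auto
    then have "- k * x\<^sup>2 + l * x \<le> - x" by (simp add: power2_eq_square algebra_simps)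
    then show ?case using elim by (simp add: abs_mult)
  qed
  show "((\<lambda>x::real. (2 * x + 3) * exp (- x + c)) \<longlongrightarrow> 0) at_top" by real_asymp
qed

text \<open>With \<open>x\<close> standing for \<open>a(\<beta>, r)\<close>, the function \<open>N\<close> bounds the number of indices in the window
  \<open>\<beta> \<bar>i\<bar> \<le> a + 1\<close>, and \<open>exp (\<epsilon> * x^2)\<close> bounds the distance up to which indices count as close.\<close>

lemma window_error_limits:
  fixes q k \<epsilon> :: real
  defines "N \<equiv> \<lambda>x. (2 * x + 3) * exp (q * x\<^sup>2 / 2 + x)"
  shows "q / 2 + \<epsilon> < k \<Longrightarrow> ((\<lambda>x. N x * exp (\<epsilon> * x\<^sup>2) * exp (- (k * (x - 1)\<^sup>2))) \<longlongrightarrow> 0) at_top"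
    and "1 \<le> q \<Longrightarrow> ((\<lambda>x. N x * exp (- ((q + 1) * x)\<^sup>2 / 2)) \<longlongrightarrow> 0) at_top"
    and "\<epsilon> < q / 2 \<Longrightarrow> ((\<lambda>x. exp (\<epsilon> * x\<^sup>2) * exp (- (q * (x - 1)\<^sup>2 / 2))) \<longlongrightarrow> 0) at_top"
proof -
  assume *: "q / 2 + \<epsilon> < k"
  have e: "q * x\<^sup>2 / 2 + x + \<epsilon> * x\<^sup>2 + - (k * (x - 1)\<^sup>2) = - (k - q / 2 - \<epsilon>) * x\<^sup>2 + (1 + 2 * k) * x + - k" for x
    by (simp add: power2_eq_square algebra_simps)
  show "((\<lambda>x. N x * exp (\<epsilon> * x\<^sup>2) * exp (- (k * (x - 1)\<^sup>2))) \<longlongrightarrow> 0) at_top"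
    unfolding N_def mult.assoc mult_exp_exp e by (rule gaussian_decay) (use * in simp)
next
  assume q: "1 \<le> q"
  have e: "q * x\<^sup>2 / 2 + x + - ((q + 1) * x)\<^sup>2 / 2 = - ((q\<^sup>2 + q + 1) / 2) * x\<^sup>2 + 1 * x + 0" for x
    by (simp add: power2_eq_square field_simps)
  show "((\<lambda>x. N x * exp (- ((q + 1) * x)\<^sup>2 / 2)) \<longlongrightarrow> 0) at_top"
    unfolding N_def mult.assoc mult_exp_exp e by (rule gaussian_decay) (use q in \<open>simp add: add_pos_pos\<close>)
next
  assume *: "\<epsilon> < q / 2"
  have e: "\<epsilon> * x\<^sup>2 + - (q * (x - 1)\<^sup>2 / 2) = - (q / 2 - \<epsilon>) * x\<^sup>2 + q * x + - (q / 2)" for x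
    by (simp add: power2_eq_square field_simps)
  show "((\<lambda>x. exp (\<epsilon> * x\<^sup>2) * exp (- (q * (x - 1)\<^sup>2 / 2))) \<longlongrightarrow> 0) at_top"
  proof (rule Lim_null_comparison)
    show "((\<lambda>x. (2 * x + 3) * exp (- (q / 2 - \<epsilon>) * x\<^sup>2 + q * x + - (q / 2))) \<longlongrightarrow> 0) at_top"
      using * by (intro gaussian_decay) simp
    show "\<forall>\<^sub>F x in at_top. norm (exp (\<epsilon> * x\<^sup>2) * exp (- (q * (x - 1)\<^sup>2 / 2))) \<le> (2 * x + 3) * exp (- (q / 2 - \<epsilon>) * x\<^sup>2 + q * x + - (q / 2))"
      using eventually_ge_at_top[of 0] unfolding mult_exp_exp e by eventually_elim simp
  qed
qed

context gaussian_columns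
begin

lemma exceedance_le_rate: assumes "0 < v" shows "prob (exceedance v i) \<le> tail_rate d r v"
proof -
  have "0 \<le> normal_tail v" by (simp add: normal_tail_def)
  then have "real (d choose r) * normal_tail v ^ r \<le> real (d choose r) * (std_normal_density v / v) ^ r"
    using normal_tail_bounds(1)[OF assms] by (intro mult_left_mono power_mono) auto
  with prob_exceedance_upper[of v i] show ?thesis unfolding tail_rate_eq by linarith
qed

lemma exceedance_ge_rate:
  assumes v: "1 \<le> v" shows "tail_factor d r v * tail_rate d r v \<le> prob (exceedance v i)"
proof -
  let ?h = "std_normal_density v / v"
  have h: "0 \<le> ?h" using v by simp
  have K: "0 < 1 + 1 / v\<^sup>2" using v by (simp add: add_pos_nonneg)
  have q0: "0 \<le> normal_tail v" by (simp add: normal_tail_def)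
  have 1: "1 / (1 + 1 / v\<^sup>2) * ?h \<le> normal_tail v"
    using normal_tail_bounds(2)[of v] v K by (simp add: pos_divide_le_eq mult_ac)
  have "std_normal_density v \<le> 1"
  proof -
    have "1 \<le> sqrt (2 * pi)" using pi_gt3 by simp
    then have "1 / sqrt (2 * pi) \<le> 1" by simp
    then have "1 / sqrt (2 * pi) * exp (- v\<^sup>2 / 2) \<le> 1 * 1" by (intro mult_mono) auto
    then show ?thesis by (simp add: std_normal_density_def)
  qed
  then have "?h \<le> 1 / v" using v by (intro divide_right_mono) auto
  then have 2: "1 - 1 / v \<le> 1 - normal_tail v" using normal_tail_bounds(1)[of v] v by linarith
  have "tail_factor d r v * tail_rate d r v = real (d choose r) * (1 / (1 + 1 / v\<^sup>2) * ?h) ^ r * (1 - 1 / v) ^ d"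
    unfolding tail_factor_def tail_rate_eq by (simp only: power_mult_distrib mult_ac)
  also have "\<dots> \<le> real (d choose r) * normal_tail v ^ r * (1 - normal_tail v) ^ d"
    using 1 2 v h K q0 by (intro mult_mono power_mono mult_left_mono mult_nonneg_nonneg) auto
  also have "\<dots> \<le> prob (exceedance v i)" by (rule prob_exceedance_lower)
  finally show ?thesis .
qed

lemma shifted_exceedance_gap:
  assumes I: "finite I" and v: "\<And>i. i \<in> I \<Longrightarrow> 3 \<le> b \<and> b \<le> v i" and s: "0 \<le> s" "\<And>i. i \<in> I \<Longrightarrow> v i * s \<le> t" and t: "t < 1"
  shows "(\<Sum>i\<in>I. prob (exceedance (v i - s) i) - prob (exceedance (v i + s) i))
    \<le> shift_gap r (tail_factor d r b) t * (\<Sum>i\<in>I. tail_rate d r (v i))"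
  unfolding sum_distrib_left
proof (rule sum_mono)
  fix i assume i: "i \<in> I"
  let ?v = "v i"
  have v3: "3 \<le> ?v" "1 \<le> b" "b \<le> ?v" using v[OF i] by auto
  have "s * 1 \<le> s * ?v" using v3 s(1) by (intro mult_left_mono) auto
  then have s1: "s < 1" using s(2)[OF i] t by (simp add: mult.commute)
  have "prob (exceedance (?v - s) i) \<le> tail_rate d r (?v - s)"
    using s1 v3 by (intro exceedance_le_rate) auto
  also have "\<dots> \<le> (1 / (1 - t)) ^ r * exp (real r * t) * tail_rate d r ?v"
    using v3 s(1) s(2)[OF i] t by (intro tail_rate_shift_left) auto
  finally have up: "prob (exceedance (?v - s) i) \<le> (1 / (1 - t)) ^ r * exp (real r * t) * tail_rate d r ?v" .
  have "tail_factor d r b * ((1 / (1 + t)) ^ r * exp (- real r * (t + t\<^sup>2 / 2)) * tail_rate d r ?v) \<le> tail_factor d r (?v + s) * tail_rate d r (?v + s)"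
  proof (rule mult_mono)
    show "tail_factor d r b \<le> tail_factor d r (?v + s)" using v3 s by (intro tail_factor_mono) auto
    show "(1 / (1 + t)) ^ r * exp (- real r * (t + t\<^sup>2 / 2)) * tail_rate d r ?v \<le> tail_rate d r (?v + s)"
      using v3 s(1) s(2)[OF i] by (intro tail_rate_shift_right) auto
    have "0 \<le> ?v * s" using v3 s by simp
    then have "0 \<le> t" using s(2)[OF i] by linarith
    then show "0 \<le> (1 / (1 + t)) ^ r * exp (- real r * (t + t\<^sup>2 / 2)) * tail_rate d r ?v"
      using v3 by (intro mult_nonneg_nonneg tail_rate_nonneg) auto
  qed (use v3 s in \<open>auto intro: tail_factor_nonneg\<close>)
  also have "\<dots> \<le> prob (exceedance (?v + s) i)"
    using v3 s by (intro exceedance_ge_rate) auto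
  finally show "prob (exceedance (?v - s) i) - prob (exceedance (?v + s) i) \<le> shift_gap r (tail_factor d r b) t * tail_rate d r ?v"
    using up by (simp add: shift_gap_def algebra_simps)
qed

end

section \<open>Poisson limit along the two half-lines\<close>

context gaussian_columns
begin

text \<open>The level for the index \<open>i\<close>, on both half-lines.\<close>

abbreviation line :: "real \<Rightarrow> int \<Rightarrow> real" where
  "line \<beta> i \<equiv> \<beta> * of_int \<bar>i\<bar>"

text \<open>All parameters of \<open>quiet_poisson_bound\<close> are chosen as functions of \<open>a(\<beta>, r)\<close>. The cut-off for a
  single value is \<open>(r + 1) a\<close>, because \<open>exp (- ((r + 1) a)^2 / 2)\<close> is small compared with
  \<open>\<beta>\<close>; close means within distance \<open>exp (\<epsilon> a^2)\<close>.\<close>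

lemma poisson_limit_window:
  assumes \<delta>: "0 \<le> \<delta>" "\<delta> < 1" "\<And>n. 1 \<le> n \<Longrightarrow> \<rho> n \<le> \<delta>"
    and decay: "(\<lambda>n. \<rho> n * ln (real n)) \<longlonglongrightarrow> 0"
    and window: "\<forall>\<^sub>F \<beta> in at_right 0. \<forall>i\<in>I \<beta>. norm_a d r \<beta> - 1 \<le> line \<beta> i \<and> line \<beta> i \<le> norm_a d r \<beta> + 1"
    and sum: "((\<lambda>\<beta>. \<Sum>i\<in>I \<beta>. tail_rate d r (line \<beta> i)) \<longlongrightarrow> l) (at_right 0)"
  shows "((\<lambda>\<beta>. prob (quiet (line \<beta>) (I \<beta>))) \<longlongrightarrow> exp (- l)) (at_right 0)"
proof -
  define a where "a = norm_a d r"
  have at: "filterlim a at_top (at_right 0)" unfolding a_def by (rule norm_a_at_top[OF r])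
  have big: "\<forall>\<^sub>F \<beta> in at_right 0. 4 < a \<beta>" using at by (simp add: filterlim_at_top_dense)
  have rng: "\<forall>\<^sub>F \<beta> in at_right 0. \<forall>i\<in>I \<beta>. a \<beta> - 1 \<le> line \<beta> i \<and> line \<beta> i \<le> a \<beta> + 1"
    using window unfolding a_def .
  obtain \<tau> where \<tau>: "\<And>x. 0 \<le> \<tau> x" "\<And>x n. exp x < real n \<Longrightarrow> \<bar>\<rho> n\<bar> \<le> \<tau> x" "((\<lambda>x. x * \<tau> x) \<longlongrightarrow> 0) at_top"
    using log_decay_envelope[OF decay] by blast
  define q where "q = real r"
  have q: "1 \<le> q" using r by (simp add: q_def)
  define D where "D = 1 + \<delta>"
  have D: "1 \<le> D" "D < 2" "\<delta> = D - 1" using \<delta> by (auto simp: D_def)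
  \<comment> \<open>Half of the room between \<open>q / D\<close>, the exponent of a pair of exceedances, and \<open>q / 2\<close>, the exponent of \<open>1 / \<beta>\<close>.\<close>
  define \<epsilon> where "\<epsilon> = q * (2 - D) / (4 * D)"
  have \<epsilon>: "0 < \<epsilon>" "q / 2 + \<epsilon> < q / D" "\<epsilon> < q / 2"
  proof -
    show "0 < \<epsilon>" using q D by (simp add: \<epsilon>_def)
    have "q / D - (q / 2 + \<epsilon>) = \<epsilon>" using D(1) by (simp add: \<epsilon>_def field_simps)
    then show gap: "q / 2 + \<epsilon> < q / D" using \<open>0 < \<epsilon>\<close> by linarith
    have "q / D \<le> q / 1" using D q by (intro divide_left_mono) auto
    then show "\<epsilon> < q / 2" using gap by simp
  qed
  \<comment> \<open>At distances above \<open>exp (\<epsilon> x^2)\<close> the correlation is at most \<open>\<tau> (\<epsilon> x^2) = o(1 / x^2)\<close>, so \<open>x * \<eta> x\<close> tends to zero.\<close>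
  define \<eta> where "\<eta> x = \<tau> (\<epsilon> * x\<^sup>2) * ((q + 1) * x)" for x
  define t where "t x = (x + 1) * (2 * \<eta> x)" for x
  define m where "m x = tail_const d r * exp (- (q * (x - 1)\<^sup>2 / 2))" for x
  define \<kappa> where "\<kappa> x = tail_factor d r (x - 1)" for x
  define N where "N x = (2 * x + 3) * exp (q * x\<^sup>2 / 2 + x)" for x
  define c where "c = (real (d choose r))\<^sup>2"
  define e1 where "e1 x = c * (N x * exp (\<epsilon> * x\<^sup>2) * exp (- (q / D * (x - 1)\<^sup>2)))" for x
  define e2 where "e2 x = exp (\<epsilon> * x\<^sup>2) * m x" for x
  define e3 where "e3 x = shift_gap r (\<kappa> x) (t x)" for x
  define e4 where "e4 x = 4 * real d * (N x * exp (- ((q + 1) * x)\<^sup>2 / 2))" for x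
  have "filterlim (\<lambda>x::real. x - 1) at_top at_top" by real_asymp
  then have \<kappa>1: "(\<kappa> \<longlongrightarrow> 1) at_top"
    unfolding \<kappa>_def by (rule filterlim_compose[OF tail_factor_tendsto])
  \<comment> \<open>This is the only place where the rate of decay of the correlations enters.\<close>
  have t0: "(t \<longlongrightarrow> 0) at_top"
  proof -
    have "filterlim (\<lambda>x::real. \<epsilon> * x\<^sup>2) at_top at_top" using \<epsilon>(1) by real_asymp
    from filterlim_compose[OF \<tau>(3) this]
    have "((\<lambda>x. \<epsilon> * x\<^sup>2 * \<tau> (\<epsilon> * x\<^sup>2)) \<longlongrightarrow> 0) at_top" .
    moreover have "((\<lambda>x::real. 2 * (q + 1) / \<epsilon> * (1 + 1 / x)) \<longlongrightarrow> 2 * (q + 1) / \<epsilon>) at_top" by real_asymp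
    ultimately have "((\<lambda>x. 2 * (q + 1) / \<epsilon> * (1 + 1 / x) * (\<epsilon> * x\<^sup>2 * \<tau> (\<epsilon> * x\<^sup>2))) \<longlongrightarrow> 2 * (q + 1) / \<epsilon> * 0) at_top"
      by (intro tendsto_mult)
    moreover have "\<forall>\<^sub>F x in at_top. 2 * (q + 1) / \<epsilon> * (1 + 1 / x) * (\<epsilon> * x\<^sup>2 * \<tau> (\<epsilon> * x\<^sup>2)) = t x"
      using eventually_gt_at_top[of 0]
      by eventually_elim (use \<epsilon>(1) in \<open>simp add: t_def \<eta>_def power2_eq_square field_simps\<close>)
    ultimately show ?thesis by (auto intro: Lim_transform_eventually)
  qed
  have e1: "(e1 \<longlongrightarrow> 0) at_top"
    using tendsto_mult[OF tendsto_const[of c] window_error_limits(1)[OF \<epsilon>(2)]] by (simp add: e1_def[abs_def] N_def)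
  have e2: "(e2 \<longlongrightarrow> 0) at_top"
    using tendsto_mult[OF tendsto_const[of "tail_const d r"] window_error_limits(3)[OF \<epsilon>(3)]]
    by (simp add: e2_def[abs_def] m_def mult_ac)
  have e3: "(e3 \<longlongrightarrow> 0) at_top"
  proof -
    have "(e3 \<longlongrightarrow> (1 / (1 - 0)) ^ r * exp (real r * 0) - 1 * ((1 / (1 + 0)) ^ r * exp (- real r * (0 + 0\<^sup>2 / 2)))) at_top"
      unfolding e3_def shift_gap_def by (intro tendsto_intros t0 \<kappa>1) auto
    then show ?thesis by simp
  qed
  have e4: "(e4 \<longlongrightarrow> 0) at_top"
    using tendsto_mult[OF tendsto_const[of "4 * real d"] window_error_limits(2)[OF q]] by (simp add: e4_def[abs_def] N_def)
  have m0: "(m \<longlongrightarrow> 0) at_top"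
    using tendsto_mult[OF tendsto_const[of "tail_const d r"] window_error_limits(3)[of 0 q]] q by (simp add: m_def[abs_def])
  define G where "G \<beta> = (\<Sum>i\<in>I \<beta>. tail_rate d r (line \<beta> i))" for \<beta>
  define P where "P \<beta> = (\<Sum>i\<in>I \<beta>. prob (exceedance (line \<beta> i) i))" for \<beta>
  have Glim: "(G \<longlongrightarrow> l) (at_right 0)" using sum unfolding G_def .
  have Plim: "(P \<longlongrightarrow> l) (at_right 0)"
  proof (rule tendsto_sandwich)
    show "((\<lambda>\<beta>. \<kappa> (a \<beta>) * G \<beta>) \<longlongrightarrow> l) (at_right 0)"
      using tendsto_mult[OF filterlim_compose[OF \<kappa>1 at] Glim] by simp
    show "(G \<longlongrightarrow> l) (at_right 0)" by (rule Glim)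
    show "\<forall>\<^sub>F \<beta> in at_right 0. \<kappa> (a \<beta>) * G \<beta> \<le> P \<beta>"
      using rng big
    proof eventually_elim
      case (elim \<beta>)
      show ?case
        unfolding P_def G_def sum_distrib_left
      proof (rule sum_mono)
        fix i assume i: "i \<in> I \<beta>"
        have le: "a \<beta> - 1 \<le> line \<beta> i" using elim i by blast
        have "\<kappa> (a \<beta>) * tail_rate d r (line \<beta> i) \<le> tail_factor d r (line \<beta> i) * tail_rate d r (line \<beta> i)"
          unfolding \<kappa>_def using le elim(2) by (intro mult_right_mono tail_factor_mono tail_rate_nonneg) auto
        also have "\<dots> \<le> prob (exceedance (line \<beta> i) i)"
          using le elim(2) by (intro exceedance_ge_rate) auto
        finally show "\<kappa> (a \<beta>) * tail_rate d r (line \<beta> i) \<le> prob (exceedance (line \<beta> i) i)" .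
      qed
    qed
    show "\<forall>\<^sub>F \<beta> in at_right 0. P \<beta> \<le> G \<beta>"
      using rng big
    proof eventually_elim
      case (elim \<beta>)
      show ?case
        unfolding P_def G_def
      proof (rule sum_mono)
        fix i assume "i \<in> I \<beta>"
        then have "a \<beta> - 1 \<le> line \<beta> i" using elim by blast
        then show "prob (exceedance (line \<beta> i) i) \<le> tail_rate d r (line \<beta> i)"
          using elim(2) by (intro exceedance_le_rate) auto
      qed
    qed
  qed
  define err where "err \<beta> = e1 (a \<beta>) + P \<beta> * e2 (a \<beta>) + P \<beta> * (e3 (a \<beta>) * G \<beta>) + e4 (a \<beta>) + m (a \<beta>) * P \<beta>" for \<beta>
  have "(err \<longlongrightarrow> 0 + l * 0 + l * (0 * l) + 0 + 0 * l) (at_right 0)"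
    unfolding err_def[abs_def]
    by (intro tendsto_add tendsto_mult Plim Glim filterlim_compose[OF _ at] e1 e2 e3 e4 m0)
  then have err0: "(err \<longlongrightarrow> 0) (at_right 0)" by simp
  have small: "\<forall>\<^sub>F \<beta> in at_right 0. t (a \<beta>) < 1"
    using order_tendstoD(2)[OF filterlim_compose[OF t0 at], of 1] by simp
  have one: "\<forall>\<^sub>F \<beta>::real in at_right 0. \<beta> < 1"
    using order_tendstoD(2)[OF tendsto_ident_at[of "0::real" "{0<..}"], of 1] by simp
  have inv_drift: "\<forall>\<^sub>F \<beta> in at_right 0. 1 / \<beta> \<le> exp (q * (a \<beta>)\<^sup>2 / 2 + a \<beta>)"
    unfolding q_def a_def by (rule inverse_drift_le[OF r])
  have bound: "\<forall>\<^sub>F \<beta> in at_right 0. norm (prob (quiet (line \<beta>) (I \<beta>)) - exp (- P \<beta>)) \<le> err \<beta>"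
    using rng big eventually_at_right_pos small one inv_drift
  proof eventually_elim
    case (elim \<beta>)
    define x where "x = a \<beta>"
    have x: "4 < x" using elim by (simp add: x_def)
    have rg: "x - 1 \<le> line \<beta> i" "line \<beta> i \<le> x + 1" if "i \<in> I \<beta>" for i using elim(1) that by (auto simp: x_def)
    define n where "n = \<lfloor>(x + 1) / \<beta>\<rfloor>"
    have n0: "0 \<le> n" using elim x by (simp add: n_def)
    have sub: "I \<beta> \<subseteq> {- n..n}"
    proof
      fix i assume "i \<in> I \<beta>"
      then have "\<beta> * of_int \<bar>i\<bar> \<le> x + 1" by (rule rg)
      then have "of_int \<bar>i\<bar> \<le> (x + 1) / \<beta>" using elim(3) by (simp only: pos_le_divide_eq mult.commute)
      then have "\<bar>i\<bar> \<le> n" unfolding n_def by (simp only: le_floor_iff)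
      then show "i \<in> {- n..n}" by auto
    qed
    have fin: "finite (I \<beta>)" by (rule finite_subset[OF sub]) simp
    have "card (I \<beta>) \<le> card {- n..n}" using sub by (intro card_mono) auto
    then have "real (card (I \<beta>)) \<le> 2 * real_of_int n + 1" using n0 by simp
    also have "\<dots> \<le> 2 * ((x + 1) / \<beta>) + 1 / \<beta>"
    proof -
      have "real_of_int n \<le> (x + 1) / \<beta>" unfolding n_def by (rule of_int_floor_le)
      moreover have "1 \<le> 1 / \<beta>" using elim by simp
      ultimately show ?thesis by linarith
    qed
    also have "\<dots> = (2 * x + 3) * (1 / \<beta>)" by (simp add: add_divide_distrib[symmetric])
    also have "\<dots> \<le> N x" unfolding N_def using elim x by (intro mult_left_mono) (auto simp: x_def)
    finally have card: "real (card (I \<beta>)) \<le> N x" .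
    define L where "L = nat \<lfloor>exp (\<epsilon> * x\<^sup>2)\<rfloor>"
    have L: "real L \<le> exp (\<epsilon> * x\<^sup>2)" unfolding L_def by (simp add: of_nat_nat)
    have R0: "0 \<le> (q + 1) * x" and \<eta>0: "0 \<le> \<eta> x" using q x \<tau>(1) by (simp_all add: \<eta>_def)
    have far: "\<bar>\<rho> k\<bar> * ((q + 1) * x) \<le> \<eta> x" if "L < k" for k
    proof -
      have "exp (\<epsilon> * x\<^sup>2) < real k"
        using that unfolding L_def by (metis floor_less_iff nat_less_iff of_int_of_nat_eq zero_le_floor exp_ge_zero)
      then show ?thesis unfolding \<eta>_def using \<tau>(2) R0 by (intro mult_right_mono) auto
    qed
    have C: "0 \<le> tail_const d r" using tail_const_pos[OF r(2)] by simp
    have m_nonneg: "0 \<le> m x" using C by (simp add: m_def)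
    have pm: "prob (exceedance (line \<beta> i) i) \<le> m x" if "i \<in> I \<beta>" for i
    proof -
      have "prob (exceedance (line \<beta> i) i) \<le> tail_rate d r (line \<beta> i)" using rg[OF that] x by (intro exceedance_le_rate) auto
      also have "\<dots> \<le> tail_rate d r (x - 1)" using rg[OF that] x by (intro tail_rate_antimono) auto
      also have "\<dots> \<le> tail_const d r * exp (- real r * (x - 1)\<^sup>2 / 2) / 1"
        unfolding tail_rate_def using C x by (intro divide_left_mono one_le_power) auto
      finally show ?thesis by (simp add: m_def q_def)
    qed
    have P0: "0 \<le> P \<beta>" unfolding P_def by (intro sum_nonneg) auto
    let ?gap = "\<Sum>i\<in>I \<beta>. prob (exceedance (line \<beta> i - 2 * \<eta> x) i) - prob (exceedance (line \<beta> i + 2 * \<eta> x) i)"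
    have gap: "?gap \<le> e3 x * G \<beta>"
      unfolding e3_def \<kappa>_def G_def
    proof (rule shifted_exceedance_gap[OF fin])
      show "line \<beta> i * (2 * \<eta> x) \<le> t x" if "i \<in> I \<beta>" for i
        unfolding t_def using rg[OF that] \<eta>0 by (intro mult_right_mono) auto
    qed (use elim x rg \<eta>0 in \<open>auto simp: x_def\<close>)
    have Dr: "real r * (x - 1)\<^sup>2 / (1 + \<delta>) = q / D * (x - 1)\<^sup>2" by (simp add: q_def D_def)
    have "\<bar>prob (quiet (line \<beta>) (I \<beta>)) - exp (- P \<beta>)\<bar>
      \<le> real (card (I \<beta>)) * real L * (c * exp (- (q / D * (x - 1)\<^sup>2)))
      + P \<beta> * (real L * m x) + P \<beta> * ?gap
      + real (card (I \<beta>)) * (4 * real d * exp (- ((q + 1) * x)\<^sup>2 / 2)) + m x * P \<beta>"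
      unfolding P_def c_def Dr[symmetric]
      by (rule quiet_poisson_bound[OF fin _ _ \<delta>(1,3) R0 far \<eta>0 pm]) (use x rg in auto)
    also have "\<dots> \<le> N x * exp (\<epsilon> * x\<^sup>2) * (c * exp (- (q / D * (x - 1)\<^sup>2)))
      + P \<beta> * e2 x + P \<beta> * (e3 x * G \<beta>)
      + N x * (4 * real d * exp (- ((q + 1) * x)\<^sup>2 / 2)) + m x * P \<beta>"
      unfolding e2_def using card L m_nonneg P0 gap x
      by (intro add_mono mult_right_mono mult_left_mono mult_mono) (auto simp: N_def c_def)
    also have "\<dots> = err \<beta>"
      unfolding err_def e1_def e4_def x_def[symmetric] by (simp only: mult_ac)
    finally show ?case by simp
  qed
  have "((\<lambda>\<beta>. prob (quiet (line \<beta>) (I \<beta>)) - exp (- P \<beta>)) \<longlongrightarrow> 0) (at_right 0)"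
    by (rule Lim_null_comparison[OF bound err0])
  from tendsto_add[OF this tendsto_exp[OF tendsto_minus[OF Plim]]]
  show ?thesis by simp
qed

text \<open>A union bound over both half-lines beyond the window, summed by telescoping.\<close>

lemma prob_exceedance_beyond:
  fixes n :: int
  assumes \<beta>: "0 < \<beta>" and n: "0 < n"
  shows "prob (\<Union>i\<in>{i. n < \<bar>i\<bar>}. exceedance (line \<beta> i) i) \<le> 2 * (tail_mass d r (\<beta> * n) / \<beta>)"
proof -
  define A where "A k = exceedance (line \<beta> (n + 1 + int k)) (n + 1 + int k) \<union> exceedance (line \<beta> (- (n + 1 + int k))) (- (n + 1 + int k))" for k
  have A: "range A \<subseteq> sets M" by (auto simp: A_def)
  have "(\<Union>i\<in>{i. n < \<bar>i\<bar>}. exceedance (line \<beta> i) i) \<subseteq> (\<Union>k. A k)"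
  proof
    fix \<omega> assume "\<omega> \<in> (\<Union>i\<in>{i. n < \<bar>i\<bar>}. exceedance (line \<beta> i) i)"
    then obtain i where i: "n < \<bar>i\<bar>" "\<omega> \<in> exceedance (line \<beta> i) i" by auto
    have "\<bar>i\<bar> = n + 1 + int (nat (\<bar>i\<bar> - n - 1))" using i by simp
    then have "i = n + 1 + int (nat (\<bar>i\<bar> - n - 1)) \<or> i = - (n + 1 + int (nat (\<bar>i\<bar> - n - 1)))" by linarith
    then have "\<omega> \<in> A (nat (\<bar>i\<bar> - n - 1))" unfolding A_def using i(2) by (metis UnI1 UnI2)
    then show "\<omega> \<in> (\<Union>k. A k)" by blast
  qed
  then have 1: "prob (\<Union>i\<in>{i. n < \<bar>i\<bar>}. exceedance (line \<beta> i) i) \<le> prob (\<Union>k. A k)"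
    using A by (intro finite_measure_mono) auto
  have pA: "prob (A k) \<le> 2 * tail_rate d r (\<beta> * (n + 1 + int k))" for k
  proof -
    have pos: "0 < \<beta> * (n + 1 + int k)" using \<beta> n by simp
    have ab: "\<bar>n + 1 + int k\<bar> = n + 1 + int k" "\<bar>- (n + 1 + int k)\<bar> = n + 1 + int k" using n by auto
    have "prob (A k) \<le> prob (exceedance (line \<beta> (n + 1 + int k)) (n + 1 + int k)) + prob (exceedance (line \<beta> (- (n + 1 + int k))) (- (n + 1 + int k)))"
      unfolding A_def by (intro measure_Un_le) auto
    also have "\<dots> \<le> tail_rate d r (\<beta> * (n + 1 + int k)) + tail_rate d r (\<beta> * (n + 1 + int k))"
      unfolding ab by (intro add_mono exceedance_le_rate pos)
    finally show ?thesis by simp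
  qed
  have part: "(\<Sum>k<m. prob (A k)) \<le> 2 * (tail_mass d r (\<beta> * n) / \<beta>)" for m
  proof -
    have "(\<Sum>k<m. prob (A k)) \<le> (\<Sum>k<m. 2 * tail_rate d r (\<beta> * (n + 1 + int k)))"
      by (intro sum_mono pA)
    also have "\<dots> = 2 * (\<Sum>i\<in>{n<..n + int m}. tail_rate d r (\<beta> * i))"
      unfolding sum_distrib_left
      by (rule sum.reindex_bij_witness[of _ "\<lambda>i. nat (i - n - 1)" "\<lambda>k. n + 1 + int k"]) auto
    also have "\<dots> \<le> 2 * (tail_mass d r (\<beta> * n) / \<beta>)"
      using sum_tail_rate_upper[OF r \<beta> n, of "n + int m"] \<beta> by (simp add: pos_le_divide_eq mult.commute)
    finally show ?thesis .
  qed
  have summ: "summable (\<lambda>k. prob (A k))"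
    by (rule summableI_nonneg_bounded[OF _ part]) simp
  have "prob (\<Union>k. A k) \<le> (\<Sum>k. prob (A k))"
    by (rule finite_measure_subadditive_countably[OF A summ])
  also have "\<dots> \<le> 2 * (tail_mass d r (\<beta> * n) / \<beta>)"
    by (rule suminf_le_const[OF summ part])
  finally show ?thesis using 1 by linarith
qed

text \<open>The restriction to a bounded window is removed: indices beyond it exceed their levels with
  vanishing probability by \<open>tail_mass_beyond\<close>.\<close>

lemma poisson_limit:
  assumes decay: "(\<lambda>n. \<rho> n * ln (real n)) \<longlonglongrightarrow> 0"
    and low: "\<forall>\<^sub>F \<beta> in at_right 0. \<forall>i\<in>J \<beta>. norm_a d r \<beta> - 1 \<le> line \<beta> i"
    and sum: "((\<lambda>\<beta>. \<Sum>i\<in>{i\<in>J \<beta>. \<bar>i\<bar> \<le> \<lfloor>(norm_a d r \<beta> + 1) / \<beta>\<rfloor>}. tail_rate d r (line \<beta> i)) \<longlongrightarrow> l) (at_right 0)"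
  shows "((\<lambda>\<beta>. prob (quiet (line \<beta>) (J \<beta>))) \<longlongrightarrow> exp (- l)) (at_right 0)"
proof -
  obtain \<delta> where \<delta>: "0 \<le> \<delta>" "\<delta> < 1" "\<And>n. 1 \<le> n \<Longrightarrow> \<rho> n \<le> \<delta>"
    using correlation_bounded_away[OF decay] by blast
  define n where "n \<beta> = \<lfloor>(norm_a d r \<beta> + 1) / \<beta>\<rfloor>" for \<beta> :: real
  define I where "I \<beta> = {i\<in>J \<beta>. \<bar>i\<bar> \<le> n \<beta>}" for \<beta>
  note pos = eventually_at_right_pos
  have big: "\<forall>\<^sub>F \<beta> in at_right 0. 4 < norm_a d r \<beta>" using norm_a_at_top[OF r] by (simp add: filterlim_at_top_dense)
  have small: "\<forall>\<^sub>F \<beta>::real in at_right 0. \<beta> < 1" using order_tendstoD(2)[OF tendsto_ident_at[of "0::real" "{0<..}"], of 1] by simp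
  have lim: "((\<lambda>\<beta>. prob (quiet (line \<beta>) (I \<beta>))) \<longlongrightarrow> exp (- l)) (at_right 0)"
  proof (rule poisson_limit_window[OF \<delta> decay])
    show "\<forall>\<^sub>F \<beta> in at_right 0. \<forall>i\<in>I \<beta>. norm_a d r \<beta> - 1 \<le> line \<beta> i \<and> line \<beta> i \<le> norm_a d r \<beta> + 1"
      using low pos
    proof eventually_elim
      case (elim \<beta>)
      have "line \<beta> i \<le> norm_a d r \<beta> + 1" if "\<bar>i\<bar> \<le> n \<beta>" for i
      proof -
        have "line \<beta> i \<le> \<beta> * of_int (n \<beta>)" using that elim by (intro mult_left_mono) auto
        also have "\<dots> \<le> norm_a d r \<beta> + 1" unfolding n_def by (rule floor_multiple_bounds(1)[OF elim(2)])
        finally show ?thesis .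
      qed
      then show ?case using elim by (auto simp: I_def)
    qed
    show "((\<lambda>\<beta>. \<Sum>i\<in>I \<beta>. tail_rate d r (line \<beta> i)) \<longlongrightarrow> l) (at_right 0)"
      using sum unfolding I_def n_def .
  qed
  have "((\<lambda>\<beta>. prob (quiet (line \<beta>) (J \<beta>)) - prob (quiet (line \<beta>) (I \<beta>))) \<longlongrightarrow> 0) (at_right 0)"
  proof (rule Lim_null_comparison)
    have "((\<lambda>\<beta>. \<beta> * of_int (n \<beta>) - norm_a d r \<beta> - 1) \<longlongrightarrow> 0) (at_right 0)"
    proof (rule Lim_null_comparison)
      show "((\<lambda>\<beta>::real. \<beta>) \<longlongrightarrow> 0) (at_right 0)" by (rule tendsto_ident_at)
      show "\<forall>\<^sub>F \<beta> in at_right 0. norm (\<beta> * of_int (n \<beta>) - norm_a d r \<beta> - 1) \<le> \<beta>"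
        using pos
      proof eventually_elim
        case (elim \<beta>)
        then show ?case using floor_multiple_bounds[OF elim, of "norm_a d r \<beta> + 1"] unfolding n_def by (simp add: abs_le_iff)
      qed
    qed
    from tendsto_add[OF this tendsto_const[of 1]]
    have "((\<lambda>\<beta>. \<beta> * of_int (n \<beta>) - norm_a d r \<beta>) \<longlongrightarrow> 1) (at_right 0)" by simp
    from tendsto_mult[OF tendsto_const[of 2] tail_mass_beyond[OF r this]]
    show "((\<lambda>\<beta>. 2 * (tail_mass d r (\<beta> * of_int (n \<beta>)) / \<beta>)) \<longlongrightarrow> 0) (at_right 0)" by simp
    show "\<forall>\<^sub>F \<beta> in at_right 0. norm (prob (quiet (line \<beta>) (J \<beta>)) - prob (quiet (line \<beta>) (I \<beta>))) \<le> 2 * (tail_mass d r (\<beta> * of_int (n \<beta>)) / \<beta>)"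
      using pos big small
    proof eventually_elim
      case (elim \<beta>)
      have "1 \<le> (norm_a d r \<beta> + 1) / \<beta>" using elim by (simp add: pos_le_divide_eq)
      then have n0: "0 < n \<beta>" unfolding n_def by linarith
      let ?B = "\<Union>i\<in>{i. n \<beta> < \<bar>i\<bar>}. exceedance (line \<beta> i) i"
      have B: "?B \<in> sets M" by (intro sets.countable_UN') auto
      have "prob (quiet (line \<beta>) (I \<beta>)) \<le> prob (quiet (line \<beta>) (J \<beta>) \<union> ?B)"
      proof (rule finite_measure_mono)
        show "quiet (line \<beta>) (I \<beta>) \<subseteq> quiet (line \<beta>) (J \<beta>) \<union> ?B"
        proof
          fix \<omega> assume w: "\<omega> \<in> quiet (line \<beta>) (I \<beta>)"
          have "\<omega> \<notin> exceedance (line \<beta> l) l" if "\<omega> \<notin> ?B" "l \<in> J \<beta>" for l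
            using w that by (cases "\<bar>l\<bar> \<le> n \<beta>") (auto simp: quiet_def I_def)
          with w show "\<omega> \<in> quiet (line \<beta>) (J \<beta>) \<union> ?B" unfolding quiet_def by blast
        qed
      qed (use B in simp)
      also have "\<dots> \<le> prob (quiet (line \<beta>) (J \<beta>)) + prob ?B" using B by (intro measure_Un_le) auto
      finally have 1: "prob (quiet (line \<beta>) (I \<beta>)) \<le> prob (quiet (line \<beta>) (J \<beta>)) + prob ?B" .
      have 2: "prob (quiet (line \<beta>) (J \<beta>)) \<le> prob (quiet (line \<beta>) (I \<beta>))"
        by (intro finite_measure_mono) (auto simp: quiet_def I_def)
      show ?case using 1 2 prob_exceedance_beyond[OF elim(1) n0] by simp
    qed
  qed
  from tendsto_add[OF this lim] show ?thesis by simp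
qed

lemma norm_u_window:
  "\<forall>\<^sub>F \<beta> in at_right 0. 0 < norm_u d r \<beta> x \<and> norm_a d r \<beta> - 1 \<le> \<beta> * norm_u d r \<beta> x"
proof -
  have inv: "((\<lambda>\<beta>. inverse (norm_a d r \<beta>)) \<longlongrightarrow> 0) (at_right 0)"
    by (rule filterlim_compose[OF tendsto_inverse_0_at_top[OF filterlim_ident] norm_a_at_top[OF r]])
  have "((\<lambda>\<beta>. x / (real r * norm_a d r \<beta>)) \<longlongrightarrow> 0) (at_right 0)"
    using tendsto_mult[OF tendsto_const[of "x / real r"] inv] by (simp add: field_simps)
  then have "\<forall>\<^sub>F \<beta> in at_right 0. - 1 < x / (real r * norm_a d r \<beta>)" by (rule order_tendstoD) simp
  moreover have "\<forall>\<^sub>F \<beta> in at_right 0. 4 < norm_a d r \<beta>" using norm_a_at_top[OF r] by (simp add: filterlim_at_top_dense)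
  ultimately show ?thesis using eventually_at_right_pos
    by eventually_elim (simp add: norm_u_def)
qed

text \<open>The two half-lines contribute \<open>exp (- x)\<close> and \<open>exp (- y)\<close> to the expected number of exceedances;
  the reflection \<open>i \<mapsto> - i\<close> reduces the left one to the right one.\<close>

lemma crossing_limits:
  assumes decay: "(\<lambda>n. \<rho> n * ln (real n)) \<longlonglongrightarrow> 0"
  shows "((\<lambda>\<beta>. prob (quiet (line \<beta>) ({i. of_int i < - norm_u d r \<beta> x} \<union> {i. norm_u d r \<beta> y < of_int i}))) \<longlongrightarrow> exp (- (exp (- x) + exp (- y)))) (at_right 0)"
    and "((\<lambda>\<beta>. prob (quiet (line \<beta>) {i. of_int i < - norm_u d r \<beta> x})) \<longlongrightarrow> exp (- exp (- x))) (at_right 0)"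
    and "((\<lambda>\<beta>. prob (quiet (line \<beta>) {i. norm_u d r \<beta> x < of_int i})) \<longlongrightarrow> exp (- exp (- x))) (at_right 0)"
proof -
  define n where "n \<beta> = \<lfloor>(norm_a d r \<beta> + 1) / \<beta>\<rfloor>" for \<beta> :: real
  let ?S = "\<lambda>(\<beta>::real) z. \<Sum>i\<in>{\<lfloor>norm_u d r \<beta> z\<rfloor><..n \<beta>}. tail_rate d r (\<beta> * i)"
  have S: "((\<lambda>\<beta>. ?S \<beta> z) \<longlongrightarrow> exp (- z)) (at_right 0)" for z
    using window_sum_limit[OF r, of z] unfolding n_def .
  let ?Rt = "\<lambda>\<beta> z. {i::int. norm_u d r \<beta> z < of_int i}" and ?Lf = "\<lambda>\<beta> z. {i::int. of_int i < - norm_u d r \<beta> z}"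
  have sumR: "(\<Sum>i\<in>{i\<in>?Rt \<beta> z. \<bar>i\<bar> \<le> n \<beta>}. tail_rate d r (line \<beta> i)) = ?S \<beta> z" if "0 < norm_u d r \<beta> z" for \<beta> z
  proof (rule sum.cong)
    show "{i\<in>?Rt \<beta> z. \<bar>i\<bar> \<le> n \<beta>} = {\<lfloor>norm_u d r \<beta> z\<rfloor><..n \<beta>}"
      using that by (auto simp: floor_less_iff)
    show "tail_rate d r (line \<beta> i) = tail_rate d r (\<beta> * i)" if "i \<in> {\<lfloor>norm_u d r \<beta> z\<rfloor><..n \<beta>}" for i
    proof -
      have "norm_u d r \<beta> z < of_int i" using that by (simp add: floor_less_iff)
      then have "0 < i" using \<open>0 < norm_u d r \<beta> z\<close> by linarith
      then show ?thesis by simp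
    qed
  qed
  have sumL: "(\<Sum>i\<in>{i\<in>?Lf \<beta> z. \<bar>i\<bar> \<le> n \<beta>}. tail_rate d r (line \<beta> i)) = ?S \<beta> z" if "0 < norm_u d r \<beta> z" for \<beta> z
  proof -
    have "(\<Sum>i\<in>{i\<in>?Lf \<beta> z. \<bar>i\<bar> \<le> n \<beta>}. tail_rate d r (line \<beta> i)) = (\<Sum>i\<in>{i\<in>?Rt \<beta> z. \<bar>i\<bar> \<le> n \<beta>}. tail_rate d r (line \<beta> i))"
      by (rule sum.reindex_bij_witness[of _ uminus uminus]) auto
    then show ?thesis using sumR[OF that] by simp
  qed
  have fin: "finite {i\<in>A. \<bar>i\<bar> \<le> k}" for A and k :: int
    by (rule finite_subset[of _ "{-k..k}"]) auto
  have sumLR: "(\<Sum>i\<in>{i\<in>?Lf \<beta> x \<union> ?Rt \<beta> y. \<bar>i\<bar> \<le> n \<beta>}. tail_rate d r (line \<beta> i)) = ?S \<beta> x + ?S \<beta> y"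
    if "0 < norm_u d r \<beta> x" "0 < norm_u d r \<beta> y" for \<beta>
  proof -
    have "{i\<in>?Lf \<beta> x \<union> ?Rt \<beta> y. \<bar>i\<bar> \<le> n \<beta>} = {i\<in>?Lf \<beta> x. \<bar>i\<bar> \<le> n \<beta>} \<union> {i\<in>?Rt \<beta> y. \<bar>i\<bar> \<le> n \<beta>}" by auto
    moreover have "{i\<in>?Lf \<beta> x. \<bar>i\<bar> \<le> n \<beta>} \<inter> {i\<in>?Rt \<beta> y. \<bar>i\<bar> \<le> n \<beta>} = {}" using that by auto
    ultimately have "(\<Sum>i\<in>{i\<in>?Lf \<beta> x \<union> ?Rt \<beta> y. \<bar>i\<bar> \<le> n \<beta>}. tail_rate d r (line \<beta> i))
      = (\<Sum>i\<in>{i\<in>?Lf \<beta> x. \<bar>i\<bar> \<le> n \<beta>}. tail_rate d r (line \<beta> i)) + (\<Sum>i\<in>{i\<in>?Rt \<beta> y. \<bar>i\<bar> \<le> n \<beta>}. tail_rate d r (line \<beta> i))"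
      using fin by (simp only: sum.union_disjoint)
    then show ?thesis using sumL[OF that(1)] sumR[OF that(2)] by simp
  qed
  have low: "norm_a d r \<beta> - 1 \<le> line \<beta> i"
    if "0 < \<beta>" "norm_a d r \<beta> - 1 \<le> \<beta> * norm_u d r \<beta> z" "norm_u d r \<beta> z < \<bar>real_of_int i\<bar>" for \<beta> z i
  proof -
    have "\<beta> * norm_u d r \<beta> z \<le> line \<beta> i" using that by (intro mult_left_mono) auto
    then show ?thesis using that by linarith
  qed
  \<comment> \<open>The one-sided cases are obtained with \<open>y = x\<close>.\<close>
  have limit_along: "((\<lambda>\<beta>. prob (quiet (line \<beta>) (J \<beta>))) \<longlongrightarrow> exp (- l)) (at_right 0)"
    if J: "\<And>\<beta> i. 0 < norm_u d r \<beta> x \<Longrightarrow> 0 < norm_u d r \<beta> y \<Longrightarrow> i \<in> J \<beta> \<Longrightarrow>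
        norm_u d r \<beta> x < \<bar>real_of_int i\<bar> \<or> norm_u d r \<beta> y < \<bar>real_of_int i\<bar>"
      and f: "(f \<longlongrightarrow> l) (at_right 0)"
      and sum: "\<And>\<beta>. 0 < norm_u d r \<beta> x \<Longrightarrow> 0 < norm_u d r \<beta> y \<Longrightarrow>
        (\<Sum>i\<in>{i\<in>J \<beta>. \<bar>i\<bar> \<le> n \<beta>}. tail_rate d r (line \<beta> i)) = f \<beta>" for J f l x y
  proof (rule poisson_limit[OF decay])
    show "\<forall>\<^sub>F \<beta> in at_right 0. \<forall>i\<in>J \<beta>. norm_a d r \<beta> - 1 \<le> line \<beta> i"
      using norm_u_window[of x] norm_u_window[of y] eventually_at_right_pos
    proof eventually_elim
      case (elim \<beta>)
      show ?case
      proof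
        fix i assume "i \<in> J \<beta>"
        then show "norm_a d r \<beta> - 1 \<le> line \<beta> i"
          using J[of \<beta> i] low[of \<beta> x i] low[of \<beta> y i] elim by blast
      qed
    qed
    have "\<forall>\<^sub>F \<beta> in at_right 0. f \<beta> = (\<Sum>i\<in>{i\<in>J \<beta>. \<bar>i\<bar> \<le> n \<beta>}. tail_rate d r (line \<beta> i))"
      using norm_u_window[of x] norm_u_window[of y] by eventually_elim (simp only: sum)
    from Lim_transform_eventually[OF f this]
    show "((\<lambda>\<beta>. \<Sum>i\<in>{i\<in>J \<beta>. \<bar>i\<bar> \<le> \<lfloor>(norm_a d r \<beta> + 1) / \<beta>\<rfloor>}. tail_rate d r (line \<beta> i)) \<longlongrightarrow> l) (at_right 0)"
      unfolding n_def .
  qed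
  show "((\<lambda>\<beta>. prob (quiet (line \<beta>) (?Lf \<beta> x \<union> ?Rt \<beta> y))) \<longlongrightarrow> exp (- (exp (- x) + exp (- y)))) (at_right 0)"
    by (rule limit_along[of x y, OF _ tendsto_add[OF S S]]) (auto simp only: sumLR)
  show "((\<lambda>\<beta>. prob (quiet (line \<beta>) (?Lf \<beta> x))) \<longlongrightarrow> exp (- exp (- x))) (at_right 0)"
    by (rule limit_along[of x x, OF _ S]) (auto simp only: sumL)
  show "((\<lambda>\<beta>. prob (quiet (line \<beta>) (?Rt \<beta> x))) \<longlongrightarrow> exp (- exp (- x))) (at_right 0)"
    by (rule limit_along[of x x, OF _ S]) (auto simp only: sumR)
qed

end

section \<open>First crossing point and last exit time\<close>

lemma first_crossing_ge_iff:
  "ereal (- u) \<le> first_crossing Z \<beta> \<omega> \<longleftrightarrow> (\<forall>i. real_of_int i < - u \<longrightarrow> \<not> Z i \<omega> > - \<beta> * of_int i)"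
  unfolding first_crossing_def by (auto simp: le_INF_iff not_less)

text \<open>For \<open>u \<ge> 0\<close> the convention for an empty exit set and the restriction to \<open>i \<ge> 0\<close> make no
  difference.\<close>

lemma last_exit_le_iff:
  assumes "0 \<le> u"
  shows "last_exit Z \<beta> \<omega> \<le> ereal u \<longleftrightarrow> (\<forall>i. u < real_of_int i \<longrightarrow> \<not> Z i \<omega> > \<beta> * of_int i)"
proof -
  have "last_exit Z \<beta> \<omega> \<le> ereal u \<longleftrightarrow> (\<forall>i\<in>{i. 0 \<le> i \<and> Z i \<omega> > \<beta> * of_int i}. ereal (of_int i) \<le> ereal u)"
    unfolding last_exit_def using assms by (auto simp: SUP_le_iff)
  also have "\<dots> \<longleftrightarrow> (\<forall>i. u < real_of_int i \<longrightarrow> \<not> Z i \<omega> > \<beta> * of_int i)"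
  proof -
    have "0 \<le> i" if "u < real_of_int i" for i using that assms by linarith
    then show ?thesis by (auto simp: not_less) (meson not_le)
  qed
  finally show ?thesis .
qed

lemma seq_law_functional:
  assumes "(\<lambda>\<omega> i. A i \<omega>) \<in> measurable M seq_space" "(\<lambda>\<omega> i. B i \<omega>) \<in> measurable M seq_space"
    and "seq_law M A = seq_law M B" and f: "f \<in> measurable seq_space (borel :: real measure)"
  shows "distr M borel (\<lambda>\<omega>. f (\<lambda>i. A i \<omega>)) = distr M borel (\<lambda>\<omega>. f (\<lambda>i. B i \<omega>))"
    and "(\<integral>\<omega>. f (\<lambda>i. A i \<omega>) \<partial>M) = (\<integral>\<omega>. f (\<lambda>i. B i \<omega>) \<partial>M)"
proof -
  have A: "distr M borel (\<lambda>\<omega>. f (\<lambda>i. A i \<omega>)) = distr (seq_law M A) borel f" "(\<integral>\<omega>. f (\<lambda>i. A i \<omega>) \<partial>M) = (\<integral>g. f g \<partial>seq_law M A)"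
    unfolding seq_law_def using assms(1) f by (simp_all add: distr_distr o_def integral_distr)
  have B: "distr M borel (\<lambda>\<omega>. f (\<lambda>i. B i \<omega>)) = distr (seq_law M B) borel f" "(\<integral>\<omega>. f (\<lambda>i. B i \<omega>) \<partial>M) = (\<integral>g. f g \<partial>seq_law M B)"
    unfolding seq_law_def using assms(2) f by (simp_all add: distr_distr o_def integral_distr)
  show "distr M borel (\<lambda>\<omega>. f (\<lambda>i. A i \<omega>)) = distr M borel (\<lambda>\<omega>. f (\<lambda>i. B i \<omega>))"
    "(\<integral>\<omega>. f (\<lambda>i. A i \<omega>) \<partial>M) = (\<integral>\<omega>. f (\<lambda>i. B i \<omega>) \<partial>M)"
    unfolding A B assms(3) by simp_all
qed

text \<open>All assumptions of the locale concern laws of columns, which coincide with the law of \<open>X\<close>;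
  stationarity reduces a general covariance to one involving the index \<open>1\<close>.\<close>

lemma gaussian_columns_of_copies:
  assumes M: "prob_space M" and r: "1 \<le> r" "r \<le> d"
    and gauss: "gaussian_seq M X" and stat: "stationary_seq M X" and std: "standard_seq M X"
    and copies: "independent_copies M X d Y"
  shows "gaussian_columns M Y d r (cov_fun M X)"
proof -
  interpret prob_space M by fact
  have Xi: "X i \<in> borel_measurable M" for i using stat by (simp add: stationary_seq_def)
  have Xm: "(\<lambda>\<omega> i. X (i + k) \<omega>) \<in> measurable M seq_space" for k
    using Xi by (intro measurable_PiM_single') auto
  have X0m: "(\<lambda>\<omega> i. X i \<omega>) \<in> measurable M seq_space" using Xm[of 0] by simp
  have indep: "indep_vars (\<lambda>_. seq_space) (\<lambda>j \<omega> i. Y j i \<omega>) {1..d}"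
    and law: "j \<in> {1..d} \<Longrightarrow> seq_law M (Y j) = seq_law M X" for j
    using copies by (auto simp: independent_copies_def)
  have Ym: "(\<lambda>\<omega> i. Y j i \<omega>) \<in> measurable M seq_space" if "j \<in> {1..d}" for j
    using indep that by (auto simp: indep_vars_def)
  have proj: "(\<lambda>f. f i) \<in> borel_measurable seq_space" for i :: int by simp
  have s: "\<forall>i. expectation (X i) = 0 \<and> variance (X i) = 1"
    using std unfolding standard_seq_def .
  have meanX: "expectation (X i) = 0" and varX: "variance (X i) = 1" for i
    using s by blast+
  have covX: "(\<integral>\<omega>. X i \<omega> * X (i + int n) \<omega> \<partial>M) = cov_fun M X n" for i n
  proof -
    have "(\<integral>\<omega>. (\<lambda>f. f 1 * f (int n + 1)) (\<lambda>l. X (l + (i - 1)) \<omega>) \<partial>M) = (\<integral>\<omega>. (\<lambda>f. f 1 * f (int n + 1)) (\<lambda>l. X l \<omega>) \<partial>M)"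
    proof (rule seq_law_functional(2)[OF Xm X0m])
      show "seq_law M (\<lambda>l. X (l + (i - 1))) = seq_law M X" using stat by (simp add: stationary_seq_def)
      show "(\<lambda>f. f 1 * f (int n + 1)) \<in> borel_measurable seq_space"
        by (intro borel_measurable_times proj)
    qed
    then show ?thesis by (simp add: cov_fun_def algebra_simps)
  qed
  show ?thesis
  proof (unfold_locales)
    show "1 \<le> r" "r \<le> d" by (fact r)+
    show "indep_vars (\<lambda>_. seq_space) (\<lambda>j \<omega> i. Y j i \<omega>) {1..d}" by (fact indep)
    show "cov_fun M X 0 = 1"
      using varX[of 1] meanX[of 1] by (simp add: cov_fun_def power2_eq_square)
    fix j assume j: "j \<in> {1..d}"
    show "gaussian_seq M (Y j)"
      unfolding gaussian_seq_def
    proof (intro allI impI)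
      fix I :: "int set" and c :: "int \<Rightarrow> real"
      assume I: "finite I"
      have f: "(\<lambda>f. \<Sum>i\<in>I. c i * f i) \<in> borel_measurable seq_space"
        by (intro borel_measurable_sum borel_measurable_times proj) simp
      show "gaussian_rv M (\<lambda>\<omega>. \<Sum>i\<in>I. c i * Y j i \<omega>)"
      proof (rule gaussian_rv_transfer)
        show "gaussian_rv M (\<lambda>\<omega>. \<Sum>i\<in>I. c i * X i \<omega>)" using gauss I by (simp add: gaussian_seq_def)
        show "(\<lambda>\<omega>. \<Sum>i\<in>I. c i * Y j i \<omega>) \<in> borel_measurable M"
          using measurable_compose[OF Ym[OF j] f] by simp
        show "distr M borel (\<lambda>\<omega>. \<Sum>i\<in>I. c i * X i \<omega>) = distr M borel (\<lambda>\<omega>. \<Sum>i\<in>I. c i * Y j i \<omega>)"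
          using seq_law_functional(1)[OF X0m Ym[OF j] law[OF j, symmetric] f] by simp
      qed
    qed
    show "expectation (Y j i) = 0" for i
      using seq_law_functional(2)[OF Ym[OF j] X0m law[OF j] proj[of i]] meanX[of i] by simp
    show "expectation (\<lambda>\<omega>. Y j i \<omega> * Y j k \<omega>) = cov_fun M X (nat \<bar>i - k\<bar>)" for i k
    proof -
      have f: "(\<lambda>f. f i * f k) \<in> borel_measurable seq_space" by (intro borel_measurable_times proj)
      have "expectation (\<lambda>\<omega>. Y j i \<omega> * Y j k \<omega>) = expectation (\<lambda>\<omega>. X i \<omega> * X k \<omega>)"
        using seq_law_functional(2)[OF Ym[OF j] X0m law[OF j] f] by simp
      also have "\<dots> = cov_fun M X (nat \<bar>i - k\<bar>)"
      proof (cases "i \<le> k")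
        case True
        then show ?thesis using covX[of i "nat (k - i)"] by simp
      next
        case False
        then show ?thesis using covX[of k "nat (i - k)"] by (simp add: mult.commute)
      qed
      finally show ?thesis .
    qed
  qed
qed

theorem theorem2p1:
  fixes M :: "'a measure"
    and X :: "int \<Rightarrow> 'a \<Rightarrow> real"
    and Y :: "nat \<Rightarrow> int \<Rightarrow> 'a \<Rightarrow> real"
    and d r :: nat
    and x y :: real
  assumes "prob_space M"
    and "d \<ge> 1" and "1 \<le> r" and "r \<le> d"
    and "gaussian_seq M X" and "stationary_seq M X" and "standard_seq M X"
    and "independent_copies M X d Y"
    and "(\<lambda>n. cov_fun M X n * ln (real n)) \<longlonglongrightarrow> 0"
  shows "((\<lambda>\<beta>. \<P>(\<omega> in M. first_crossing (order_stat Y d r) \<beta> \<omega> \<ge> ereal (- norm_u d r \<beta> x) \<and>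
                         last_exit (order_stat Y d r) \<beta> \<omega> \<le> ereal (norm_u d r \<beta> y)))
            \<longlongrightarrow> exp (- (exp (- x) + exp (- y)))) (at_right 0) \<and>
         ((\<lambda>\<beta>. \<P>(\<omega> in M. first_crossing (order_stat Y d r) \<beta> \<omega> \<ge> ereal (- norm_u d r \<beta> x)))
            \<longlongrightarrow> exp (- exp (- x))) (at_right 0) \<and>
         ((\<lambda>\<beta>. \<P>(\<omega> in M. last_exit (order_stat Y d r) \<beta> \<omega> \<le> ereal (norm_u d r \<beta> x)))
            \<longlongrightarrow> exp (- exp (- x))) (at_right 0)"
proof -
  interpret gaussian_columns M Y d r "cov_fun M X"
    by (rule gaussian_columns_of_copies) (fact assms)+
  let ?Z = "order_stat Y d r"
  have first: "first_crossing ?Z \<beta> \<omega> \<ge> ereal (- u) \<longleftrightarrow> (\<forall>l\<in>{i. real_of_int i < - u}. \<omega> \<notin> exceedance (line \<beta> l) l)"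
    if "0 < u" "\<omega> \<in> space M" for u \<beta> \<omega>
  proof -
    have "- \<beta> * of_int i = line \<beta> i" if "real_of_int i < - u" for i using that \<open>0 < u\<close> by simp
    then show ?thesis
      unfolding first_crossing_ge_iff order_stat_gt_iff[OF r]
      using that by (auto simp: exceedance_def)
  qed
  have last: "last_exit ?Z \<beta> \<omega> \<le> ereal u \<longleftrightarrow> (\<forall>l\<in>{i. u < real_of_int i}. \<omega> \<notin> exceedance (line \<beta> l) l)"
    if "0 < u" "\<omega> \<in> space M" for u \<beta> \<omega>
  proof -
    have "\<beta> * of_int i = line \<beta> i" if "u < real_of_int i" for i using that \<open>0 < u\<close> by simp
    then show ?thesis
      unfolding last_exit_le_iff[OF less_imp_le[OF that(1)]] order_stat_gt_iff[OF r]
      using that by (auto simp: exceedance_def)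
  qed
  note limits = crossing_limits[OF assms(9)]
  have upos: "\<forall>\<^sub>F \<beta> in at_right 0. 0 < norm_u d r \<beta> z" for z
    using norm_u_window[of z] by eventually_elim simp
  have "\<forall>\<^sub>F \<beta> in at_right 0. prob (quiet (line \<beta>) ({i. of_int i < - norm_u d r \<beta> x} \<union> {i. norm_u d r \<beta> y < of_int i}))
      = \<P>(\<omega> in M. first_crossing ?Z \<beta> \<omega> \<ge> ereal (- norm_u d r \<beta> x) \<and> last_exit ?Z \<beta> \<omega> \<le> ereal (norm_u d r \<beta> y))"
    using upos[of x] upos[of y] unfolding quiet_def
    by eventually_elim (intro arg_cong[where f=prob] Collect_cong conj_cong refl, simp only: ball_Un first last)
  moreover have "\<forall>\<^sub>F \<beta> in at_right 0. prob (quiet (line \<beta>) {i. of_int i < - norm_u d r \<beta> x})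
      = \<P>(\<omega> in M. first_crossing ?Z \<beta> \<omega> \<ge> ereal (- norm_u d r \<beta> x))"
    using upos[of x] unfolding quiet_def
    by eventually_elim (intro arg_cong[where f=prob] Collect_cong conj_cong refl, simp only: first)
  moreover have "\<forall>\<^sub>F \<beta> in at_right 0. prob (quiet (line \<beta>) {i. norm_u d r \<beta> x < of_int i})
      = \<P>(\<omega> in M. last_exit ?Z \<beta> \<omega> \<le> ereal (norm_u d r \<beta> x))"
    using upos[of x] unfolding quiet_def
    by eventually_elim (intro arg_cong[where f=prob] Collect_cong conj_cong refl, simp only: last)
  ultimately show ?thesis
    using limits(1)[of x y] limits(2)[of x] limits(3)[of x]
    by (intro conjI) (rule Lim_transform_eventually; assumption)+
qed

end
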